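(* Let $N\ge 1$ and $0<\theta\le 2$. Let $f\in C^1(0,\infty)\cap C[0,\infty)$ satisfy $f(u)>0$ for $u>0$, $f'(u)\ge 0$ for $u\ge 0$ (wherever $f'$ is defined), $F(u):=\int_u^\infty \frac{dt}{f(t)}<\infty$ for large $u>0$, and suppose that the limit $q:=\lim_{u\to\infty}f'(u)F(u)$ exists and $q=1$. For a nonnegative measurable function $\phi$ on $\mathbb{R}^N$ consider the Cauchy problem $$\partial_t u+(-\Delta)^{\theta/2}u=f(u)\ \text{ in } \mathbb{R}^N\times(0,T),\qquad u(x,0)=\phi(x)\ \text{ in }\mathbb{R}^N. \qquad (P)$$ Then the following hold. (i) Assume that $r>N/\theta$, that $f(u)$ is convex for large $u>0$, and that $f'(u)F(u)\le 1$ for large $u>0$. If $\phi\ge 0$ and $F(\phi)^{-r}\in L^1_{\mathrm{ul},\rho}(\mathbb{R}^N)$, then (P) has a local-in-time (integral) solution. (ii) Assume that $f(u)$ is convex for $u\ge 0$. For any $r\in(0,N/\theta)$ there is $\phi\ge 0$ such that $F(\phi)^{-r}\in L^1_{\mathrm{ul},\rho}(\mathbb{R}^N)$ and (P) does not have a local-in-time nonnegative (integral) solution.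
   Context: Uniformly local space: for a fixed $\rho>0$, $L^1_{\mathrm{ul},\rho}(\mathbb{R}^N)$ is the set of $u\in L^1_{\mathrm{loc}}(\mathbb{R}^N)$ with $\sup_{y\in\mathbb{R}^N}\int_{B_y(\rho)}|u(x)|\,dx<\infty$, where $B_y(\rho)=\{x:|x-y|<\rho\}$. Function $F$: $F$ is finite and strictly decreasing on $(0,\infty)$, with $0<F(0)\le\infty$. $F(\phi)^{-r}$ means $1/F(\phi(x))^{r}$ (with value $0$ where $F(\phi(x))=\infty$). Semigroup: $G(x,t)=(2\pi)^{-N}\int_{\mathbb{R}^N}e^{ix\cdot\xi-t|\xi|^\theta}d\xi$ is the fundamental solution of $\partial_tu+(-\Delta)^{\theta/2}u=0$ (a positive function with $\int_{\mathbb{R}^N} G(x,t)dx=1$), and $S(t)[\psi](x)=\int_{\mathbb{R}^N}G(x-y,t)\psi(y)\,dy$; for nonnegative measurable $\psi$ this takes values in $[0,\infty]$. Integral solution: a nonnegative measurable function $u$ on $\mathbb{R}^N\times(0,T)$ is a solution of (P) on $(0,T)$ if $$\infty>u(t)=S(t)\phi+\int_0^tS(t-s)f(u(s))\,ds\quad\text{a.e. } x\in\mathbb{R}^N,\ 0<t<T.$$ (P) has a local-in-time solution if such a $u$ exists for some $T>0$. *)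

theory Defs
  imports "HOL-Analysis.Analysis"
begin

text \<open>
  Throughout, the space \<open>\<real>\<^sup>N\<close> is an arbitrary type of class \<open>euclidean_space\<close> and
  \<open>N = DIM('a)\<close>, so that \<open>N \<ge> 1\<close> is automatic. Quantities that may be infinite take values in
  \<open>ennreal\<close>. Measurable means Lebesgue measurable.
\<close>

definition L1_loc :: "('a::euclidean_space \<Rightarrow> real) set" where
  "L1_loc = {u. \<forall>K. compact K \<longrightarrow> u absolutely_integrable_on K}"

definition L1_ul :: "real \<Rightarrow> ('a::euclidean_space \<Rightarrow> real) set" where
  "L1_ul \<rho> = {u \<in> L1_loc. (SUP y. \<integral>\<^sup>+x\<in>ball y \<rho>. ennreal \<bar>u x\<bar> \<partial>lebesgue) < \<infinity>}"

text \<open>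
  The domain of integration is the open half-line because \<open>f 0 = 0\<close> is allowed.
\<close>
definition F_of :: "(real \<Rightarrow> real) \<Rightarrow> real \<Rightarrow> ennreal" where
  "F_of f u = (\<integral>\<^sup>+t\<in>{u<..}. ennreal (1 / f t) \<partial>lebesgue)"

definition F_neg_pow :: "(real \<Rightarrow> real) \<Rightarrow> real \<Rightarrow> real \<Rightarrow> real" where
  "F_neg_pow f r u = (if F_of f u = \<infinity> then 0 else 1 / enn2real (F_of f u) powr r)"

text \<open>
  The Fourier integral is real, since its integrand is conjugated by \<open>\<xi> \<mapsto> - \<xi>\<close>; \<open>Re\<close> only
  changes the type.
\<close>
definition G :: "real \<Rightarrow> 'a::euclidean_space \<Rightarrow> real \<Rightarrow> real" where
  "G \<theta> x t = Re (1 / (2 * of_real pi) ^ DIM('a) *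
     (LINT \<xi>|lborel. exp (\<i> * of_real (x \<bullet> \<xi>) - of_real (t * norm \<xi> powr \<theta>))))"

definition S :: "real \<Rightarrow> real \<Rightarrow> ('a::euclidean_space \<Rightarrow> ennreal) \<Rightarrow> 'a \<Rightarrow> ennreal" where
  "S \<theta> t \<psi> x = (\<integral>\<^sup>+y. ennreal (G \<theta> (x - y) t) * \<psi> y \<partial>lebesgue)"

text \<open>
  The identity is required for every \<open>t \<in> (0,T)\<close> and almost every \<open>x\<close>. As \<open>u\<close> is real-valued,
  the identity contains the finiteness of both sides.
\<close>
definition integral_solution ::
  "real \<Rightarrow> (real \<Rightarrow> real) \<Rightarrow> ('a::euclidean_space \<Rightarrow> real) \<Rightarrow> real \<Rightarrow> ('a \<Rightarrow> real \<Rightarrow> real) \<Rightarrow> bool"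
where
  "integral_solution \<theta> f \<phi> T u \<longleftrightarrow>
     (\<lambda>(x, t). u x t) \<in> borel_measurable (lebesgue_on (UNIV \<times> {0<..<T})) \<and>
     (\<forall>x. \<forall>t\<in>{0<..<T}. 0 \<le> u x t) \<and>
     (\<forall>t\<in>{0<..<T}. AE x in lebesgue.
        ennreal (u x t) =
          S \<theta> t (\<lambda>y. ennreal (\<phi> y)) x +
          (\<integral>\<^sup>+s\<in>{0<..<t}. S \<theta> (t - s) (\<lambda>y. ennreal (f (u y s))) x \<partial>lebesgue))"

definition has_local_solution ::
  "real \<Rightarrow> (real \<Rightarrow> real) \<Rightarrow> ('a::euclidean_space \<Rightarrow> real) \<Rightarrow> bool"
where
  "has_local_solution \<theta> f \<phi> \<longleftrightarrow> (\<exists>T>0. \<exists>u. integral_solution \<theta> f \<phi> T u)"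

end

theory Submission
  imports Defs "HOL-Probability.Probability"
begin

text \<open>
  Multiplication by \<open>exp (- s * \<bar>\<xi>\<bar>\<^sup>2)\<close> preserves the class of \<open>h\<close> whose products with Gaussians have
  nonnegative, radially decreasing Fourier transforms, and so do mixtures and bounded limits. Since
  \<open>\<bar>\<xi>\<bar>\<close> to the power \<open>\<theta> < 2\<close> is a mixture of \<open>1 - exp (- s * \<bar>\<xi>\<bar>\<^sup>2)\<close>, expanding the
  exponential shows that \<open>G\<close> is nonnegative and radially decreasing. Pairing \<open>G\<close> with Gaussians then
  gives its total mass, the semigroup law and the tail bound \<open>C * t * R powr (- \<theta>)\<close>.

  Existence: for large arguments \<open>f * F\<close> is decreasing, so \<open>F\<close> to the power \<open>- r\<close> is convex there, and
  Jensen's inequality with the \<open>L\<^sup>1\<close> to \<open>L\<^sup>\<infinity>\<close> estimate gives \<open>F (S(t)\<phi>) \<ge> b * t powr \<alpha>\<close> with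
  \<open>\<alpha> = N / (\<theta> * r) < 1\<close>. Put \<open>F (v t) = b * t powr \<alpha>\<close> and \<open>F (w t) = b * t powr \<alpha> / 2\<close>. Then
  \<open>f (w t)\<close> is at most a multiple of \<open>t powr (- \<alpha>)\<close>, while \<open>w t - v t\<close> decays slower than every positive
  power of \<open>t\<close>, so that \<open>w\<close> bounds the monotone iteration.

  Nonexistence: take \<open>F (\<phi> x) = \<bar>x\<bar> powr \<beta>\<close> near the origin with \<open>\<theta> < \<beta> < N / r\<close>. Since \<open>f' * F\<close> tends
  to \<open>1\<close>, small positive powers of \<open>F\<close> are convex for large arguments. Jensen's inequality and the
  tail bound then give \<open>F (S(t)\<phi>) < t\<close> near the origin for small \<open>t\<close>. But for a solution, convexity of
  \<open>f\<close> makes \<open>z s = S(t - s) u(s)\<close> satisfy \<open>z' \<ge> f z\<close>, which forces \<open>F (S(t)\<phi>) \<ge> t\<close>.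
\<close>

section \<open>Gaussian integrals and integrability on Euclidean space\<close>

text \<open>One computation governs both parts: \<open>F powr a\<close> has slope
  \<open>- a / (f * F powr (1 - a))\<close>, and the derivative of \<open>f * F powr (1 - a)\<close>
  is \<open>F powr (- a) * (f' * F - (1 - a))\<close>. Hence \<open>F powr a\<close> is convex where
  \<open>f' * F \<le> 1 - a\<close> if a < 0, and where \<open>f' * F \<ge> 1 - a\<close> if a > 0.
  The bound \<open>f' * F \<le> 1\<close> serves a = -r in (i); the limit q = 1 serves every small a
  > 0 in (ii). In (i) the obstacle is that \<open>f * F\<close> may tend to 0, so the gap between v
  and w, at least \<open>f v * F v / 2\<close>, has no positive lower bound. The limit q = 1
  confines the loss to a factor \<open>F powr \<epsilon>\<close>, that is
  \<open>t powr (\<alpha> * \<epsilon>)\<close>, while the Duhamel term is of the smaller order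
  \<open>t powr (1 - \<alpha>)\<close>. In (ii) the tail bound is not small at the natural radius
  \<open>t powr (1 / \<theta>)\<close>. A slightly larger radius is used, and the room between
  \<theta> and \<beta> pays for it. The kernel is given only by a Fourier integral. Gaussian factors
  make the integrals converge before the kernel is known to be integrable.\<close>

lemma (in pair_sigma_finite) Fubini_dominated:
  fixes f :: "'a \<Rightarrow> 'b \<Rightarrow> real"
  assumes [measurable]: "(\<lambda>(x, y). f x y) \<in> borel_measurable (M1 \<Otimes>\<^sub>M M2)"
    and g: "integrable M1 g" and h: "integrable M2 h"
    and bound: "\<And>x y. x \<in> space M1 \<Longrightarrow> y \<in> space M2 \<Longrightarrow> \<bar>f x y\<bar> \<le> g x * h y"
  shows "(\<integral>x. (\<integral>y. f x y \<partial>M2) \<partial>M1) = (\<integral>y. (\<integral>x. f x y \<partial>M1) \<partial>M2)"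
    and "integrable M1 (\<lambda>x. \<integral>y. f x y \<partial>M2)"
    and "integrable M2 (\<lambda>y. \<integral>x. f x y \<partial>M1)"
proof -
  have [measurable]: "g \<in> borel_measurable M1" and [measurable]: "h \<in> borel_measurable M2"
    using g h by auto
  have "integrable (M1 \<Otimes>\<^sub>M M2) (\<lambda>(x, y). g x * h y)"
  proof (rule Fubini_integrable)
    show "integrable M1 (\<lambda>x. \<integral>y. norm (case (x, y) of (x, y) \<Rightarrow> g x * h y) \<partial>M2)"
      using g h by (simp add: abs_mult)
    show "AE x in M1. integrable M2 (\<lambda>y. case (x, y) of (x, y) \<Rightarrow> g x * h y)"
      using h by simp
  qed measurable
  then have int: "integrable (M1 \<Otimes>\<^sub>M M2) (\<lambda>(x, y). f x y)"
    by (rule Bochner_Integration.integrable_bound)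
       (use bound in \<open>auto simp: space_pair_measure intro!: AE_I2 order_trans[OF bound]\<close>)
  show "(\<integral>x. (\<integral>y. f x y \<partial>M2) \<partial>M1) = (\<integral>y. (\<integral>x. f x y \<partial>M1) \<partial>M2)"
    using integral_fst[OF int] integral_snd[OF int] by simp
  show "integrable M1 (\<lambda>x. \<integral>y. f x y \<partial>M2)" using integrable_fst[OF int] .
  show "integrable M2 (\<lambda>y. \<integral>x. f x y \<partial>M1)" using integrable_snd[OF int] .
qed

text \<open>Lebesgue measure is the image of the product of one-dimensional measures, so products
  over the coordinates integrate factor by factor. This serves both the exact Gaussian integrals and
  the domination arguments in dimension N.\<close>

lemma integral_lborel_prod:
  fixes f :: "'a::euclidean_space \<Rightarrow> real \<Rightarrow> complex"
  assumes int: "\<And>b. b \<in> Basis \<Longrightarrow> integrable lborel (f b)"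
  shows "integrable lborel (\<lambda>x::'a. \<Prod>b\<in>Basis. f b (x \<bullet> b))" (is ?I)
    and "(\<integral>x. (\<Prod>b\<in>Basis. f b (x \<bullet> b)) \<partial>lborel) = (\<Prod>b\<in>Basis. (\<integral>s. f b s \<partial>lborel))" (is ?E)
proof -
  interpret product_sigma_finite "\<lambda>b::'a. lborel :: real measure" ..
  have m: "(\<lambda>f. \<Sum>b\<in>Basis. f b *\<^sub>R b) \<in> measurable (\<Pi>\<^sub>M b\<in>(Basis::'a set). (lborel :: real measure)) borel"
    by measurable
  have [measurable]: "f b \<in> borel_measurable borel" if "b \<in> Basis" for b
    using borel_measurable_integrable[OF int[OF that]] by simp
  have mp: "(\<lambda>x::'a. \<Prod>b\<in>Basis. f b (x \<bullet> b)) \<in> borel_measurable borel" by measurable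
  have eq: "(\<lambda>g. \<Prod>b\<in>Basis. f b ((\<Sum>b\<in>Basis. g b *\<^sub>R b) \<bullet> b)) = (\<lambda>g. \<Prod>b\<in>Basis. f b (g b))"
    by (intro ext prod.cong) simp_all
  have 1: "integrable (\<Pi>\<^sub>M b\<in>Basis. lborel) (\<lambda>g. \<Prod>b\<in>Basis. f b (g b))"
    by (rule product_integrable_prod) (use int in auto)
  show ?I
    by (subst lborel_eq, subst integrable_distr_eq[OF m mp]) (simp only: eq 1)
  show ?E
    apply (subst lborel_eq)
    apply (subst integral_distr[OF m mp])
    apply (simp only: eq)
    apply (rule product_integral_prod)
    using int by auto
qed

text \<open>Read off from the characteristic function of the standard normal distribution by
  rescaling with \<open>c = sqrt (2 * \<delta>)\<close>.\<close>

lemma gaussian_fourier_1d: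
  fixes \<delta> y :: real
  assumes "\<delta> > 0"
  shows "integrable lborel (\<lambda>s. iexp (y * s) * of_real (exp (- \<delta> * s\<^sup>2)))" (is ?I)
    and "(\<integral>s. iexp (y * s) * of_real (exp (- \<delta> * s\<^sup>2)) \<partial>lborel)
      = of_real (sqrt (pi / \<delta>) * exp (- y\<^sup>2 / (4 * \<delta>)))" (is ?E)
proof -
  define c where "c = sqrt (2 * \<delta>)"
  have c: "c > 0" "c\<^sup>2 = 2 * \<delta>" using assms by (auto simp: c_def)
  let ?g = "\<lambda>x. iexp (y / c * x) * of_real (std_normal_density x)"
  have gi: "integrable lborel ?g"
    by (rule Bochner_Integration.integrable_bound[OF integrable_std_normal_moment[of 0]])
       (auto simp: norm_mult normal_density_nonneg)
  have "(\<integral>x. ?g x \<partial>lborel) = char std_normal_distribution (y / c)"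
    unfolding char_def by (subst integral_density)
      (auto simp: normal_density_nonneg scaleR_conv_of_real mult.commute)
  also have "\<dots> = of_real (exp (- (y / c)\<^sup>2 / 2))" by (simp add: char_std_normal_distribution)
  finally have G: "(\<integral>x. ?g x \<partial>lborel) = of_real (exp (- (y / c)\<^sup>2 / 2))" .
  have eq: "?g (0 + c * s) = of_real (1 / sqrt (2 * pi)) * (iexp (y * s) * of_real (exp (- \<delta> * s\<^sup>2)))" for s
  proof -
    have "(c * s)\<^sup>2 / 2 = \<delta> * s\<^sup>2" using c by (simp add: power_mult_distrib)
    then have *: "std_normal_density (c * s) = 1 / sqrt (2 * pi) * exp (- \<delta> * s\<^sup>2)"
      by (simp add: std_normal_density_def)
    have **: "y / c * (c * s) = y * s" using c by simp
    show ?thesis unfolding add_0 * ** by (simp add: ac_simps)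
  qed
  have "integrable lborel (\<lambda>s. ?g (0 + c * s))"
    using gi lborel_integrable_real_affine_iff[of c ?g 0] c by simp
  then have "integrable lborel (\<lambda>s. of_real (sqrt (2 * pi)) * (of_real (1 / sqrt (2 * pi)) * (iexp (y * s) * of_real (exp (- \<delta> * s\<^sup>2)))) :: complex)"
    unfolding eq by (rule integrable_mult_right)
  then show ?I by (simp add: field_simps)
  have "(\<integral>x. ?g x \<partial>lborel) = of_real c * (of_real (1 / sqrt (2 * pi)) * (\<integral>s. iexp (y * s) * of_real (exp (- \<delta> * s\<^sup>2)) \<partial>lborel))"
    using lborel_integral_real_affine[of c ?g 0] c(1)
    by (simp only: eq integral_mult_right_zero scaleR_conv_of_real abs_of_pos)
  then have "(\<integral>s. iexp (y * s) * of_real (exp (- \<delta> * s\<^sup>2)) \<partial>lborel)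
     = of_real (sqrt (2 * pi) / c) * of_real (exp (- (y / c)\<^sup>2 / 2))"
    unfolding G using c by (simp add: field_simps)
  also have "sqrt (2 * pi) / c = sqrt (pi / \<delta>)"
    using assms by (simp add: c_def real_sqrt_divide[symmetric])
  also have "- (y / c)\<^sup>2 / 2 = - y\<^sup>2 / (4 * \<delta>)" using c by (simp add: power_divide)
  finally show ?E by simp
qed

lemma gaussian_fourier:
  fixes x :: "'a::euclidean_space"
  assumes "\<delta> > 0"
  shows "integrable lborel (\<lambda>\<xi>::'a. exp (- \<delta> * (norm \<xi>)\<^sup>2))"
    and "(\<integral>\<xi>. cos (x \<bullet> \<xi>) * exp (- \<delta> * (norm \<xi>)\<^sup>2) \<partial>lborel)
      = sqrt (pi / \<delta>) ^ DIM('a) * exp (- (norm x)\<^sup>2 / (4 * \<delta>))"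
proof -
  define g where "g b s = iexp ((x \<bullet> b) * s) * complex_of_real (exp (- \<delta> * s\<^sup>2))" for b s
  have gi: "integrable lborel (g b)" for b
    unfolding g_def by (rule gaussian_fourier_1d(1)[OF assms])
  have nrm: "(norm z)\<^sup>2 = (\<Sum>b\<in>Basis. (z \<bullet> b)\<^sup>2)" for z :: 'a
    unfolding power2_norm_eq_inner by (subst euclidean_inner) (simp add: power2_eq_square)
  have eq: "(\<Prod>b\<in>Basis. g b (\<xi> \<bullet> b)) = iexp (x \<bullet> \<xi>) * of_real (exp (- \<delta> * (norm \<xi>)\<^sup>2))" for \<xi>
  proof -
    have "(\<Prod>b\<in>Basis. g b (\<xi> \<bullet> b)) = exp (\<i> * of_real (\<Sum>b\<in>Basis. (x \<bullet> b) * (\<xi> \<bullet> b))) * of_real (exp (\<Sum>b\<in>Basis. - \<delta> * (\<xi> \<bullet> b)\<^sup>2))"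
      unfolding g_def by (simp add: prod.distrib exp_sum sum_distrib_left)
    also have "(\<Sum>b\<in>Basis. (x \<bullet> b) * (\<xi> \<bullet> b)) = x \<bullet> \<xi>" by (simp add: euclidean_inner[of x \<xi>])
    finally show ?thesis by (simp add: nrm sum_distrib_left sum_negf)
  qed
  have I: "integrable lborel (\<lambda>\<xi>::'a. iexp (x \<bullet> \<xi>) * of_real (exp (- \<delta> * (norm \<xi>)\<^sup>2)))"
    using integral_lborel_prod(1)[of g] gi unfolding eq by blast
  have E: "(\<integral>\<xi>. iexp (x \<bullet> \<xi>) * of_real (exp (- \<delta> * (norm \<xi>)\<^sup>2)) \<partial>lborel)
     = of_real (sqrt (pi / \<delta>) ^ DIM('a) * exp (- (norm x)\<^sup>2 / (4 * \<delta>)))"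
  proof -
    have "(\<integral>\<xi>. iexp (x \<bullet> \<xi>) * of_real (exp (- \<delta> * (norm \<xi>)\<^sup>2)) \<partial>lborel) = (\<Prod>b\<in>Basis. (\<integral>s. g b s \<partial>lborel))"
      using integral_lborel_prod(2)[of g] gi unfolding eq by blast
    also have "\<dots> = (\<Prod>b\<in>(Basis::'a set). of_real (sqrt (pi / \<delta>) * exp (- (x \<bullet> b)\<^sup>2 / (4 * \<delta>))))"
      unfolding g_def by (simp only: gaussian_fourier_1d(2)[OF assms])
    also have "\<dots> = of_real (sqrt (pi / \<delta>) ^ DIM('a) * (\<Prod>b\<in>(Basis::'a set). exp (- (x \<bullet> b)\<^sup>2 / (4 * \<delta>))))"
      by (simp add: prod.distrib)
    also have "(\<Prod>b\<in>(Basis::'a set). exp (- (x \<bullet> b)\<^sup>2 / (4 * \<delta>))) = exp (- (norm x)\<^sup>2 / (4 * \<delta>))"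
      by (simp add: nrm exp_sum[symmetric] sum_negf sum_divide_distrib[symmetric])
    finally show ?thesis .
  qed
  have "integrable lborel (\<lambda>\<xi>::'a. norm (iexp (x \<bullet> \<xi>) * of_real (exp (- \<delta> * (norm \<xi>)\<^sup>2))))"
    using I by (rule integrable_norm)
  then show "integrable lborel (\<lambda>\<xi>::'a. exp (- \<delta> * (norm \<xi>)\<^sup>2))" by (simp add: norm_mult)
  have Re: "Re (iexp (x \<bullet> \<xi>) * of_real (exp (- \<delta> * (norm \<xi>)\<^sup>2))) = cos (x \<bullet> \<xi>) * exp (- \<delta> * (norm \<xi>)\<^sup>2)" for \<xi>
    by (simp add: Re_exp)
  show "(\<integral>\<xi>. cos (x \<bullet> \<xi>) * exp (- \<delta> * (norm \<xi>)\<^sup>2) \<partial>lborel)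
      = sqrt (pi / \<delta>) ^ DIM('a) * exp (- (norm x)\<^sup>2 / (4 * \<delta>))"
    using integral_Re[OF I] unfolding E Re by simp
qed

lemma nn_integral_lborel_affine:
  fixes f :: "'a::euclidean_space \<Rightarrow> ennreal"
  assumes [measurable]: "f \<in> borel_measurable borel" and "c \<noteq> 0"
  shows "(\<integral>\<^sup>+x. f x \<partial>lborel) = ennreal (\<bar>c\<bar> ^ DIM('a)) * (\<integral>\<^sup>+x. f (t + c *\<^sub>R x) \<partial>lborel)"
  by (subst lborel_affine[OF \<open>c \<noteq> 0\<close>, of t])
     (simp add: nn_integral_density nn_integral_distr nn_integral_cmult)

lemma integral_lborel_affine:
  fixes f :: "'a::euclidean_space \<Rightarrow> real"
  assumes [measurable]: "f \<in> borel_measurable borel" and "c \<noteq> 0"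
  shows "(\<integral>x. f x \<partial>lborel) = \<bar>c\<bar> ^ DIM('a) * (\<integral>x. f (t + c *\<^sub>R x) \<partial>lborel)"
  by (subst lborel_affine[OF \<open>c \<noteq> 0\<close>, of t])
     (simp add: integral_density integral_distr)

lemma nn_integral_lborel_reflect:
  fixes f :: "'a::euclidean_space \<Rightarrow> ennreal"
  assumes "f \<in> borel_measurable borel"
  shows "(\<integral>\<^sup>+y. f (x - y) \<partial>lborel) = (\<integral>\<^sup>+y. f y \<partial>lborel)"
  using nn_integral_lborel_affine[OF assms, of "-1" x] by simp

lemma integral_lborel_reflect:
  fixes f :: "'a::euclidean_space \<Rightarrow> real"
  assumes "f \<in> borel_measurable borel"
  shows "(\<integral>y. f (x - y) \<partial>lborel) = (\<integral>y. f y \<partial>lborel)"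
  using integral_lborel_affine[OF assms, of "-1" x] by simp

lemma nn_integral_powr_Icc:
  fixes a c :: real
  assumes "a > -1" "c \<ge> 0"
  shows "(\<integral>\<^sup>+x. ennreal (x powr a) * indicator {0..c} x \<partial>lborel) = ennreal (c powr (a + 1) / (a + 1))"
proof -
  have "((\<lambda>x. x powr a * indicator {0..c} x) has_integral (c powr (a + 1) / (a + 1))) UNIV"
    using has_integral_powr_from_0[OF assms] by (subst (asm) has_integral_restrict_UNIV[symmetric])
      (simp add: indicator_def of_bool_def if_distrib cong: if_cong)
  then have "(\<integral>\<^sup>+x. ennreal (x powr a * indicator {0..c} x) \<partial>lborel) = ennreal (c powr (a + 1) / (a + 1))"
    by (intro nn_integral_has_integral_lborel) auto
  then show ?thesis by (simp add: ennreal_mult' ennreal_indicator)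
qed

text \<open>Instead of polar coordinates, the power is distributed over the coordinates:
  \<open>norm x powr (-\<gamma>)\<close> is the N-th power of \<open>norm x powr a\<close> with
  \<open>a = - \<gamma> / N\<close>, and each factor is at most the same power of one coordinate.
  The condition \<gamma> < N is exactly a > -1.\<close>

lemma nn_integral_norm_powr_unit_ball:
  fixes \<gamma> :: real
  assumes "0 \<le> \<gamma>" "\<gamma> < DIM('a::euclidean_space)"
  shows "(\<integral>\<^sup>+x. ennreal (norm (x::'a) powr (-\<gamma>)) * indicator (ball 0 1) x \<partial>lborel) < \<infinity>"
proof -
  define N where "N = real DIM('a)"
  define a where "a = - \<gamma> / N"
  have N: "N > 0" by (simp add: N_def)
  have a: "a > -1" "a \<le> 0" using assms N by (auto simp: a_def field_simps N_def)
  \<comment> \<open>As \<open>0 powr a\<close> is 0, the value at s = 0 has to be set to infinity;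
    otherwise the bound \<open>le\<close> fails at points with a vanishing coordinate.\<close>
  define g where "g s = (if s = 0 then \<infinity> else ennreal (\<bar>s\<bar> powr a)) * indicator {-1..1} s" for s :: real
  have [measurable]: "g \<in> borel_measurable borel" unfolding g_def by measurable
  have g0: "g s \<ge> ennreal (r powr a)" if "\<bar>s\<bar> \<le> r" "r \<le> 1" for s r
  proof -
    have "indicator {-1..1} s = (1 :: ennreal)" using that by (auto simp: indicator_def)
    then show ?thesis using that a by (auto simp: g_def intro!: ennreal_leI powr_mono2')
  qed
  have le: "ennreal (norm x powr (-\<gamma>)) * indicator (ball 0 1) x \<le> (\<Prod>b\<in>Basis. g (x \<bullet> b))" for x :: 'a
  proof (cases "x \<in> ball 0 1 \<and> x \<noteq> 0")
    case True
    then have x: "norm x > 0" "norm x \<le> 1" by auto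
    have "norm x powr (-\<gamma>) = (norm x powr a) ^ DIM('a)"
      using x N by (simp add: powr_realpow[symmetric] powr_powr a_def N_def)
    then have "ennreal (norm x powr (-\<gamma>)) = (\<Prod>b\<in>(Basis::'a set). ennreal (norm x powr a))"
      by (simp add: ennreal_power)
    also have "\<dots> \<le> (\<Prod>b\<in>Basis. g (x \<bullet> b))"
      using x by (intro prod_mono_ennreal g0 Basis_le_norm) auto
    finally show ?thesis using True by simp
  qed (auto simp: indicator_def)
  have "(\<integral>\<^sup>+s. g s \<partial>lborel) < \<infinity>"
  proof -
    have *: "(\<integral>\<^sup>+s. ennreal (s powr a) * indicator {0..1} s \<partial>lborel) < \<infinity>" (is "?J < _")
      by (subst nn_integral_powr_Icc) (use a in auto)
    have "(\<integral>\<^sup>+s. g s \<partial>lborel) \<le> (\<integral>\<^sup>+s. ennreal (s powr a) * indicator {0..1} s + ennreal ((0 - s) powr a) * indicator {0..1} (0 - s) \<partial>lborel)"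
      by (intro nn_integral_mono_AE) (use AE_lborel_singleton[of "0::real"] in eventually_elim, auto simp: g_def indicator_def abs_if)
    also have "\<dots> = ?J + (\<integral>\<^sup>+s. ennreal ((0 - s) powr a) * indicator {0..1} (0 - s) \<partial>lborel)"
      by (intro nn_integral_add) measurable
    also have "(\<integral>\<^sup>+s. ennreal ((0 - s) powr a) * indicator {0..1} (0 - s) \<partial>lborel) = ?J"
      by (rule nn_integral_lborel_reflect[where f="\<lambda>s. ennreal (s powr a) * indicator {0..1} s"]) measurable
    finally have "(\<integral>\<^sup>+s. g s \<partial>lborel) \<le> ?J + ?J" .
    also have "?J + ?J < \<infinity>" using * by simp
    finally show ?thesis .
  qed
  then have "(\<Prod>b\<in>(Basis::'a set). (\<integral>\<^sup>+s. g s \<partial>lborel)) < \<infinity>"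
    by (simp add: power_less_top_ennreal)
  moreover have "(\<integral>\<^sup>+x. ennreal (norm (x::'a) powr (-\<gamma>)) * indicator (ball 0 1) x \<partial>lborel) \<le> (\<integral>\<^sup>+x. (\<Prod>b\<in>(Basis::'a set). g (x \<bullet> b)) \<partial>lborel)"
    by (intro nn_integral_mono le)
  moreover have "(\<integral>\<^sup>+x. (\<Prod>b\<in>(Basis::'a set). g (x \<bullet> b)) \<partial>lborel) = (\<Prod>b\<in>(Basis::'a set). (\<integral>\<^sup>+s. g s \<partial>lborel))"
    by (rule nn_integral_lborel_prod) auto
  ultimately show ?thesis by order
qed

lemma integrable_inverse_one_plus_square: "integrable lborel (\<lambda>x::real. inverse (1 + x\<^sup>2))"
  using integrable_inverse_1_plus_square by (simp add: set_integrable_def)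

text \<open>Coordinates are bounded by the norm, so the exponent
  \<open>t * norm \<xi> powr \<theta>\<close> is at least the sum over the coordinates of
  \<open>c\<close> times their \<theta>-th powers, with \<open>c = t / N\<close>. A product of
  one-dimensional integrable functions therefore dominates.\<close>

lemma integrable_exp_neg_norm_powr:
  assumes t: "t > 0" and \<theta>: "\<theta> > 0"
  shows "integrable lborel (\<lambda>\<xi>::'a::euclidean_space. exp (- (t * norm \<xi> powr \<theta>)))"
proof -
  define N where "N = real DIM('a)"
  have N: "N > 0" by (simp add: N_def)
  define c where "c = t / N"
  have c: "c > 0" using t N by (simp add: c_def)
  define g where "g s = exp (- (c * \<bar>s\<bar> powr \<theta>))" for s :: real
  have [measurable]: "g \<in> borel_measurable borel" unfolding g_def by measurable
  \<comment> \<open>Once \<open>\<theta> * k \<ge> 2\<close>, the inequality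
    \<open>exp y \<ge> (y / k) ^ k\<close> turns the exponential into decay of order
    \<open>1 / s\<^sup>2\<close>.\<close>
  define k where "k = nat \<lceil>2 / \<theta>\<rceil>"
  have k: "\<theta> * real k \<ge> 2"
  proof -
    have "2 / \<theta> \<le> real k" unfolding k_def by (rule real_nat_ceiling_ge)
    then show ?thesis using \<theta> by (simp add: pos_divide_le_eq mult.commute)
  qed
  then have k0: "k > 0" by (cases k) auto
  define K where "K = max 1 ((real k / c) ^ k)"
  have gb: "g s \<le> 2 * K * inverse (1 + s\<^sup>2)" for s
  proof (cases "\<bar>s\<bar> \<le> 1")
    case True
    then have "1 + s\<^sup>2 \<le> 2" by (simp add: abs_square_le_1)
    then have "1 \<le> 2 * inverse (1 + s\<^sup>2)" by (simp add: field_simps add_pos_nonneg)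
    moreover have "g s \<le> 1" using c by (simp add: g_def)
    moreover have "2 * inverse (1 + s\<^sup>2) \<le> K * (2 * inverse (1 + s\<^sup>2))"
      by (rule mult_right_mono[of 1 K, simplified]) (auto simp: K_def add_nonneg_nonneg)
    ultimately show ?thesis by (simp add: mult_ac)
  next
    case False
    then have s: "\<bar>s\<bar> > 1" by simp
    let ?y = "c * \<bar>s\<bar> powr \<theta>"
    have y: "?y > 0" using s c by auto
    have "s\<^sup>2 = \<bar>s\<bar> powr 2" using s by (simp add: powr_numeral)
    also have "\<dots> \<le> \<bar>s\<bar> powr (\<theta> * real k)" using s k by (intro powr_mono) auto
    also have "\<dots> = (\<bar>s\<bar> powr \<theta>) ^ k" using s by (simp add: powr_powr[symmetric] powr_realpow)
    finally have 1: "s\<^sup>2 \<le> (\<bar>s\<bar> powr \<theta>) ^ k" .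
    have "(?y / real k) ^ k \<le> (1 + ?y / real k) ^ k" using y by (intro power_mono) auto
    also have "\<dots> \<le> exp ?y" using k0 y by (intro exp_ge_one_plus_x_over_n_power_n) auto
    finally have "g s \<le> inverse ((?y / real k) ^ k)"
      using y k0 by (simp add: g_def exp_minus le_imp_inverse_le)
    also have "\<dots> = (real k / c) ^ k * inverse ((\<bar>s\<bar> powr \<theta>) ^ k)"
      using s c k0 by (simp add: field_simps power_divide power_mult_distrib)
    also have "\<dots> \<le> K * inverse (s\<^sup>2)"
      using 1 s c k0 by (intro mult_mono le_imp_inverse_le) (auto simp: K_def)
    also have "K * inverse (s\<^sup>2) \<le> K * (2 * inverse (1 + s\<^sup>2))"
    proof (rule mult_left_mono)
      have "s\<^sup>2 > 1" using s using power_strict_mono[of 1 "\<bar>s\<bar>" 2] by simp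
      then show "inverse (s\<^sup>2) \<le> 2 * inverse (1 + s\<^sup>2)"
        by (simp add: inverse_eq_divide divide_le_eq le_divide_eq)
    qed (simp add: K_def)
    finally show ?thesis by (simp only: mult_ac)
  qed
  have gi: "integrable lborel g"
    by (rule Bochner_Integration.integrable_bound[OF integrable_mult_right[OF integrable_inverse_one_plus_square, of "2 * K"]])
       (use gb in \<open>auto simp: g_def K_def intro!: AE_I2 order_trans[OF gb[unfolded g_def K_def]]\<close>)
  have "integrable lborel (\<lambda>x::'a. \<Prod>b\<in>Basis. complex_of_real (g (x \<bullet> b)))"
    using gi by (intro integral_lborel_prod(1)) auto
  then have "integrable lborel (\<lambda>x::'a. norm (\<Prod>b\<in>Basis. complex_of_real (g (x \<bullet> b))))"
    by (rule integrable_norm)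
  then have *: "integrable lborel (\<lambda>x::'a. (\<Prod>b\<in>Basis. g (x \<bullet> b)))"
    by (simp add: prod_norm[symmetric] g_def)
  show ?thesis
  proof (rule Bochner_Integration.integrable_bound[OF *], simp, rule AE_I2)
    fix x :: 'a
    have "(\<Sum>b\<in>(Basis::'a set). c * \<bar>x \<bullet> b\<bar> powr \<theta>) \<le> (\<Sum>b\<in>(Basis::'a set). c * norm x powr \<theta>)"
      using c \<theta> by (intro sum_mono mult_left_mono powr_mono2 Basis_le_norm) auto
    also have "\<dots> = t * norm x powr \<theta>" using N by (simp add: c_def N_def)
    finally have "exp (- (t * norm x powr \<theta>)) \<le> (\<Prod>b\<in>(Basis::'a set). g (x \<bullet> b))"
      by (simp add: g_def exp_sum[symmetric] sum_negf)
    then show "norm (exp (- (t * norm x powr \<theta>))) \<le> norm (\<Prod>b\<in>(Basis::'a set). g (x \<bullet> b))" by simp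
  qed
qed

section \<open>Positivity and radial monotonicity of the fundamental solution\<close>

definition gauss_cos :: "real \<Rightarrow> ('a::euclidean_space \<Rightarrow> real) \<Rightarrow> 'a \<Rightarrow> real" where
  "gauss_cos \<delta> h x = (\<integral>\<xi>. cos (x \<bullet> \<xi>) * exp (- \<delta> * (norm \<xi>)\<^sup>2) * h \<xi> \<partial>lborel)"

text \<open>
  The Gaussian factor makes the Fourier integral converge for every bounded \<open>h\<close>, in particular for
  the partial sums of the exponential series.
\<close>

definition radial_pd :: "('a::euclidean_space \<Rightarrow> real) \<Rightarrow> bool" where
  "radial_pd h \<longleftrightarrow> h \<in> borel_measurable borel \<and> (\<exists>B. \<forall>\<xi>. \<bar>h \<xi>\<bar> \<le> B) \<and>
     (\<forall>\<delta>>0. \<forall>x y. norm x \<le> norm y \<longrightarrow> 0 \<le> gauss_cos \<delta> h y \<and> gauss_cos \<delta> h y \<le> gauss_cos \<delta> h x)"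

lemma radial_pdI:
  fixes h :: "'a::euclidean_space \<Rightarrow> real"
  assumes "h \<in> borel_measurable borel" "\<And>\<xi>. \<bar>h \<xi>\<bar> \<le> B"
    and "\<And>\<delta> x y. \<delta> > 0 \<Longrightarrow> norm (x::'a) \<le> norm y \<Longrightarrow> 0 \<le> gauss_cos \<delta> h y"
    and "\<And>\<delta> x y. \<delta> > 0 \<Longrightarrow> norm x \<le> norm y \<Longrightarrow> gauss_cos \<delta> h y \<le> gauss_cos \<delta> h x"
  shows "radial_pd h"
  unfolding radial_pd_def
proof (intro conjI exI[of _ B] allI impI)
  fix \<delta> :: real and x y :: 'a
  assume "\<delta> > 0" "norm x \<le> norm y"
  then show "0 \<le> gauss_cos \<delta> h y" "gauss_cos \<delta> h y \<le> gauss_cos \<delta> h x"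
    using assms(3)[of \<delta> x y] assms(4)[of \<delta> x y] by simp_all
qed (rule assms)+

lemma radial_pdD:
  assumes "radial_pd h"
  shows "h \<in> borel_measurable borel"
    and "\<delta> > 0 \<Longrightarrow> 0 \<le> gauss_cos \<delta> h x"
    and "\<delta> > 0 \<Longrightarrow> norm x \<le> norm y \<Longrightarrow> gauss_cos \<delta> h y \<le> gauss_cos \<delta> h x"
proof -
  note * = assms[unfolded radial_pd_def]
  show "h \<in> borel_measurable borel" using * by (rule conjunct1)
  note ** = *[THEN conjunct2, THEN conjunct2, rule_format]
  show "\<delta> > 0 \<Longrightarrow> 0 \<le> gauss_cos \<delta> h x" using **[of \<delta> x x] by simp
  show "\<delta> > 0 \<Longrightarrow> norm x \<le> norm y \<Longrightarrow> gauss_cos \<delta> h y \<le> gauss_cos \<delta> h x" using **[of \<delta> x y] by simp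
qed

lemma integrable_gauss_cos:
  fixes h :: "'a::euclidean_space \<Rightarrow> real"
  assumes [measurable]: "h \<in> borel_measurable borel" and "\<And>\<xi>. \<bar>h \<xi>\<bar> \<le> B" and "\<delta> > 0"
  shows "integrable lborel (\<lambda>\<xi>. cos (x \<bullet> \<xi>) * exp (- \<delta> * (norm \<xi>)\<^sup>2) * h \<xi>)"
proof (rule Bochner_Integration.integrable_bound)
  let ?g = "\<lambda>\<xi>::'a. exp (- \<delta> * (norm \<xi>)\<^sup>2)"
  show "integrable lborel (\<lambda>\<xi>::'a. B * ?g \<xi>)"
    using gaussian_fourier(1)[OF \<open>\<delta> > 0\<close>] by (rule integrable_mult_right)
  show "AE \<xi> in lborel. norm (cos (x \<bullet> \<xi>) * ?g \<xi> * h \<xi>) \<le> norm (B * ?g \<xi>)"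
  proof (rule AE_I2)
    fix \<xi>
    have "\<bar>cos (x \<bullet> \<xi>)\<bar> * ?g \<xi> * \<bar>h \<xi>\<bar> \<le> 1 * ?g \<xi> * \<bar>B\<bar>"
      using assms(2)[of \<xi>] by (intro mult_mono) auto
    then show "norm (cos (x \<bullet> \<xi>) * ?g \<xi> * h \<xi>) \<le> norm (B * ?g \<xi>)"
      by (simp add: abs_mult mult.commute)
  qed
qed simp

section \<open>Closure properties of the class \<open>radial_pd\<close>\<close>

lemma radial_pd_const: "radial_pd (\<lambda>\<xi>::'a::euclidean_space. 1)"
proof (rule radial_pdI[where B = 1])
  fix \<delta> :: real and x y :: 'a
  assume \<delta>: "\<delta> > 0"
  have eq: "gauss_cos \<delta> (\<lambda>_. 1) z = sqrt (pi / \<delta>) ^ DIM('a) * exp (- (norm z)\<^sup>2 / (4 * \<delta>))" for z :: 'a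
    using gaussian_fourier(2)[OF \<delta>, of z] by (simp add: gauss_cos_def)
  show "0 \<le> gauss_cos \<delta> (\<lambda>_. 1) y" unfolding eq using \<delta> by simp
  assume "norm x \<le> norm y"
  then show "gauss_cos \<delta> (\<lambda>_. 1) y \<le> gauss_cos \<delta> (\<lambda>_. 1) x"
    unfolding eq using \<delta> by (intro mult_left_mono) (auto simp: divide_right_mono power_mono)
qed auto

lemma radial_pd_cmult:
  assumes "radial_pd h" "c \<ge> 0"
  shows "radial_pd (\<lambda>\<xi>. c * h \<xi>)"
proof -
  obtain B where B: "\<And>\<xi>. \<bar>h \<xi>\<bar> \<le> B" using assms unfolding radial_pd_def by auto
  have eq: "gauss_cos \<delta> (\<lambda>\<xi>. c * h \<xi>) x = c * gauss_cos \<delta> h x" for \<delta> x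
    by (simp add: gauss_cos_def mult.left_commute)
  have [measurable]: "h \<in> borel_measurable borel" using radial_pdD(1)[OF assms(1)] .
  show ?thesis
    using assms B by (intro radial_pdI[where B = "c * B"])
      (auto simp: eq radial_pdD abs_mult intro!: mult_left_mono)
qed

lemma radial_pd_add:
  assumes "radial_pd g" "radial_pd h"
  shows "radial_pd (\<lambda>\<xi>. g \<xi> + h \<xi>)"
proof -
  obtain B where B: "\<And>\<xi>. \<bar>g \<xi>\<bar> \<le> B" using assms unfolding radial_pd_def by auto
  obtain C where C: "\<And>\<xi>. \<bar>h \<xi>\<bar> \<le> C" using assms unfolding radial_pd_def by auto
  have eq: "gauss_cos \<delta> (\<lambda>\<xi>. g \<xi> + h \<xi>) x = gauss_cos \<delta> g x + gauss_cos \<delta> h x" if "\<delta> > 0" for \<delta> x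
    unfolding gauss_cos_def distrib_left
    by (rule Bochner_Integration.integral_add)
       (use assms B C that integrable_gauss_cos radial_pdD(1) in blast)+
  have [measurable]: "g \<in> borel_measurable borel" "h \<in> borel_measurable borel"
    using radial_pdD(1) assms by auto
  show ?thesis
    using assms by (intro radial_pdI[where B = "B + C"])
      (auto simp: eq radial_pdD intro!: add_mono add_nonneg_nonneg order_trans[OF abs_triangle_ineq] B C)
qed

lemma radial_pd_sum:
  assumes "\<And>k::nat. radial_pd (h k)"
  shows "radial_pd (\<lambda>\<xi>. \<Sum>k<n. h k \<xi>)"
proof (induction n)
  case 0
  show ?case using radial_pd_cmult[OF radial_pd_const, of 0] by simp
next
  case (Suc n)
  show ?case using radial_pd_add[OF Suc assms[of n]] by simp
qed

lemma radial_pd_limit: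
  fixes g :: "'a::euclidean_space \<Rightarrow> real"
  assumes pd: "\<And>n. radial_pd (h n)" and B: "\<And>n \<xi>. \<bar>h n \<xi>\<bar> \<le> B"
    and lim: "\<And>\<xi>. (\<lambda>n. h n \<xi>) \<longlonglongrightarrow> g \<xi>"
  shows "radial_pd g"
proof -
  let ?g = "\<lambda>\<delta> \<xi>::'a. exp (- \<delta> * (norm \<xi>)\<^sup>2)"
  have [measurable]: "h n \<in> borel_measurable borel" for n using radial_pdD(1)[OF pd] .
  have [measurable]: "g \<in> borel_measurable borel"
    by (rule borel_measurable_LIMSEQ_real[OF lim]) measurable
  have L: "(\<lambda>n. gauss_cos \<delta> (h n) x) \<longlonglongrightarrow> gauss_cos \<delta> g x" if "\<delta> > 0" for \<delta> x
    unfolding gauss_cos_def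
  proof (rule integral_dominated_convergence[where w = "\<lambda>\<xi>. B * ?g \<delta> \<xi>"])
    show "integrable lborel (\<lambda>\<xi>. B * ?g \<delta> \<xi>)"
      using gaussian_fourier(1)[OF that] by (rule integrable_mult_right)
    show "AE \<xi> in lborel. (\<lambda>n. cos (x \<bullet> \<xi>) * ?g \<delta> \<xi> * h n \<xi>) \<longlonglongrightarrow> cos (x \<bullet> \<xi>) * ?g \<delta> \<xi> * g \<xi>"
      using lim by (intro AE_I2 tendsto_mult_left)
    fix n
    show "AE \<xi> in lborel. norm (cos (x \<bullet> \<xi>) * ?g \<delta> \<xi> * h n \<xi>) \<le> B * ?g \<delta> \<xi>"
    proof (rule AE_I2)
      fix \<xi>
      have "\<bar>cos (x \<bullet> \<xi>)\<bar> * ?g \<delta> \<xi> * \<bar>h n \<xi>\<bar> \<le> 1 * ?g \<delta> \<xi> * B"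
        using B[of n \<xi>] by (intro mult_mono) auto
      then show "norm (cos (x \<bullet> \<xi>) * ?g \<delta> \<xi> * h n \<xi>) \<le> B * ?g \<delta> \<xi>"
        by (simp add: abs_mult mult.commute)
    qed
  qed measurable
  show ?thesis
  proof (rule radial_pdI[where B = B])
    show "\<bar>g \<xi>\<bar> \<le> B" for \<xi>
      using tendsto_rabs[OF lim[of \<xi>]] by (rule LIMSEQ_le_const2) (use B in auto)
    fix \<delta> :: real and x y :: 'a assume \<delta>: "\<delta> > 0" "norm x \<le> norm y"
    show "0 \<le> gauss_cos \<delta> g y"
      by (rule LIMSEQ_le_const[OF L[OF \<delta>(1)]]) (use \<delta> radial_pdD[OF pd] in blast)
    show "gauss_cos \<delta> g y \<le> gauss_cos \<delta> g x"
      by (rule LIMSEQ_le[OF L[OF \<delta>(1)] L[OF \<delta>(1)]]) (use \<delta> radial_pdD[OF pd] in blast)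
  qed simp
qed

lemma laplace_bounds:
  fixes l :: real and \<nu> :: "real \<Rightarrow> real"
  assumes \<nu>: "integrable lborel \<nu>" "\<And>s. \<nu> s \<ge> 0" "\<And>s. s < 0 \<Longrightarrow> \<nu> s = 0" and l: "l \<ge> 0"
  shows "\<nu> s * exp (- s * l) \<le> \<nu> s" (is ?le)
    and "integrable lborel (\<lambda>s. \<nu> s * exp (- s * l))" (is ?int)
    and "0 \<le> (\<integral>s. \<nu> s * exp (- s * l) \<partial>lborel)" (is ?pos)
    and "(\<integral>s. \<nu> s * exp (- s * l) \<partial>lborel) \<le> integral\<^sup>L lborel \<nu>" (is ?bound)
proof -
  have [measurable]: "\<nu> \<in> borel_measurable borel" using \<nu>(1) by auto
  have le: "\<nu> s * exp (- s * l) \<le> \<nu> s" for s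
    using \<nu>(2)[of s] \<nu>(3)[of s] l by (cases "s < 0") (auto intro!: mult_left_le)
  show int: ?int
    by (rule Bochner_Integration.integrable_bound[OF \<nu>(1)]) (use \<nu>(2) le in auto)
  show ?le by (rule le)
  show ?pos ?bound using \<nu> int le by (auto intro!: integral_nonneg_AE integral_mono)
qed

text \<open>The factor \<open>exp (- s * (norm \<xi>)\<^sup>2)\<close> only raises the Gaussian
  parameter from \<delta> to \<delta> + s. After Fubini the transform of the product is a
  nonnegative mixture of \<open>gauss_cos (\<delta> + s) h\<close>, which is why the class
  quantifies over all \<delta> > 0.\<close>

lemma radial_pd_laplace:
  fixes h :: "'a::euclidean_space \<Rightarrow> real" and \<nu> :: "real \<Rightarrow> real"
  assumes h: "radial_pd h" and \<nu>: "integrable lborel \<nu>" "\<And>s. \<nu> s \<ge> 0" "\<And>s. s < 0 \<Longrightarrow> \<nu> s = 0"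
  shows "radial_pd (\<lambda>\<xi>. (\<integral>s. \<nu> s * exp (- s * (norm \<xi>)\<^sup>2) \<partial>lborel) * h \<xi>)"
proof -
  let ?g = "\<lambda>\<delta> \<xi>::'a. exp (- \<delta> * (norm \<xi>)\<^sup>2)"
  obtain B where B: "\<And>\<xi>. \<bar>h \<xi>\<bar> \<le> B" using h unfolding radial_pd_def by auto
  have [measurable]: "h \<in> borel_measurable borel" "\<nu> \<in> borel_measurable borel"
    using radial_pdD(1)[OF h] borel_measurable_integrable[OF \<nu>(1)] by auto
  define m where "m \<xi> = (\<integral>s. \<nu> s * ?g s \<xi> \<partial>lborel)" for \<xi> :: 'a
  have [measurable]: "m \<in> borel_measurable borel" unfolding m_def by measurable
  have m: "0 \<le> m \<xi>" "m \<xi> \<le> integral\<^sup>L lborel \<nu>" for \<xi>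
    unfolding m_def by (rule laplace_bounds[OF \<nu>]; simp)+
  have exch: "gauss_cos \<delta> (\<lambda>\<xi>. m \<xi> * h \<xi>) x = (\<integral>s. \<nu> s * gauss_cos (\<delta> + s) h x \<partial>lborel)"
    and int: "integrable lborel (\<lambda>s. \<nu> s * gauss_cos (\<delta> + s) h x)" if "\<delta> > 0" for \<delta> x
  proof -
    let ?f = "\<lambda>s \<xi>. \<nu> s * (cos (x \<bullet> \<xi>) * ?g (\<delta> + s) \<xi> * h \<xi>)"
    have gi: "integrable lborel (\<lambda>\<xi>::'a. B * ?g \<delta> \<xi>)"
      using gaussian_fourier(1)[OF that] by (rule integrable_mult_right)
    have bd: "\<bar>?f s \<xi>\<bar> \<le> \<nu> s * (B * ?g \<delta> \<xi>)" for s \<xi>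
    proof (cases "s < 0")
      case False
      have "\<bar>cos (x \<bullet> \<xi>)\<bar> * ?g (\<delta> + s) \<xi> * \<bar>h \<xi>\<bar> \<le> 1 * ?g \<delta> \<xi> * B"
        using B[of \<xi>] False by (intro mult_mono) (auto simp: algebra_simps)
      then show ?thesis using \<nu>(2)[of s] by (auto simp: abs_mult mult.commute intro!: mult_left_mono)
    qed (use \<nu>(3) in auto)
    note F = lborel_pair.Fubini_dominated[of ?f, OF _ \<nu>(1) gi bd]
    have meas: "(\<lambda>(s, \<xi>). ?f s \<xi>) \<in> borel_measurable (lborel \<Otimes>\<^sub>M lborel)" by measurable
    have "(\<integral>\<xi>. (\<integral>s. ?f s \<xi> \<partial>lborel) \<partial>lborel) = gauss_cos \<delta> (\<lambda>\<xi>. m \<xi> * h \<xi>) x"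
      unfolding gauss_cos_def
    proof (rule Bochner_Integration.integral_cong[OF refl])
      fix \<xi>
      have "?f s \<xi> = (cos (x \<bullet> \<xi>) * ?g \<delta> \<xi> * h \<xi>) * (\<nu> s * ?g s \<xi>)" for s
        by (simp add: algebra_simps exp_add[symmetric])
      then have "(\<integral>s. ?f s \<xi> \<partial>lborel) = (cos (x \<bullet> \<xi>) * ?g \<delta> \<xi> * h \<xi>) * m \<xi>"
        by (simp only: m_def integral_mult_right_zero)
      then show "(\<integral>s. ?f s \<xi> \<partial>lborel) = cos (x \<bullet> \<xi>) * ?g \<delta> \<xi> * (m \<xi> * h \<xi>)"
        by (simp add: mult_ac)
    qed
    moreover have eq: "(\<integral>\<xi>. ?f s \<xi> \<partial>lborel) = \<nu> s * gauss_cos (\<delta> + s) h x" for s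
      unfolding gauss_cos_def by simp
    ultimately show "gauss_cos \<delta> (\<lambda>\<xi>. m \<xi> * h \<xi>) x = (\<integral>s. \<nu> s * gauss_cos (\<delta> + s) h x \<partial>lborel)"
      using F(1)[OF meas] by (simp only: eq)
    show "integrable lborel (\<lambda>s. \<nu> s * gauss_cos (\<delta> + s) h x)"
      using F(2)[OF meas] unfolding eq .
  qed
  have B0: "B \<ge> 0" using B[of 0] by linarith
  show ?thesis
    unfolding m_def[symmetric]
  proof (rule radial_pdI[where B = "integral\<^sup>L lborel \<nu> * B"])
    show "\<bar>m \<xi> * h \<xi>\<bar> \<le> integral\<^sup>L lborel \<nu> * B" for \<xi>
      using m[of \<xi>] B[of \<xi>] B0 by (simp add: abs_mult mult_mono)
    fix \<delta> :: real and x y :: 'a assume \<delta>: "\<delta> > 0" and "norm x \<le> norm y"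
    have "\<nu> s * gauss_cos (\<delta> + s) h y \<ge> 0" for s
      using \<nu>(2)[of s] \<nu>(3)[of s] \<delta> by (cases "s < 0") (auto intro!: mult_nonneg_nonneg radial_pdD[OF h])
    then show "0 \<le> gauss_cos \<delta> (\<lambda>\<xi>. m \<xi> * h \<xi>) y" unfolding exch[OF \<delta>] by simp
    have "\<nu> s * gauss_cos (\<delta> + s) h y \<le> \<nu> s * gauss_cos (\<delta> + s) h x" for s
      using \<nu>(2)[of s] \<nu>(3)[of s] \<delta> \<open>norm x \<le> norm y\<close>
      by (cases "s < 0") (auto intro!: mult_left_mono radial_pdD[OF h])
    then show "gauss_cos \<delta> (\<lambda>\<xi>. m \<xi> * h \<xi>) y \<le> gauss_cos \<delta> (\<lambda>\<xi>. m \<xi> * h \<xi>) x"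
      unfolding exch[OF \<delta>] by (intro integral_mono int \<delta>)
  qed simp
qed

lemma exp_partial_sums_le:
  fixes x :: real
  assumes "x \<ge> 0"
  shows "(\<Sum>k<n. x ^ k / fact k) \<le> exp x"
proof -
  have "(\<Sum>k<n. x ^ k /\<^sub>R fact k) \<le> (\<Sum>k. x ^ k /\<^sub>R fact k)"
    using assms by (intro sum_le_suminf summable_exp_generic) auto
  then show ?thesis unfolding exp_def by (simp add: field_simps)
qed

text \<open>Powers of the Laplace mixture m come from applying \<open>radial_pd_laplace\<close>
  repeatedly. The exponential series has nonnegative coefficients, and its partial sums are bounded
  by the exponential of the total mass of \<nu>, so the limit stays in the class.\<close>

lemma radial_pd_exp_laplace:
  fixes \<nu> :: "real \<Rightarrow> real"
  assumes \<nu>: "integrable lborel \<nu>" "\<And>s. \<nu> s \<ge> 0" "\<And>s. s < 0 \<Longrightarrow> \<nu> s = 0"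
  shows "radial_pd (\<lambda>\<xi>::'a::euclidean_space. exp (\<integral>s. \<nu> s * exp (- s * (norm \<xi>)\<^sup>2) \<partial>lborel))"
proof -
  define m where "m \<xi> = (\<integral>s. \<nu> s * exp (- s * (norm \<xi>)\<^sup>2) \<partial>lborel)" for \<xi> :: 'a
  have pw: "radial_pd (\<lambda>\<xi>. m \<xi> ^ k)" for k
  proof (induction k)
    case (Suc k)
    show ?case using radial_pd_laplace[OF Suc \<nu>] by (simp add: m_def)
  qed (simp add: radial_pd_const)
  have m: "0 \<le> m \<xi>" "m \<xi> \<le> integral\<^sup>L lborel \<nu>" for \<xi>
    unfolding m_def by (rule laplace_bounds[OF \<nu>]; simp)+
  have "radial_pd (\<lambda>\<xi>. exp (m \<xi>))"
  proof (rule radial_pd_limit[where h = "\<lambda>n \<xi>. \<Sum>k<n. m \<xi> ^ k / fact k" and B = "exp (integral\<^sup>L lborel \<nu>)"])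
    show "radial_pd (\<lambda>\<xi>. \<Sum>k<n. m \<xi> ^ k / fact k)" for n
      using radial_pd_cmult[OF pw, of "1 / fact _"] by (intro radial_pd_sum) (simp add: field_simps)
    show "\<bar>\<Sum>k<n. m \<xi> ^ k / fact k\<bar> \<le> exp (integral\<^sup>L lborel \<nu>)" for n \<xi>
      using exp_partial_sums_le[OF m(1)[of \<xi>], of n] m[of \<xi>]
      by (subst abs_of_nonneg) (auto intro!: sum_nonneg order_trans[OF exp_partial_sums_le])
    show "(\<lambda>n. \<Sum>k<n. m \<xi> ^ k / fact k) \<longlonglongrightarrow> exp (m \<xi>)" for \<xi>
      using exp_converges[of "m \<xi>"] by (simp add: sums_def field_simps)
  qed
  then show ?thesis by (simp add: m_def)
qed

text \<open>Integrability of h allows the Gaussian factor to be removed: \<delta> = 1 / (n + 1)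
  tends to 0 under dominated convergence, and both inequalities pass to the limit.\<close>

lemma radial_pd_fourier:
  fixes h :: "'a::euclidean_space \<Rightarrow> real"
  assumes pd: "radial_pd h" and int: "integrable lborel h"
  shows "0 \<le> (\<integral>\<xi>. cos (x \<bullet> \<xi>) * h \<xi> \<partial>lborel)"
    and "norm x \<le> norm y \<Longrightarrow> (\<integral>\<xi>. cos (y \<bullet> \<xi>) * h \<xi> \<partial>lborel) \<le> (\<integral>\<xi>. cos (x \<bullet> \<xi>) * h \<xi> \<partial>lborel)"
proof -
  let ?g = "\<lambda>n \<xi>::'a. exp (- (1 / real (Suc n)) * (norm \<xi>)\<^sup>2)"
  have [measurable]: "h \<in> borel_measurable borel" using radial_pdD(1)[OF pd] .
  have L: "(\<lambda>n. gauss_cos (1 / real (Suc n)) h x) \<longlonglongrightarrow> (\<integral>\<xi>. cos (x \<bullet> \<xi>) * h \<xi> \<partial>lborel)" for x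
    unfolding gauss_cos_def
  proof (rule integral_dominated_convergence[where w = "\<lambda>\<xi>. \<bar>h \<xi>\<bar>"])
    show "integrable lborel (\<lambda>\<xi>. \<bar>h \<xi>\<bar>)" using int by simp
    show "AE \<xi> in lborel. (\<lambda>n. cos (x \<bullet> \<xi>) * ?g n \<xi> * h \<xi>) \<longlonglongrightarrow> cos (x \<bullet> \<xi>) * h \<xi>"
    proof (rule AE_I2)
      fix \<xi>
      have "(\<lambda>n. cos (x \<bullet> \<xi>) * ?g n \<xi> * h \<xi>) \<longlonglongrightarrow> cos (x \<bullet> \<xi>) * exp (- 0 * (norm \<xi>)\<^sup>2) * h \<xi>"
        by (intro tendsto_intros LIMSEQ_Suc[OF lim_1_over_n])
      then show "(\<lambda>n. cos (x \<bullet> \<xi>) * ?g n \<xi> * h \<xi>) \<longlonglongrightarrow> cos (x \<bullet> \<xi>) * h \<xi>" by simp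
    qed
    fix n
    show "AE \<xi> in lborel. norm (cos (x \<bullet> \<xi>) * ?g n \<xi> * h \<xi>) \<le> \<bar>h \<xi>\<bar>"
    proof (rule AE_I2)
      fix \<xi>
      have "\<bar>cos (x \<bullet> \<xi>)\<bar> * ?g n \<xi> * \<bar>h \<xi>\<bar> \<le> 1 * 1 * \<bar>h \<xi>\<bar>"
        by (intro mult_mono) auto
      then show "norm (cos (x \<bullet> \<xi>) * ?g n \<xi> * h \<xi>) \<le> \<bar>h \<xi>\<bar>"
        by (simp add: abs_mult)
    qed
  qed measurable
  show "0 \<le> (\<integral>\<xi>. cos (x \<bullet> \<xi>) * h \<xi> \<partial>lborel)"
    by (rule LIMSEQ_le_const[OF L]) (use radial_pdD[OF pd] in auto)
  show "(\<integral>\<xi>. cos (y \<bullet> \<xi>) * h \<xi> \<partial>lborel) \<le> (\<integral>\<xi>. cos (x \<bullet> \<xi>) * h \<xi> \<partial>lborel)" if "norm x \<le> norm y"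
    by (rule LIMSEQ_le[OF L L]) (use radial_pdD(3)[OF pd _ that] in auto)
qed

lemma integrable_powr_tail:
  fixes c e :: real
  assumes "c > 0" "e < -1"
  shows "integrable lborel (\<lambda>s. indicator {c..} s * s powr e)"
proof -
  have "((\<lambda>s. s powr e) has_integral -(c powr (e + 1)) / (e + 1)) {c..}"
    using assms by (intro has_integral_powr_to_inf) auto
  then have "(\<lambda>s::real. s powr e) absolutely_integrable_on {c..}"
    by (intro nonnegative_absolutely_integrable_1) (auto simp: has_integral_integrable)
  then show ?thesis
    unfolding set_integrable_def by (subst (asm) integrable_completion) (auto simp: mult.commute)
qed

text \<open>The subordination formula for \<open>l powr a\<close>. Rescaling s by l extracts the
  power of l, and C is the integral for l = 1. The integrand is bounded by
  \<open>s powr (- a)\<close> near 0 and by \<open>s powr (-1 - a)\<close> at infinity, which is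
  where 0 < a < 1 enters.\<close>

lemma fractional_power_integral:
  fixes a :: real
  assumes a: "0 < a" "a < 1"
  obtains C where "C > 0"
    "\<And>l. l \<ge> 0 \<Longrightarrow> integrable lborel (\<lambda>s. indicator {0<..} s * ((1 - exp (- s * l)) * s powr (-1 - a)))"
    "\<And>l. l \<ge> 0 \<Longrightarrow> (\<integral>s. indicator {0<..} s * ((1 - exp (- s * l)) * s powr (-1 - a)) \<partial>lborel) = C * l powr a"
proof -
  define K where "K s = indicator {0<..} s * ((1 - exp (- s)) * s powr (-1 - a))" for s :: real
  have [measurable]: "K \<in> borel_measurable borel" unfolding K_def by measurable
  have K0: "K s \<ge> 0" for s by (auto simp: K_def indicator_def)
  have 1: "integrable lborel (\<lambda>s. indicator {0..1} s * s powr (-a))"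
  proof -
    have "((\<lambda>s. s powr (-a)) has_integral (1 powr (-a + 1) / (-a + 1))) {0..1}"
      using a by (intro has_integral_powr_from_0) auto
    then have "(\<lambda>s::real. s powr (-a)) absolutely_integrable_on {0..1}"
      by (intro nonnegative_absolutely_integrable_1) (auto simp: has_integral_integrable)
    then show ?thesis
      unfolding set_integrable_def by (subst (asm) integrable_completion) (auto simp: mult.commute)
  qed
  have 2: "integrable lborel (\<lambda>s. indicator {1..} s * s powr (-1 - a))"
    by (rule integrable_powr_tail) (use a in auto)
  have Kle: "K s \<le> indicator {0..1} s * s powr (-a) + indicator {1..} s * s powr (-1 - a)" for s
  proof (cases "s > 0")
    case True
    have "1 - exp (- s) \<le> s" using exp_ge_add_one_self[of "-s"] by simp
    then have "(1 - exp (- s)) * s powr (-1 - a) \<le> s * s powr (-1 - a)" by (rule mult_right_mono) simp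
    also have "\<dots> = s powr (-a)" using True powr_add[of s 1 "-1 - a"] by simp
    finally have A: "(1 - exp (- s)) * s powr (-1 - a) \<le> s powr (-a)" .
    have B: "(1 - exp (- s)) * s powr (-1 - a) \<le> 1 * s powr (-1 - a)" by (rule mult_right_mono) auto
    show ?thesis using True A B exp_ge_zero[of "-1 :: real"] by (auto simp: K_def indicator_def simp del: exp_ge_zero)
  qed (auto simp: K_def indicator_def)
  have Ki: "integrable lborel K"
    by (rule Bochner_Integration.integrable_bound[OF Bochner_Integration.integrable_add[OF 1 2]])
       (use Kle K0 in \<open>auto intro!: order_trans[OF Kle]\<close>)
  define C where "C = (\<integral>s. K s \<partial>lborel)"
  have "C > 0"
  proof -
    define k where "k = (1 - exp (-1)) * 2 powr (-1 - a)"
    have k: "k > 0" by (simp add: k_def)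
    have "k * indicator {1..2} s \<le> K s" for s :: real
    proof (cases "s \<in> {1..2}")
      case True
      then have "(1 - exp (-1)) * 2 powr (-1 - a) \<le> (1 - exp (- s)) * s powr (-1 - a)"
        using a by (intro mult_mono powr_mono2') auto
      then show ?thesis using True by (simp add: K_def k_def)
    qed (use K0 in auto)
    then have "(\<integral>s. k * indicator {1..2::real} s \<partial>lborel) \<le> C"
      unfolding C_def by (intro integral_mono Ki) (auto intro!: integrable_mult_right)
    then show ?thesis using k by simp
  qed
  show ?thesis
  proof (rule that[OF \<open>C > 0\<close>])
    fix l :: real assume l: "l \<ge> 0"
    let ?g = "\<lambda>s. indicator {0<..} s * ((1 - exp (- s * l)) * s powr (-1 - a))"
    have "integrable lborel ?g \<and> (\<integral>s. ?g s \<partial>lborel) = C * l powr a"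
    proof (cases "l = 0")
      case False
      then have l: "l > 0" using l by simp
      have eq: "K (0 + l * s) = l powr (-1 - a) * ?g s" for s
        using l by (auto simp: K_def indicator_def powr_mult zero_less_mult_iff mult_ac)
      have 0: "integrable lborel (\<lambda>s. K (0 + l * s))"
        using Ki lborel_integrable_real_affine_iff[of l K 0] l by simp
      then have "integrable lborel (\<lambda>s. l powr (1 + a) * (l powr (-1 - a) * ?g s))"
        unfolding eq by (rule integrable_mult_right)
      moreover have ll: "l powr (1 + a) * (l powr (-1 - a) * u) = u" for u
        using l powr_add[of l "1 + a" "-1 - a"] by (simp flip: mult.assoc)
      ultimately have I: "integrable lborel ?g" by simp
      have "C = l * (l powr (-1 - a) * (\<integral>s. ?g s \<partial>lborel))"
        using lborel_integral_real_affine[of l K 0] l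
        unfolding C_def eq integral_mult_right_zero by simp
      then have "l powr (1 + a) * C = l * (\<integral>s. ?g s \<partial>lborel)" using ll by (metis mult.left_commute)
      also have "l powr (1 + a) = l * l powr a" using l by (simp add: powr_add)
      finally show ?thesis using I l by (simp add: mult_ac)
    qed simp
    then show "integrable lborel ?g" "(\<integral>s. ?g s \<partial>lborel) = C * l powr a" by blast+
  qed
qed

text \<open>For \<theta> = 2 the exponential merely raises the Gaussian parameter by t. For \<theta>
  < 2 the subordination formula is applied with \<open>a = \<theta> / 2\<close> at the squared
  norm.\<close>

lemma radial_pd_exp_neg_norm_powr:
  assumes \<theta>: "0 < \<theta>" "\<theta> \<le> 2" and t: "t > 0"
  shows "radial_pd (\<lambda>\<xi>::'a::euclidean_space. exp (- (t * norm \<xi> powr \<theta>)))"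
proof (cases "\<theta> = 2")
  case True
  have [simp]: "norm \<xi> powr \<theta> = (norm \<xi>)\<^sup>2" for \<xi> :: 'a using True by (cases "\<xi> = 0") (auto simp: powr_numeral)
  have eq: "gauss_cos \<delta> (\<lambda>\<xi>::'a. exp (- (t * norm \<xi> powr \<theta>))) = gauss_cos (\<delta> + t) (\<lambda>_. 1)" for \<delta>
    by (rule ext) (simp add: gauss_cos_def mult.assoc exp_add[symmetric] algebra_simps)
  show ?thesis
  proof (rule radial_pdI[where B = 1])
    fix \<delta> :: real and x y :: 'a assume "\<delta> > 0" "norm x \<le> norm y"
    then show "0 \<le> gauss_cos \<delta> (\<lambda>\<xi>. exp (- (t * norm \<xi> powr \<theta>))) y"
      "gauss_cos \<delta> (\<lambda>\<xi>. exp (- (t * norm \<xi> powr \<theta>))) y \<le> gauss_cos \<delta> (\<lambda>\<xi>. exp (- (t * norm \<xi> powr \<theta>))) x"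
      unfolding eq using t by (auto intro!: radial_pdD[OF radial_pd_const])
  qed (use t in auto)
next
  case False
  define a where "a = \<theta> / 2"
  have a: "0 < a" "a < 1" using \<theta> False by (auto simp: a_def)
  obtain C where C: "C > 0"
    "\<And>l. l \<ge> 0 \<Longrightarrow> integrable lborel (\<lambda>s. indicator {0<..} s * ((1 - exp (- s * l)) * s powr (-1 - a)))"
    "\<And>l. l \<ge> 0 \<Longrightarrow> (\<integral>s. indicator {0<..} s * ((1 - exp (- s * l)) * s powr (-1 - a)) \<partial>lborel) = C * l powr a"
    using fractional_power_integral[OF a] by blast
  \<comment> \<open>The density \<open>t / C * s powr (-1 - a)\<close> has infinite mass at 0. Cut
    off at 1 / (n + 1) it has finite mass \<open>M n\<close>, and \<open>M n - m n \<xi>\<close>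
    converges to the wanted exponent although \<open>M n\<close> itself diverges.\<close>
  define \<nu> where "\<nu> n s = t / C * (indicator {1 / real (Suc n)..} s * s powr (-1 - a))" for n s
  have \<nu>: "integrable lborel (\<nu> n)" "\<nu> n s \<ge> 0" "s < 0 \<Longrightarrow> \<nu> n s = 0" for n s
  proof -
    have "integrable lborel (\<lambda>s. indicator {1 / real (Suc n)..} s * s powr (-1 - a))"
      by (rule integrable_powr_tail) (use a in auto)
    then show "integrable lborel (\<nu> n)" unfolding \<nu>_def by (rule integrable_mult_right)
    show "\<nu> n s \<ge> 0" using C(1) t by (simp add: \<nu>_def)
    show "\<nu> n s = 0" if "s < 0"
    proof -
      have "s < 1 / real (Suc n)" using that by (meson divide_nonneg_nonneg le_less_trans less_le_not_le not_le of_nat_0_le_iff order_less_le_trans zero_le_one)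
      then show ?thesis by (simp add: \<nu>_def)
    qed
  qed
  define m where "m n \<xi> = (\<integral>s. \<nu> n s * exp (- s * (norm \<xi>)\<^sup>2) \<partial>lborel)" for n and \<xi> :: 'a
  define M where "M n = (\<integral>s. \<nu> n s \<partial>lborel)" for n
  let ?d = "\<lambda>n s \<xi>. \<nu> n s - \<nu> n s * exp (- s * (norm \<xi>)\<^sup>2)"
  have [measurable]: "\<nu> n \<in> borel_measurable borel" for n using \<nu>(1)[of n] by auto
  have le: "\<nu> n s * exp (- s * (norm \<xi>)\<^sup>2) \<le> \<nu> n s"
    and mi: "integrable lborel (\<lambda>s. \<nu> n s * exp (- s * (norm \<xi>)\<^sup>2))"
    and mM: "m n \<xi> \<le> M n" for n s and \<xi> :: 'a
    unfolding m_def M_def by (rule laplace_bounds[OF \<nu>]; simp)+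
  have lim: "(\<lambda>n. M n - m n \<xi>) \<longlonglongrightarrow> t * norm \<xi> powr \<theta>" for \<xi>
  proof -
    let ?g = "\<lambda>s. indicator {0<..} s * ((1 - exp (- s * (norm \<xi>)\<^sup>2)) * s powr (-1 - a))"
    have "(\<lambda>n. \<integral>s. ?d n s \<xi> \<partial>lborel) \<longlonglongrightarrow> (\<integral>s. t / C * ?g s \<partial>lborel)"
    proof (rule integral_dominated_convergence[where w = "\<lambda>s. t / C * ?g s"])
      show "integrable lborel (\<lambda>s. t / C * ?g s)" by (intro integrable_mult_right C(2)) simp
      show "AE s in lborel. (\<lambda>n. ?d n s \<xi>) \<longlonglongrightarrow> t / C * ?g s"
      proof (rule AE_I2)
        fix s :: real
        have "\<forall>\<^sub>F n in sequentially. ?d n s \<xi> = t / C * ?g s"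
        proof (cases "s > 0")
          case True
          have "\<forall>\<^sub>F n in sequentially. 1 / real (Suc n) < s"
            using order_tendstoD(2)[OF LIMSEQ_Suc[OF lim_1_over_n] True] by simp
          then show ?thesis
            by eventually_elim (use True in \<open>simp add: \<nu>_def algebra_simps\<close>)
        next
          case False
          then have "s < 1 / real (Suc n)" for n
            by (meson divide_pos_pos le_less_trans not_less of_nat_0_less_iff zero_less_Suc zero_less_one)
          then have "\<nu> n s = 0" for n unfolding \<nu>_def indicator_def by (simp add: not_le del: of_nat_Suc)
          then show ?thesis using False by simp
        qed
        then show "(\<lambda>n. ?d n s \<xi>) \<longlonglongrightarrow> t / C * ?g s"
          by (rule tendsto_eventually)
      qed
      fix n
      show "AE s in lborel. norm (?d n s \<xi>) \<le> t / C * ?g s"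
      proof (rule AE_I2)
        fix s :: real
        have "?d n s \<xi> \<le> t / C * ?g s"
        proof (cases "s \<ge> 1 / real (Suc n)")
          case True
          then have "s > 0" by (meson divide_pos_pos less_le_trans of_nat_0_less_iff zero_less_Suc zero_less_one)
          then show ?thesis using True by (simp add: \<nu>_def algebra_simps)
        next
          case False
          then show ?thesis using C(1) t by (simp add: \<nu>_def indicator_def)
        qed
        then show "norm (?d n s \<xi>) \<le> t / C * ?g s"
          using le[of n s \<xi>] by simp
      qed
    qed measurable
    moreover have "(\<integral>s. ?d n s \<xi> \<partial>lborel) = M n - m n \<xi>" for n
      unfolding M_def m_def by (intro Bochner_Integration.integral_diff \<nu> mi)
    moreover have "(\<integral>s. t / C * ?g s \<partial>lborel) = t * norm \<xi> powr \<theta>"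
    proof -
      have "(norm \<xi>)\<^sup>2 powr a = (norm \<xi> powr 2) powr a" by (cases "\<xi> = 0") (simp_all add: powr_numeral)
      also have "\<dots> = norm \<xi> powr \<theta>" by (simp only: powr_powr a_def) simp
      finally have "(\<integral>s. ?g s \<partial>lborel) = C * norm \<xi> powr \<theta>" using C(3)[of "(norm \<xi>)\<^sup>2"] by (simp only: zero_le_power2)
      then show ?thesis using C(1) by (simp only: integral_mult_right_zero) simp
    qed
    ultimately show ?thesis by simp
  qed
  show ?thesis
  \<comment> \<open>In \<open>exp (- (M n - m n \<xi>))\<close> the mixture \<open>m n\<close>
    carries a positive sign, as \<open>radial_pd_exp_laplace\<close> requires, and the diverging
    mass is only a positive constant factor. The uniform bound 1 comes from
    \<open>mM\<close>.\<close>
  proof (rule radial_pd_limit[where h = "\<lambda>n \<xi>. exp (- M n) * exp (m n \<xi>)" and B = 1])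
    show "radial_pd (\<lambda>\<xi>. exp (- M n) * exp (m n \<xi>))" for n
      unfolding m_def by (intro radial_pd_cmult radial_pd_exp_laplace \<nu>) auto
    show "\<bar>exp (- M n) * exp (m n \<xi>)\<bar> \<le> 1" for n \<xi>
      using mM[of n \<xi>] by (simp add: exp_add[symmetric])
    have "(\<lambda>n. exp (- (M n - m n \<xi>))) \<longlonglongrightarrow> exp (- (t * norm \<xi> powr \<theta>))" for \<xi>
      by (intro tendsto_intros lim)
    then show "(\<lambda>n. exp (- M n) * exp (m n \<xi>)) \<longlonglongrightarrow> exp (- (t * norm \<xi> powr \<theta>))" for \<xi>
      by (simp add: exp_add[symmetric])
  qed
qed

section \<open>Mass, Fourier transform, semigroup law and tail of the fundamental solution\<close>

lemma G_eq:
  fixes x :: "'a::euclidean_space"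
  assumes "t > 0" "\<theta> > 0"
  shows "G \<theta> x t = (1 / (2 * pi) ^ DIM('a)) * (\<integral>\<xi>. cos (x \<bullet> \<xi>) * exp (- (t * norm \<xi> powr \<theta>)) \<partial>lborel)"
proof -
  let ?g = "\<lambda>\<xi>. exp (\<i> * of_real (x \<bullet> \<xi>) - of_real (t * norm \<xi> powr \<theta>))"
  have int: "integrable lborel ?g"
    by (rule Bochner_Integration.integrable_bound[OF integrable_exp_neg_norm_powr[OF assms]]) (auto simp: norm_exp_eq_Re)
  have Re: "Re (?g \<xi>) = cos (x \<bullet> \<xi>) * exp (- (t * norm \<xi> powr \<theta>))" for \<xi>
    by (simp add: Re_exp)
  have "(1 / (2 * of_real pi) ^ DIM('a) :: complex) = of_real (1 / (2 * pi) ^ DIM('a))" by simp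
  moreover have "Re (of_real c * z) = c * Re z" for c z by simp
  ultimately show ?thesis
    unfolding G_def using integral_Re[OF int] by (simp only: Re)
qed

lemma G_nonneg:
  assumes "0 < \<theta>" "\<theta> \<le> 2" "t > 0"
  shows "0 \<le> G \<theta> x t"
  unfolding G_eq[OF assms(3,1)]
  by (intro mult_nonneg_nonneg radial_pd_fourier radial_pd_exp_neg_norm_powr integrable_exp_neg_norm_powr) (use assms in auto)

lemma G_antimono:
  fixes x y :: "'a::euclidean_space"
  assumes "0 < \<theta>" "\<theta> \<le> 2" "t > 0" "norm x \<le> norm y"
  shows "G \<theta> y t \<le> G \<theta> x t"
  unfolding G_eq[OF assms(3,1)]
  by (intro mult_left_mono radial_pd_fourier radial_pd_exp_neg_norm_powr integrable_exp_neg_norm_powr) (use assms in auto)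

lemma G_minus:
  assumes "0 < \<theta>" "t > 0"
  shows "G \<theta> (- x) t = G \<theta> x t"
  unfolding G_eq[OF assms(2,1)] by simp

lemma borel_measurable_G [measurable]:
  assumes [measurable]: "f \<in> borel_measurable M" "g \<in> borel_measurable M"
  shows "(\<lambda>z. G \<theta> (f z :: 'a::euclidean_space) (g z)) \<in> borel_measurable M"
  unfolding G_def by measurable

text \<open>The value at the origin is the maximum of the kernel, and it is the quantity that
  carries the power of t in the smoothing estimate.\<close>

lemma G_zero_scale:
  assumes "0 < \<theta>" "t > 0"
  shows "G \<theta> (0 :: 'a::euclidean_space) t = t powr (- (DIM('a) / \<theta>)) * G \<theta> (0 :: 'a) 1"
proof -
  define c where "c = t powr (- (1 / \<theta>))"
  have c: "c > 0" using assms by (simp add: c_def)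
  have "(\<integral>\<xi>. exp (- (t * norm (\<xi>::'a) powr \<theta>)) \<partial>lborel) = c ^ DIM('a) * (\<integral>\<xi>. exp (- (t * norm (0 + c *\<^sub>R (\<xi>::'a)) powr \<theta>)) \<partial>lborel)"
    using integral_lborel_affine[of "\<lambda>\<xi>::'a. exp (- (t * norm \<xi> powr \<theta>))" c 0] c by simp
  also have "(\<integral>\<xi>. exp (- (t * norm (0 + c *\<^sub>R (\<xi>::'a)) powr \<theta>)) \<partial>lborel) = (\<integral>\<xi>. exp (- (1 * norm (\<xi>::'a) powr \<theta>)) \<partial>lborel)"
  proof -
    have "c powr \<theta> = t powr (-1)" using assms unfolding c_def powr_powr by simp
    then have "c powr \<theta> = 1 / t" using assms by (simp add: powr_minus_divide)
    then show ?thesis using assms c by (simp add: powr_mult)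
  qed
  also have "c ^ DIM('a) = t powr (- (DIM('a) / \<theta>))"
    using assms by (simp add: c_def powr_realpow[symmetric] powr_powr)
  finally show ?thesis using assms by (simp add: G_eq)
qed

text \<open>Parseval's identity for G against a modulated Gaussian. The Gaussian makes Fubini
  legitimate before G is known to be integrable. The substitution
  \<open>\<xi> = \<eta> + (2 * sqrt l) *\<^sub>R \<zeta>\<close> makes the weight independent of l,
  so that l can tend to 0 under the integral.\<close>

lemma G_gaussian_pairing:
  fixes \<eta> :: "'a::euclidean_space"
  assumes \<theta>: "0 < \<theta>" and t: "t > 0" and l: "l > 0"
  shows "integrable lborel (\<lambda>x::'a. G \<theta> x t * cos (x \<bullet> \<eta>) * exp (- l * (norm x)\<^sup>2))"
    and "(\<integral>x. G \<theta> x t * cos (x \<bullet> \<eta>) * exp (- l * (norm x)\<^sup>2) \<partial>lborel) =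
     (1 / sqrt pi) ^ DIM('a) * (\<integral>\<zeta>. exp (- (norm \<zeta>)\<^sup>2) * exp (- (t * norm (\<eta> + (2 * sqrt l) *\<^sub>R \<zeta>) powr \<theta>)) \<partial>lborel)"
proof -
  let ?g = "\<lambda>x::'a. exp (- l * (norm x)\<^sup>2)"
  define E where "E \<xi> = exp (- (t * norm \<xi> powr \<theta>))" for \<xi> :: 'a
  \<comment> \<open>\<open>A\<close> is the Fourier transform of the Gaussian with parameter
    l.\<close>
  define A where "A z = sqrt (pi / l) ^ DIM('a) * exp (- (norm z)\<^sup>2 / (4 * l))" for z :: 'a
  have [measurable]: "E \<in> borel_measurable borel" "A \<in> borel_measurable borel" unfolding E_def A_def by measurable
  have Ei: "integrable lborel E" unfolding E_def by (rule integrable_exp_neg_norm_powr[OF t \<theta>])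
  let ?M = "\<integral>\<xi>. A (\<xi> - \<eta>) * E \<xi> \<partial>lborel"
  let ?P = "\<integral>\<xi>. A (\<xi> + \<eta>) * E \<xi> \<partial>lborel"
  let ?J = "\<integral>\<zeta>. exp (- (norm \<zeta>)\<^sup>2) * E (\<eta> + (2 * sqrt l) *\<^sub>R \<zeta>) \<partial>lborel"
  have gi: "integrable lborel (\<lambda>x::'a. ?g x)" by (rule gaussian_fourier(1)[OF l])
  have E0: "E (- \<xi>) = E \<xi>" "0 \<le> E \<xi>" for \<xi> by (simp_all add: E_def)
  have A_le: "0 \<le> A z" "A z \<le> sqrt (pi / l) ^ DIM('a)" for z
    using l by (auto simp: A_def intro!: mult_left_le)
  let ?f = "\<lambda>x \<xi>. cos (x \<bullet> \<xi>) * cos (x \<bullet> \<eta>) * ?g x * E \<xi>"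
  have bd: "\<bar>?f x \<xi>\<bar> \<le> ?g x * E \<xi>" for x \<xi>
  proof -
    have "\<bar>cos (x \<bullet> \<xi>)\<bar> * \<bar>cos (x \<bullet> \<eta>)\<bar> * (?g x * E \<xi>) \<le> 1 * 1 * (?g x * E \<xi>)"
      using E0 by (intro mult_mono) auto
    then show ?thesis using E0 by (simp add: abs_mult mult.assoc)
  qed
  have meas: "(\<lambda>(x, \<xi>). ?f x \<xi>) \<in> borel_measurable (lborel \<Otimes>\<^sub>M lborel)" by measurable
  note F = lborel_pair.Fubini_dominated[OF meas gi Ei bd]
  have inner1: "(\<integral>\<xi>. ?f x \<xi> \<partial>lborel) = (2 * pi) ^ DIM('a) * (G \<theta> x t * cos (x \<bullet> \<eta>) * ?g x)" for x
  proof -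
    have "?f x \<xi> = (cos (x \<bullet> \<eta>) * ?g x) * (cos (x \<bullet> \<xi>) * E \<xi>)" for \<xi> by (simp add: mult_ac)
    then have "(\<integral>\<xi>. ?f x \<xi> \<partial>lborel) = (cos (x \<bullet> \<eta>) * ?g x) * (\<integral>\<xi>. cos (x \<bullet> \<xi>) * E \<xi> \<partial>lborel)"
      by (simp only: integral_mult_right_zero)
    then show ?thesis unfolding G_eq[OF t \<theta>] E_def by simp
  qed
  have cosi: "integrable lborel (\<lambda>x::'a. cos (z \<bullet> x) * ?g x)" for z
    using integrable_gauss_cos[of "\<lambda>_. 1" 1 l z] l by simp
  have inner2: "(\<integral>x. ?f x \<xi> \<partial>lborel) = (A (\<xi> + \<eta>) + A (\<xi> - \<eta>)) / 2 * E \<xi>" for \<xi>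
  proof -
    have "?f x \<xi> = (E \<xi> / 2) * (cos ((\<xi> + \<eta>) \<bullet> x) * ?g x + cos ((\<xi> - \<eta>) \<bullet> x) * ?g x)" for x
      by (simp add: inner_add_left inner_diff_left cos_add cos_diff inner_commute algebra_simps)
    then have "(\<integral>x. ?f x \<xi> \<partial>lborel) = (E \<xi> / 2) * ((\<integral>x. cos ((\<xi> + \<eta>) \<bullet> x) * ?g x \<partial>lborel) + (\<integral>x. cos ((\<xi> - \<eta>) \<bullet> x) * ?g x \<partial>lborel))"
      by (simp only: integral_mult_right_zero Bochner_Integration.integral_add[OF cosi cosi])
    then show ?thesis by (simp only: gaussian_fourier(2)[OF l] A_def[symmetric]) simp
  qed
  have AE_int: "integrable lborel (\<lambda>\<xi>. A (\<xi> + c) * E \<xi>)" for c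
    by (rule Bochner_Integration.integrable_bound[OF integrable_mult_right[OF Ei, of "sqrt (pi / l) ^ DIM('a)"]])
       (use A_le E0 in \<open>auto simp: abs_mult intro!: AE_I2 mult_right_mono order_trans[OF A_le(2)]\<close>)
  \<comment> \<open>The product of the two cosines produces Gaussians centred at \<eta> and at -
    \<eta>. Since \<open>E\<close> is even, both contribute equally.\<close>
  have "?P = (\<integral>\<xi>. A (0 - \<xi> + \<eta>) * E (0 - \<xi>) \<partial>lborel)"
    by (rule integral_lborel_reflect[of "\<lambda>\<xi>. A (\<xi> + \<eta>) * E \<xi>" 0, symmetric]) measurable
  also have "(\<lambda>\<xi>. A (0 - \<xi> + \<eta>) * E (0 - \<xi>)) = (\<lambda>\<xi>. A (\<xi> - \<eta>) * E \<xi>)"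
    by (simp add: E0 A_def norm_minus_commute)
  finally have sym: "?P = ?M" .
  have "(\<integral>\<xi>. (\<integral>x. ?f x \<xi> \<partial>lborel) \<partial>lborel) = (\<integral>\<xi>. (1 / 2) * (A (\<xi> + \<eta>) * E \<xi> + A (\<xi> - \<eta>) * E \<xi>) \<partial>lborel)"
    by (simp only: inner2) (simp add: algebra_simps add_divide_distrib)
  also have "\<dots> = (1 / 2) * (?P + ?M)"
    using AE_int[of \<eta>] AE_int[of "- \<eta>"] by simp
  also have "\<dots> = ?M" unfolding sym by simp
  also have "\<dots> = (2 * sqrt l) ^ DIM('a) * (\<integral>\<zeta>. A ((2 * sqrt l) *\<^sub>R \<zeta>) * E (\<eta> + (2 * sqrt l) *\<^sub>R \<zeta>) \<partial>lborel)"
    using integral_lborel_affine[of "\<lambda>\<xi>. A (\<xi> - \<eta>) * E \<xi>" "2 * sqrt l" \<eta>] l by simp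
  also have "(\<integral>\<zeta>. A ((2 * sqrt l) *\<^sub>R \<zeta>) * E (\<eta> + (2 * sqrt l) *\<^sub>R \<zeta>) \<partial>lborel)
     = sqrt (pi / l) ^ DIM('a) * ?J"
  proof -
    have "A ((2 * sqrt l) *\<^sub>R \<zeta>) = sqrt (pi / l) ^ DIM('a) * exp (- (norm \<zeta>)\<^sup>2)" for \<zeta>
      using l by (simp add: A_def power_mult_distrib)
    then show ?thesis by (simp only: mult.assoc integral_mult_right_zero)
  qed
  finally have R: "(\<integral>\<xi>. (\<integral>x. ?f x \<xi> \<partial>lborel) \<partial>lborel) = (2 * sqrt l) ^ DIM('a) * (sqrt (pi / l) ^ DIM('a) * ?J)" .
  have L: "(\<integral>x. (\<integral>\<xi>. ?f x \<xi> \<partial>lborel) \<partial>lborel) = (2 * pi) ^ DIM('a) * (\<integral>x. G \<theta> x t * cos (x \<bullet> \<eta>) * ?g x \<partial>lborel)"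
    by (simp only: inner1 integral_mult_right_zero)
  have coef: "(2 * sqrt l) ^ DIM('a) * sqrt (pi / l) ^ DIM('a) = (2 * pi) ^ DIM('a) * (1 / sqrt pi) ^ DIM('a)"
  proof -
    have "2 * sqrt l * sqrt (pi / l) = 2 * sqrt pi" using l by (simp add: real_sqrt_divide)
    also have "sqrt pi = pi / sqrt pi" by (simp add: real_div_sqrt)
    finally have "2 * sqrt l * sqrt (pi / l) = 2 * pi * (1 / sqrt pi)" by simp
    then show ?thesis unfolding power_mult_distrib[symmetric] by simp
  qed
  have "(2 * pi) ^ DIM('a) * (\<integral>x. G \<theta> x t * cos (x \<bullet> \<eta>) * ?g x \<partial>lborel) = (2 * pi) ^ DIM('a) * ((1 / sqrt pi) ^ DIM('a) * ?J)"
    unfolding L[symmetric] F(1) R mult.assoc[symmetric] coef ..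
  then show "(\<integral>x. G \<theta> x t * cos (x \<bullet> \<eta>) * ?g x \<partial>lborel) =
     (1 / sqrt pi) ^ DIM('a) * (\<integral>\<zeta>. exp (- (norm \<zeta>)\<^sup>2) * exp (- (t * norm (\<eta> + (2 * sqrt l) *\<^sub>R \<zeta>) powr \<theta>)) \<partial>lborel)"
    unfolding E_def by simp
  have "integrable lborel (\<lambda>x. (2 * pi) ^ DIM('a) * (G \<theta> x t * cos (x \<bullet> \<eta>) * ?g x))"
    using F(2) unfolding inner1 .
  from integrable_mult_right[OF this, of "1 / (2 * pi) ^ DIM('a)"]
  show "integrable lborel (\<lambda>x::'a. G \<theta> x t * cos (x \<bullet> \<eta>) * ?g x)" by simp
qed

text \<open>The right-hand side of the pairing for l = 1 / (n + 1): the Gaussian averages of a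
  bounded continuous function concentrate at \<eta>.\<close>

lemma gaussian_average_limit:
  fixes \<eta> :: "'a::euclidean_space"
  assumes \<theta>: "0 < \<theta>" and t: "t > 0"
  shows "(\<lambda>n. (1 / sqrt pi) ^ DIM('a) * (\<integral>\<zeta>. exp (- (norm \<zeta>)\<^sup>2) * exp (- (t * norm (\<eta> + (2 * sqrt (1 / real (Suc n))) *\<^sub>R \<zeta>) powr \<theta>)) \<partial>lborel))
    \<longlonglongrightarrow> exp (- (t * norm \<eta> powr \<theta>))"
proof -
  let ?e = "\<lambda>r \<zeta>::'a. exp (- (norm \<zeta>)\<^sup>2) * exp (- (t * norm (\<eta> + (2 * sqrt r) *\<^sub>R \<zeta>) powr \<theta>))"
  have gi: "integrable lborel (\<lambda>\<zeta>::'a. exp (- (norm \<zeta>)\<^sup>2))" using gaussian_fourier(1)[of 1] by simp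
  have "(\<lambda>n. \<integral>\<zeta>. exp (- (norm (\<zeta>::'a))\<^sup>2) * exp (- (t * norm (\<eta> + (2 * sqrt (1 / real (Suc n))) *\<^sub>R \<zeta>) powr \<theta>)) \<partial>lborel)
    \<longlonglongrightarrow> (\<integral>\<zeta>. ?e 0 \<zeta> \<partial>lborel)"
  proof (rule integral_dominated_convergence[where w = "\<lambda>\<zeta>::'a. exp (- (norm \<zeta>)\<^sup>2)"])
    show "AE \<zeta> in lborel. (\<lambda>n. ?e (1 / real (Suc n)) \<zeta>)
      \<longlonglongrightarrow> ?e 0 \<zeta>"
      by (intro AE_I2 tendsto_intros tendsto_powr' LIMSEQ_Suc[OF lim_1_over_n]) (use \<theta> in auto)
    show "AE \<zeta> in lborel. norm (?e (1 / real (Suc n)) \<zeta>) \<le> exp (- (norm \<zeta>)\<^sup>2)" for n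
      using t by (intro AE_I2) (auto intro!: mult_left_le)
  qed (use gi in simp_all)
  from tendsto_mult_left[OF this, of "(1 / sqrt pi) ^ DIM('a)"] show ?thesis
    using gaussian_fourier(2)[of 1 "0::'a"] by (simp add: power_divide)
qed

text \<open>Because G is nonnegative, the Gaussian-damped kernels increase to G as the damping
  disappears. Monotone convergence then yields integrability and mass together, the limit of the
  integrals being known from the pairing at frequency 0.\<close>

lemma G_integral:
  assumes \<theta>: "0 < \<theta>" "\<theta> \<le> 2" and t: "t > 0"
  shows "integrable lborel (\<lambda>x::'a::euclidean_space. G \<theta> x t)"
    and "(\<integral>\<^sup>+x. ennreal (G \<theta> (x::'a) t) \<partial>lborel) = 1"
proof -
  define h where "h n x = G \<theta> x t * exp (- (1 / real (Suc n)) * (norm x)\<^sup>2)" for n and x :: 'a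
  have hi: "integrable lborel (\<lambda>x. h n x)" for n
    unfolding h_def using G_gaussian_pairing(1)[OF \<theta>(1) t, of "1 / real (Suc n)" "0::'a"] by simp
  have mono: "AE x in lborel. mono (\<lambda>n. h n x)"
    using G_nonneg[OF \<theta> t] by (intro AE_I2 monoI) (auto simp: h_def field_simps intro!: mult_left_mono mult_right_mono)
  have lim: "AE x in lborel. (\<lambda>n. h n x) \<longlonglongrightarrow> G \<theta> x t"
  proof (rule AE_I2)
    fix x :: 'a
    have "(\<lambda>n. h n x) \<longlonglongrightarrow> G \<theta> x t * exp (- 0 * (norm x)\<^sup>2)"
      unfolding h_def by (intro tendsto_intros LIMSEQ_Suc[OF lim_1_over_n])
    then show "(\<lambda>n. h n x) \<longlonglongrightarrow> G \<theta> x t" by simp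
  qed
  have "(\<lambda>n. integral\<^sup>L lborel (h n)) \<longlonglongrightarrow> exp (- (t * norm (0::'a) powr \<theta>))"
  proof -
    have "integral\<^sup>L lborel (h n) = (\<integral>x. G \<theta> (x::'a) t * cos (x \<bullet> 0) * exp (- (1 / real (Suc n)) * (norm x)\<^sup>2) \<partial>lborel)" for n
      by (rule Bochner_Integration.integral_cong) (simp_all add: h_def)
    then show ?thesis
      using gaussian_average_limit[OF \<theta>(1) t, of "0::'a"] by (simp only: G_gaussian_pairing(2)[OF \<theta>(1) t] zero_less_divide_1_iff of_nat_0_less_iff zero_less_Suc)
  qed
  then have I: "(\<lambda>n. integral\<^sup>L lborel (h n)) \<longlonglongrightarrow> 1" by simp
  show i: "integrable lborel (\<lambda>x::'a. G \<theta> x t)"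
    by (rule integrable_monotone_convergence[OF hi mono lim I]) simp
  have "(\<integral>x. G \<theta> (x::'a) t \<partial>lborel) = 1"
    by (rule integral_monotone_convergence[OF hi mono lim I]) simp
  then show "(\<integral>\<^sup>+x. ennreal (G \<theta> (x::'a) t) \<partial>lborel) = 1"
    using G_nonneg[OF \<theta> t] i by (subst nn_integral_eq_integral) auto
qed

lemma G_fourier:
  fixes \<eta> :: "'a::euclidean_space"
  assumes \<theta>: "0 < \<theta>" "\<theta> \<le> 2" and t: "t > 0"
  shows "(\<integral>x. G \<theta> x t * cos (x \<bullet> \<eta>) \<partial>lborel) = exp (- (t * norm \<eta> powr \<theta>))"
proof -
  let ?g = "\<lambda>n x::'a. exp (- (1 / real (Suc n)) * (norm x)\<^sup>2)"
  have "(\<lambda>n. \<integral>x. G \<theta> x t * cos (x \<bullet> \<eta>) * ?g n x \<partial>lborel) \<longlonglongrightarrow> (\<integral>x. G \<theta> x t * cos (x \<bullet> \<eta>) * exp (- 0 * (norm x)\<^sup>2) \<partial>lborel)"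
  proof (rule integral_dominated_convergence[where w = "\<lambda>x. G \<theta> x t"])
    show "AE x in lborel. (\<lambda>n. G \<theta> x t * cos (x \<bullet> \<eta>) * ?g n x) \<longlonglongrightarrow> G \<theta> x t * cos (x \<bullet> \<eta>) * exp (- 0 * (norm x)\<^sup>2)"
      by (intro AE_I2 tendsto_intros LIMSEQ_Suc[OF lim_1_over_n])
    show "AE x in lborel. norm (G \<theta> x t * cos (x \<bullet> \<eta>) * ?g n x) \<le> G \<theta> x t" for n
    proof (rule AE_I2)
      fix x
      have "G \<theta> x t * \<bar>cos (x \<bullet> \<eta>)\<bar> * ?g n x \<le> G \<theta> x t * 1 * 1"
        using G_nonneg[OF \<theta> t] by (intro mult_mono) auto
      then show "norm (G \<theta> x t * cos (x \<bullet> \<eta>) * ?g n x) \<le> G \<theta> x t"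
        using G_nonneg[OF \<theta> t, of x] by (simp add: abs_mult)
    qed
  qed (use G_integral(1)[OF \<theta> t] in simp_all)
  moreover have "(\<lambda>n. \<integral>x. G \<theta> x t * cos (x \<bullet> \<eta>) * ?g n x \<partial>lborel) \<longlonglongrightarrow> exp (- (t * norm \<eta> powr \<theta>))"
    using gaussian_average_limit[OF \<theta>(1) t, of \<eta>] by (subst G_gaussian_pairing(2)[OF \<theta>(1) t]) auto
  ultimately show ?thesis using LIMSEQ_unique by simp blast
qed

text \<open>Only the second kernel is expanded as a Fourier integral. Integrating the first one over
  y then gives its Fourier transform at \<xi>, where the sine part vanishes because G is even, and
  the two exponentials multiply.\<close>

lemma G_semigroup:
  fixes x :: "'a::euclidean_space"
  assumes \<theta>: "0 < \<theta>" "\<theta> \<le> 2" and t: "t > 0" and s: "s > 0"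
  shows "(\<integral>\<^sup>+y. ennreal (G \<theta> (x - y) t) * ennreal (G \<theta> y s) \<partial>lborel) = ennreal (G \<theta> x (t + s))"
proof -
  define E where "E \<xi> = exp (- (s * norm \<xi> powr \<theta>))" for \<xi> :: 'a
  have [measurable]: "E \<in> borel_measurable borel" unfolding E_def by measurable
  have Ei: "integrable lborel E" unfolding E_def by (rule integrable_exp_neg_norm_powr[OF s \<theta>(1)])
  have E0: "0 \<le> E \<xi>" for \<xi> by (simp add: E_def)
  have Gi: "integrable lborel (\<lambda>y. G \<theta> (x - y) t)"
    using G_integral[OF \<theta> t, where 'a='a] nn_integral_lborel_reflect[of "\<lambda>y. ennreal (G \<theta> y t)" x] G_nonneg[OF \<theta> t]
    by (intro integrableI_nonneg) (auto simp: less_top[symmetric])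
  let ?f = "\<lambda>y \<xi>. G \<theta> (x - y) t * (cos (y \<bullet> \<xi>) * E \<xi>)"
  have meas: "(\<lambda>(y, \<xi>). ?f y \<xi>) \<in> borel_measurable (lborel \<Otimes>\<^sub>M lborel)" by measurable
  have bd: "\<bar>?f y \<xi>\<bar> \<le> G \<theta> (x - y) t * E \<xi>" for y \<xi>
  proof -
    have "G \<theta> (x - y) t * (\<bar>cos (y \<bullet> \<xi>)\<bar> * E \<xi>) \<le> G \<theta> (x - y) t * (1 * E \<xi>)"
      using G_nonneg[OF \<theta> t] E0 by (intro mult_left_mono mult_right_mono) auto
    then show ?thesis using G_nonneg[OF \<theta> t, of "x - y"] E0[of \<xi>] by (simp add: abs_mult)
  qed
  note F = lborel_pair.Fubini_dominated[OF meas Gi Ei bd]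
  have inner1: "(\<integral>\<xi>. ?f y \<xi> \<partial>lborel) = (2 * pi) ^ DIM('a) * (G \<theta> (x - y) t * G \<theta> y s)" for y
    unfolding G_eq[OF s \<theta>(1)] by (simp add: E_def)
  have trig: "integrable lborel (\<lambda>z. G \<theta> z t * cos (z \<bullet> \<xi>))" "integrable lborel (\<lambda>z. G \<theta> z t * sin (z \<bullet> \<xi>))" for \<xi> :: 'a
    by (rule Bochner_Integration.integrable_bound[OF G_integral(1)[OF \<theta> t]]; (simp add: abs_mult mult_left_le)?)+
  have inner2: "(\<integral>y. ?f y \<xi> \<partial>lborel) = cos (x \<bullet> \<xi>) * exp (- ((t + s) * norm \<xi> powr \<theta>))" for \<xi>
  proof -
    have "(\<integral>y. G \<theta> (x - y) t * cos (y \<bullet> \<xi>) \<partial>lborel) = (\<integral>y. G \<theta> (x - y) t * cos ((x - (x - y)) \<bullet> \<xi>) \<partial>lborel)" by simp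
    also have "\<dots> = (\<integral>z. G \<theta> z t * cos ((x - z) \<bullet> \<xi>) \<partial>lborel)"
      by (rule integral_lborel_reflect[of "\<lambda>z. G \<theta> z t * cos ((x - z) \<bullet> \<xi>)" x]) measurable
    also have "\<dots> = (\<integral>z. cos (x \<bullet> \<xi>) * (G \<theta> z t * cos (z \<bullet> \<xi>)) + sin (x \<bullet> \<xi>) * (G \<theta> z t * sin (z \<bullet> \<xi>)) \<partial>lborel)"
      by (simp add: inner_diff_left cos_diff algebra_simps)
    also have "\<dots> = cos (x \<bullet> \<xi>) * (\<integral>z. G \<theta> z t * cos (z \<bullet> \<xi>) \<partial>lborel) + sin (x \<bullet> \<xi>) * (\<integral>z. G \<theta> z t * sin (z \<bullet> \<xi>) \<partial>lborel)"
      using trig[of \<xi>] by simp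
    also have "(\<integral>z. G \<theta> z t * sin (z \<bullet> \<xi>) \<partial>lborel) = 0"
    proof -
      have "(\<integral>z. G \<theta> (0 - z) t * sin ((0 - z) \<bullet> \<xi>) \<partial>lborel) = (\<integral>z. G \<theta> z t * sin (z \<bullet> \<xi>) \<partial>lborel)"
        by (rule integral_lborel_reflect[of "\<lambda>z. G \<theta> z t * sin (z \<bullet> \<xi>)" 0]) measurable
      then show ?thesis by (simp add: G_minus[OF \<theta>(1) t])
    qed
    finally have *: "(\<integral>y. G \<theta> (x - y) t * cos (y \<bullet> \<xi>) \<partial>lborel) = cos (x \<bullet> \<xi>) * exp (- (t * norm \<xi> powr \<theta>))"
      by (simp add: G_fourier[OF \<theta> t])
    have "(\<integral>y. ?f y \<xi> \<partial>lborel) = (\<integral>y. G \<theta> (x - y) t * cos (y \<bullet> \<xi>) \<partial>lborel) * E \<xi>"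
      by (simp only: mult.assoc[symmetric] integral_mult_left_zero)
    moreover have "exp (- (t * norm \<xi> powr \<theta>)) * E \<xi> = exp (- ((t + s) * norm \<xi> powr \<theta>))"
      by (simp add: E_def exp_add[symmetric] distrib_right)
    ultimately show ?thesis by (simp only: * mult.assoc)
  qed
  have ts: "t + s > 0" using t s by simp
  have "(\<integral>y. (\<integral>\<xi>. ?f y \<xi> \<partial>lborel) \<partial>lborel) = (2 * pi) ^ DIM('a) * (\<integral>y. G \<theta> (x - y) t * G \<theta> y s \<partial>lborel)"
    unfolding inner1 by (rule integral_mult_right_zero)
  moreover have "(\<integral>\<xi>. (\<integral>y. ?f y \<xi> \<partial>lborel) \<partial>lborel) = (2 * pi) ^ DIM('a) * G \<theta> x (t + s)"
    unfolding inner2 G_eq[OF ts \<theta>(1)] by simp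
  ultimately have "(2 * pi) ^ DIM('a) * (\<integral>y. G \<theta> (x - y) t * G \<theta> y s \<partial>lborel) = (2 * pi) ^ DIM('a) * G \<theta> x (t + s)"
    using F(1) by (simp only:)
  then have eq: "(\<integral>y. G \<theta> (x - y) t * G \<theta> y s \<partial>lborel) = G \<theta> x (t + s)" by simp
  have "integrable lborel (\<lambda>y. (2 * pi) ^ DIM('a) * (G \<theta> (x - y) t * G \<theta> y s))" using F(2) unfolding inner1 .
  from integrable_mult_right[OF this, of "1 / (2 * pi) ^ DIM('a)"]
  have "integrable lborel (\<lambda>y. G \<theta> (x - y) t * G \<theta> y s)" by simp
  then have "(\<integral>\<^sup>+y. ennreal (G \<theta> (x - y) t * G \<theta> y s) \<partial>lborel) = ennreal (\<integral>y. G \<theta> (x - y) t * G \<theta> y s \<partial>lborel)"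
    by (intro nn_integral_eq_integral AE_I2 mult_nonneg_nonneg G_nonneg \<theta> t s)
  then show ?thesis unfolding eq by (simp add: ennreal_mult G_nonneg \<theta> t s)
qed

lemma norm_powr_le_exp:
  assumes "0 < \<theta>" "\<theta> \<le> 2"
  shows "norm \<zeta> powr \<theta> \<le> 2 * exp ((norm \<zeta>)\<^sup>2 / 2)"
proof -
  have "norm \<zeta> powr \<theta> \<le> 1 + (norm \<zeta>)\<^sup>2"
  proof (cases "norm \<zeta> \<le> 1")
    case True
    then have "norm \<zeta> powr \<theta> \<le> 1" using assms by (simp add: powr_le1)
    then show ?thesis by (smt (verit) zero_le_power2)
  next
    case False
    then have "norm \<zeta> powr \<theta> \<le> norm \<zeta> powr 2" using assms by (intro powr_mono) auto
    then show ?thesis using False by (simp add: powr_numeral)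
  qed
  then show ?thesis using exp_ge_add_one_self[of "(norm \<zeta>)\<^sup>2 / 2"] by linarith
qed

text \<open>A Chebyshev argument on the Fourier side. With \<open>l = 1 / R\<^sup>2\<close> the
  weight \<open>1 - exp (- l * (norm y)\<^sup>2)\<close> is at least 1/2 outside the ball of radius
  R. By the pairing its integral against G is a Gaussian average of
  \<open>1 - exp (- (t * w))\<close> with w of order \<open>R powr (-\<theta>)\<close>, hence at
  most linear in t. K is the Gaussian moment of order \<theta>.\<close>

lemma G_tail:
  assumes \<theta>: "0 < \<theta>" "\<theta> \<le> 2"
  obtains C where "C \<ge> 0"
    "\<And>t R. t > 0 \<Longrightarrow> R > 0 \<Longrightarrow>
      (\<integral>\<^sup>+y. ennreal (G \<theta> (y::'a::euclidean_space) t) * indicator {y. R < norm y} y \<partial>lborel) \<le> ennreal (C * t * R powr (-\<theta>))"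
proof -
  let ?g = "\<lambda>l y::'a. exp (- l * (norm y)\<^sup>2)"
  have gi: "integrable lborel (\<lambda>\<zeta>::'a. exp (- (norm \<zeta>)\<^sup>2))" using gaussian_fourier(1)[of 1] by simp
  have mi: "integrable lborel (\<lambda>\<zeta>::'a. exp (- (norm \<zeta>)\<^sup>2) * norm \<zeta> powr \<theta>)"
  proof (rule Bochner_Integration.integrable_bound)
    show "integrable lborel (\<lambda>\<zeta>::'a. 2 * exp (- (1/2) * (norm \<zeta>)\<^sup>2))"
      by (intro integrable_mult_right gaussian_fourier(1)) simp
    show "AE \<zeta> in lborel. norm (exp (- (norm (\<zeta>::'a))\<^sup>2) * norm \<zeta> powr \<theta>) \<le> norm (2 * exp (- (1/2) * (norm \<zeta>)\<^sup>2))"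
    proof (rule AE_I2)
      fix \<zeta> :: 'a
      have "exp (- (norm \<zeta>)\<^sup>2) * norm \<zeta> powr \<theta> \<le> exp (- (norm \<zeta>)\<^sup>2) * (2 * exp ((norm \<zeta>)\<^sup>2 / 2))"
        by (intro mult_left_mono norm_powr_le_exp \<theta>) auto
      also have "\<dots> = 2 * exp (- (1/2) * (norm \<zeta>)\<^sup>2)" by (simp add: exp_add[symmetric])
      finally show "norm (exp (- (norm \<zeta>)\<^sup>2) * norm \<zeta> powr \<theta>) \<le> norm (2 * exp (- (1/2) * (norm \<zeta>)\<^sup>2))" by simp
    qed
  qed simp
  define K where "K = (\<integral>\<zeta>. exp (- (norm (\<zeta>::'a))\<^sup>2) * norm \<zeta> powr \<theta> \<partial>lborel)"
  define p where "p = (1 / sqrt pi) ^ DIM('a)"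
  have p: "p \<ge> 0" by (simp add: p_def)
  have p1: "p * (\<integral>\<zeta>. exp (- (norm (\<zeta>::'a))\<^sup>2) \<partial>lborel) = 1"
    using gaussian_fourier(2)[of 1 "0::'a"] by (simp add: p_def power_divide)
  have K: "K \<ge> 0" unfolding K_def by simp
  show ?thesis
  proof (rule that[of "2 * p * 2 powr \<theta> * K"])
    show "0 \<le> 2 * p * 2 powr \<theta> * K" using p K by simp
    fix t R :: real assume t: "t > 0" and R: "R > 0"
    define l where "l = 1 / R\<^sup>2"
    have l: "l > 0" "sqrt l = 1 / R" using R by (auto simp: l_def real_sqrt_divide)
    let ?T = "\<integral>y. G \<theta> y t * (1 - ?g l y) \<partial>lborel"
    let ?e = "\<lambda>\<zeta>::'a. exp (- (norm \<zeta>)\<^sup>2) * exp (- (t * norm ((2 * sqrt l) *\<^sub>R \<zeta>) powr \<theta>))"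
    have ei: "integrable lborel ?e"
      by (rule Bochner_Integration.integrable_bound[OF gi]) (use t in \<open>auto intro!: mult_left_le\<close>)
    have Gi: "integrable lborel (\<lambda>y::'a. G \<theta> y t)" by (rule G_integral(1)[OF \<theta> t])
    have Gli: "integrable lborel (\<lambda>y::'a. G \<theta> y t * ?g l y)"
      using G_gaussian_pairing(1)[OF \<theta>(1) t l(1), of "0::'a"] by simp
    have G1: "(\<integral>y. G \<theta> (y::'a) t \<partial>lborel) = 1"
      using G_fourier[OF \<theta> t, of "0::'a"] by simp
    have "?T = (\<integral>y. G \<theta> y t - G \<theta> y t * ?g l y \<partial>lborel)"
      by (simp add: algebra_simps)
    also have "\<dots> = 1 - (\<integral>y. G \<theta> y t * ?g l y \<partial>lborel)"
      using Gi Gli G1 by simp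
    also have "\<dots> = p * (\<integral>\<zeta>. exp (- (norm (\<zeta>::'a))\<^sup>2) \<partial>lborel) - p * integral\<^sup>L lborel ?e"
      using G_gaussian_pairing(2)[OF \<theta>(1) t l(1), of "0::'a"] p1 by (simp add: p_def)
    also have "\<dots> = p * (\<integral>\<zeta>. exp (- (norm (\<zeta>::'a))\<^sup>2) - ?e \<zeta> \<partial>lborel)"
      using gi ei by (simp add: right_diff_distrib)
    also have "\<dots> \<le> p * (\<integral>\<zeta>. t * (2 / R) powr \<theta> * (exp (- (norm (\<zeta>::'a))\<^sup>2) * norm \<zeta> powr \<theta>) \<partial>lborel)"
    proof (intro mult_left_mono integral_mono p)
      fix \<zeta> :: 'a
      have "1 - exp (- (t * w)) \<le> t * w" for w
        using exp_ge_add_one_self[of "- (t * w)"] by linarith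
      moreover have weq: "norm ((2 * sqrt l) *\<^sub>R \<zeta>) powr \<theta> = (2 / R) powr \<theta> * norm \<zeta> powr \<theta>"
        using R l by (simp add: powr_mult[symmetric])
      ultimately have "exp (- (norm \<zeta>)\<^sup>2) * (1 - exp (- (t * norm ((2 * sqrt l) *\<^sub>R \<zeta>) powr \<theta>))) \<le> exp (- (norm \<zeta>)\<^sup>2) * (t * ((2 / R) powr \<theta> * norm \<zeta> powr \<theta>))"
        unfolding weq by (intro mult_left_mono) auto
      then show "exp (- (norm \<zeta>)\<^sup>2) - ?e \<zeta> \<le> t * (2 / R) powr \<theta> * (exp (- (norm \<zeta>)\<^sup>2) * norm \<zeta> powr \<theta>)"
        by (simp add: right_diff_distrib mult_ac)
    qed (use gi ei mi in auto)
    also have "\<dots> = p * 2 powr \<theta> * K * t * R powr (-\<theta>)"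
      unfolding integral_mult_right_zero K_def[symmetric] using R by (simp add: powr_divide powr_minus field_simps)
    finally have le: "?T \<le> p * 2 powr \<theta> * K * t * R powr (-\<theta>)" .
    have e1: "exp (-1) \<le> (1/2::real)"
      using exp_ge_add_one_self[of "1::real"] by (simp add: exp_minus field_simps)
    have "(\<integral>\<^sup>+y. ennreal (G \<theta> (y::'a) t) * indicator {y. R < norm y} y \<partial>lborel) \<le> (\<integral>\<^sup>+y. ennreal (2 * (G \<theta> (y::'a) t * (1 - ?g l y))) \<partial>lborel)"
    proof (intro nn_integral_mono)
      fix y :: 'a
      show "ennreal (G \<theta> y t) * indicator {y. R < norm y} y \<le> ennreal (2 * (G \<theta> y t * (1 - ?g l y)))"
      proof (cases "R < norm y")
        case True
        then have "l * (norm y)\<^sup>2 \<ge> 1" using R by (simp add: l_def power_mono)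
        then have "?g l y \<le> exp (-1)" by simp
        from order_trans[OF this e1] have "1 \<le> 2 * (1 - ?g l y)" by simp
        then have "G \<theta> y t * 1 \<le> G \<theta> y t * (2 * (1 - ?g l y))"
          using G_nonneg[OF \<theta> t] by (intro mult_left_mono) auto
        then have "G \<theta> y t \<le> 2 * (G \<theta> y t * (1 - ?g l y))" by (metis mult.left_commute mult_1_right)
        from ennreal_leI[OF this] show ?thesis using True by simp
      qed simp
    qed
    also have "\<dots> = ennreal (2 * ?T)"
    proof (subst nn_integral_eq_integral)
      show "integrable lborel (\<lambda>y::'a. 2 * (G \<theta> y t * (1 - ?g l y)))"
        using Gi Gli by (simp add: right_diff_distrib)
      show "AE y in lborel. 0 \<le> 2 * (G \<theta> (y::'a) t * (1 - ?g l y))"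
        using G_nonneg[OF \<theta> t] l by (intro AE_I2 mult_nonneg_nonneg) auto
    qed simp
    also have "\<dots> \<le> ennreal (2 * p * 2 powr \<theta> * K * t * R powr (-\<theta>))"
      using le by (intro ennreal_leI) linarith
    finally show "(\<integral>\<^sup>+y. ennreal (G \<theta> (y::'a) t) * indicator {y. R < norm y} y \<partial>lborel) \<le> ennreal (2 * p * 2 powr \<theta> * K * t * R powr (-\<theta>))" .
  qed
qed

section \<open>The semigroup on nonnegative functions\<close>

lemma S_eq: "S \<theta> t \<psi> x = (\<integral>\<^sup>+y. ennreal (G \<theta> (x - y) t) * \<psi> y \<partial>lborel)"
  by (simp add: S_def nn_integral_completion)

lemma S_cong_AE:
  assumes "AE y in lborel. \<psi> y = \<psi>' y"
  shows "S \<theta> t \<psi> x = S \<theta> t \<psi>' x"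
  unfolding S_eq by (intro nn_integral_cong_AE) (use assms in eventually_elim, simp)

lemma S_mono_AE:
  assumes "AE y in lborel. \<psi> y \<le> \<psi>' y"
  shows "S \<theta> t \<psi> x \<le> S \<theta> t \<psi>' x"
  unfolding S_eq by (intro nn_integral_mono_AE) (use assms in eventually_elim, simp add: mult_left_mono)

lemma S_mono:
  assumes "\<And>y. \<psi> y \<le> \<psi>' y"
  shows "S \<theta> t \<psi> x \<le> S \<theta> t \<psi>' x"
  using assms by (intro S_mono_AE) simp

lemma S_const:
  fixes x :: "'a::euclidean_space"
  assumes "0 < \<theta>" "\<theta> \<le> 2" "t > 0"
  shows "S \<theta> t (\<lambda>_. c) x = c"
proof -
  have "S \<theta> t (\<lambda>_. c) x = (\<integral>\<^sup>+y. ennreal (G \<theta> (x - y) t) \<partial>lborel) * c"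
    unfolding S_eq by (rule nn_integral_multc) measurable
  also have "(\<integral>\<^sup>+y. ennreal (G \<theta> (x - y) t) \<partial>lborel) = 1"
    using nn_integral_lborel_reflect[of "\<lambda>y. ennreal (G \<theta> y t)" x] G_integral(2)[OF assms, where 'a='a] by simp
  finally show ?thesis by simp
qed

lemma S_add:
  assumes [measurable]: "\<psi> \<in> borel_measurable borel" "\<psi>' \<in> borel_measurable borel"
  shows "S \<theta> t (\<lambda>y. \<psi> y + \<psi>' y) x = S \<theta> t \<psi> x + S \<theta> t \<psi>' x"
  unfolding S_eq distrib_left by (intro nn_integral_add) measurable

lemma S_cmult:
  assumes [measurable]: "\<psi> \<in> borel_measurable borel"
  shows "S \<theta> t (\<lambda>y. c * \<psi> y) x = c * S \<theta> t \<psi> x"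
  unfolding S_eq mult.left_commute[of _ c] by (intro nn_integral_cmult) measurable

lemma borel_measurable_S [measurable (raw)]:
  fixes \<psi> :: "'c \<Rightarrow> 'a::euclidean_space \<Rightarrow> ennreal"
  assumes [measurable]: "f \<in> borel_measurable M" "g \<in> borel_measurable M"
    "(\<lambda>(z, y). \<psi> z y) \<in> borel_measurable (M \<Otimes>\<^sub>M borel)"
  shows "(\<lambda>z. S \<theta> (g z) (\<psi> z) (f z)) \<in> borel_measurable M"
  unfolding S_eq by measurable

lemma S_semigroup:
  fixes \<psi> :: "'a::euclidean_space \<Rightarrow> ennreal"
  assumes \<theta>: "0 < \<theta>" "\<theta> \<le> 2" and t: "t > 0" and s: "s > 0" and [measurable]: "\<psi> \<in> borel_measurable borel"
  shows "S \<theta> t (S \<theta> s \<psi>) x = S \<theta> (t + s) \<psi> x"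
proof -
  have "S \<theta> t (S \<theta> s \<psi>) x = (\<integral>\<^sup>+y. (\<integral>\<^sup>+z. ennreal (G \<theta> (x - y) t) * (ennreal (G \<theta> (y - z) s) * \<psi> z) \<partial>lborel) \<partial>lborel)"
    unfolding S_eq by (simp add: nn_integral_cmult)
  also have "\<dots> = (\<integral>\<^sup>+z. (\<integral>\<^sup>+y. ennreal (G \<theta> (x - y) t) * (ennreal (G \<theta> (y - z) s) * \<psi> z) \<partial>lborel) \<partial>lborel)"
    by (rule lborel_pair.Fubini') measurable
  also have "\<dots> = (\<integral>\<^sup>+z. (\<integral>\<^sup>+y. ennreal (G \<theta> (x - y) t) * ennreal (G \<theta> (y - z) s) \<partial>lborel) * \<psi> z \<partial>lborel)"
    by (simp add: nn_integral_multc[symmetric] mult.assoc)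
  finally have eq: "S \<theta> t (S \<theta> s \<psi>) x = (\<integral>\<^sup>+z. (\<integral>\<^sup>+y. ennreal (G \<theta> (x - y) t) * ennreal (G \<theta> (y - z) s) \<partial>lborel) * \<psi> z \<partial>lborel)" .
  have "(\<integral>\<^sup>+y. ennreal (G \<theta> (x - y) t) * ennreal (G \<theta> (y - z) s) \<partial>lborel) = ennreal (G \<theta> (x - z) (t + s))" for z
  proof -
    have "(\<integral>\<^sup>+y. ennreal (G \<theta> (x - y) t) * ennreal (G \<theta> (y - z) s) \<partial>lborel)
       = (\<integral>\<^sup>+y. ennreal (G \<theta> (x - (z + 1 *\<^sub>R y)) t) * ennreal (G \<theta> ((z + 1 *\<^sub>R y) - z) s) \<partial>lborel)"
      using nn_integral_lborel_affine[of "\<lambda>y. ennreal (G \<theta> (x - y) t) * ennreal (G \<theta> (y - z) s)" 1 z] by simp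
    also have "\<dots> = ennreal (G \<theta> (x - z) (t + s))"
      using G_semigroup[OF \<theta> t s, of "x - z"] by (simp add: algebra_simps)
    finally show ?thesis .
  qed
  then show ?thesis unfolding eq unfolding S_eq by simp
qed

text \<open>The point c lies on the segment from z to the origin, at distance \<rho> / 2 from z. The
  ball of radius \<rho> / 2 around c is contained in the \<rho>-ball around z and consists of points
  no farther from the origin than z, where the kernel is at least
  \<open>G \<theta> z t\<close>.\<close>

lemma G_le_average:
  fixes z :: "'a::euclidean_space"
  assumes \<theta>: "0 < \<theta>" "\<theta> \<le> 2" and t: "t > 0" and \<rho>: "\<rho> > 0" and z: "norm z \<ge> \<rho>"
  shows "ennreal (G \<theta> z t) * emeasure lborel (ball (0::'a) (\<rho> / 2)) \<le> (\<integral>\<^sup>+w. ennreal (G \<theta> w t) * indicator (ball z \<rho>) w \<partial>lborel)"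
proof -
  define c where "c = z - (\<rho> / (2 * norm z)) *\<^sub>R z"
  have nz: "norm z > 0" using \<rho> z by linarith
  have dist: "dist z c = \<rho> / 2" using nz \<rho> by (simp add: c_def dist_norm)
  have "c = (1 - \<rho> / (2 * norm z)) *\<^sub>R z" by (simp add: c_def scaleR_left_diff_distrib)
  then have "norm c = \<bar>1 - \<rho> / (2 * norm z)\<bar> * norm z" by simp
  also have "\<dots> = norm z - \<rho> / 2" using nz z \<rho> by (subst abs_of_nonneg) (auto simp: field_simps)
  finally have nc: "norm c = norm z - \<rho> / 2" .
  have sub: "norm w \<le> norm z \<and> w \<in> ball z \<rho>" if "w \<in> ball c (\<rho> / 2)" for w
  proof -
    have "dist c w < \<rho> / 2" using that by simp
    moreover have "norm w \<le> norm c + dist c w" by (metis dist_norm norm_minus_commute norm_triangle_sub)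
    moreover have "dist z w \<le> dist z c + dist c w" by (rule dist_triangle)
    ultimately show ?thesis using nc dist by auto
  qed
  have "emeasure lborel (ball (0::'a) (\<rho> / 2)) = emeasure lborel (ball c (\<rho> / 2))"
    using \<rho> by (simp add: emeasure_ball)
  then have "ennreal (G \<theta> z t) * emeasure lborel (ball (0::'a) (\<rho> / 2)) = (\<integral>\<^sup>+w. ennreal (G \<theta> z t) * indicator (ball c (\<rho> / 2)) w \<partial>lborel)"
    by (simp add: nn_integral_cmult_indicator)
  also have "\<dots> \<le> (\<integral>\<^sup>+w. ennreal (G \<theta> w t) * indicator (ball z \<rho>) w \<partial>lborel)"
    using sub by (intro nn_integral_mono) (auto simp: indicator_def intro!: ennreal_leI G_antimono \<theta> t)
  finally show ?thesis .
qed

text \<open>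
  Off the ball of radius \<open>\<rho>\<close> the radially decreasing kernel is dominated by its own averages
  over balls, so no covering argument is needed.
\<close>

lemma S_le_uniformly_local:
  fixes \<psi> :: "'a::euclidean_space \<Rightarrow> ennreal"
  assumes \<theta>: "0 < \<theta>" "\<theta> \<le> 2" and \<rho>: "\<rho> > 0" and [measurable]: "\<psi> \<in> borel_measurable borel"
    and K: "K < \<infinity>" "\<And>y. (\<integral>\<^sup>+x. \<psi> x * indicator (ball y \<rho>) x \<partial>lborel) \<le> K"
  obtains C where "C > 0" "\<And>t x. 0 < t \<Longrightarrow> t \<le> 1 \<Longrightarrow> S \<theta> t \<psi> x \<le> ennreal (C * t powr (- (DIM('a) / \<theta>)))"
proof -
  let ?J = "\<lambda>x. \<integral>\<^sup>+y. \<psi> y * indicator (ball x \<rho>) y \<partial>lborel"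
  define m where "m = unit_ball_vol (real DIM('a)) * (\<rho> / 2) ^ DIM('a)"
  have m: "m > 0" using \<rho> by (simp add: m_def)
  have em: "emeasure lborel (ball (0::'a) (\<rho> / 2)) = ennreal m"
    using \<rho> by (simp add: m_def emeasure_ball)
  define k where "k = enn2real K"
  have k: "K = ennreal k" "k \<ge> 0" using K by (auto simp: k_def)
  define g where "g = G \<theta> (0::'a) 1"
  have g: "g \<ge> 0" unfolding g_def by (rule G_nonneg[OF \<theta>]) simp
  define C where "C = (g + 1 / m) * k + 1"
  show ?thesis
  proof (rule that[of C])
    show "C > 0" using m k g by (simp add: C_def add_nonneg_pos)
    fix t :: real and x :: 'a assume t: "0 < t" "t \<le> 1"
    define T where "T = t powr (- (DIM('a) / \<theta>))"
    \<comment> \<open>For t \<le> 1 the far part, bounded by a constant independent of t, can be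
      absorbed into a multiple of T.\<close>
    have T: "T \<ge> 1" using t \<theta> powr_le1[of "DIM('a) / \<theta>" t] by (simp add: T_def powr_minus divide_simps)
    have G0: "G \<theta> z t \<le> T * g" for z :: 'a
      using G_antimono[OF \<theta> t(1), of 0 z] G_zero_scale[OF \<theta>(1) t(1), where 'a='a] by (simp add: T_def g_def)
    define A where "A z = (\<integral>\<^sup>+w. ennreal (G \<theta> w t) * indicator (ball z \<rho>) w \<partial>lborel)" for z :: 'a
    have A_eq: "A z = (\<integral>\<^sup>+w. ennreal (G \<theta> w t) * indicator {w. dist z w < \<rho>} w \<partial>lborel)" for z
      unfolding A_def by (intro nn_integral_cong) (simp add: indicator_def)
    have [measurable]: "A \<in> borel_measurable borel" unfolding A_eq by measurable
    have [measurable]: "ball z \<rho> \<in> sets borel" for z :: 'a by simp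
    have le: "ennreal (G \<theta> z t) \<le> ennreal (T * g) * indicator (ball 0 \<rho>) z + ennreal (1 / m) * A z" for z
    proof (cases "norm z < \<rho>")
      case True
      have "ennreal (G \<theta> z t) \<le> ennreal (T * g) * indicator (ball 0 \<rho>) z"
        using True by (simp add: ennreal_leI G0)
      also have "\<dots> \<le> ennreal (T * g) * indicator (ball 0 \<rho>) z + ennreal (1 / m) * A z" by simp
      finally show ?thesis .
    next
      case False
      have "ennreal (G \<theta> z t) = ennreal (1 / m) * (ennreal (G \<theta> z t) * ennreal m)"
        using m G_nonneg[OF \<theta> t(1), of z] by (simp add: ennreal_mult[symmetric])
      also have "\<dots> \<le> ennreal (1 / m) * A z"
        using G_le_average[OF \<theta> t(1) \<rho>, of z] False unfolding em A_def by (intro mult_left_mono) auto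
      finally show ?thesis using False by simp
    qed
    have "S \<theta> t \<psi> x \<le> (\<integral>\<^sup>+y. ennreal (T * g) * (\<psi> y * indicator (ball x \<rho>) y) + ennreal (1 / m) * (A (x - y) * \<psi> y) \<partial>lborel)"
      unfolding S_eq
    proof (intro nn_integral_mono)
      fix y
      have "ennreal (G \<theta> (x - y) t) * \<psi> y \<le> (ennreal (T * g) * indicator (ball 0 \<rho>) (x - y) + ennreal (1 / m) * A (x - y)) * \<psi> y"
        by (intro mult_right_mono le) simp
      also have "indicator (ball 0 \<rho>) (x - y) = (indicator (ball x \<rho>) y :: ennreal)"
        by (simp add: indicator_def dist_norm norm_minus_commute)
      finally show "ennreal (G \<theta> (x - y) t) * \<psi> y \<le> ennreal (T * g) * (\<psi> y * indicator (ball x \<rho>) y) + ennreal (1 / m) * (A (x - y) * \<psi> y)"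
        by (simp only: distrib_right mult.assoc) (simp only: mult_ac)
    qed
    also have "\<dots> = ennreal (T * g) * ?J x + ennreal (1 / m) * (\<integral>\<^sup>+y. A (x - y) * \<psi> y \<partial>lborel)"
      by (subst nn_integral_add) (simp_all add: nn_integral_cmult)
    finally have S_le: "S \<theta> t \<psi> x \<le> ennreal (T * g) * ?J x + ennreal (1 / m) * (\<integral>\<^sup>+y. A (x - y) * \<psi> y \<partial>lborel)" .
    \<comment> \<open>Exchanging the integrals hands the ball over to \<psi>: its local integrals
      are at most K, and the remaining kernel has mass 1.\<close>
    have A_le: "(\<integral>\<^sup>+y. A (x - y) * \<psi> y \<partial>lborel) \<le> K"
    proof -
      have "(\<integral>\<^sup>+y. A (x - y) * \<psi> y \<partial>lborel) = (\<integral>\<^sup>+y. (\<integral>\<^sup>+w. ennreal (G \<theta> w t) * indicator {w. dist (x - y) w < \<rho>} w * \<psi> y \<partial>lborel) \<partial>lborel)"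
        unfolding A_eq by (simp add: nn_integral_multc)
      also have "\<dots> = (\<integral>\<^sup>+w. (\<integral>\<^sup>+y. ennreal (G \<theta> w t) * indicator {w. dist (x - y) w < \<rho>} w * \<psi> y \<partial>lborel) \<partial>lborel)"
        by (rule lborel_pair.Fubini') measurable
      also have "\<dots> = (\<integral>\<^sup>+w. ennreal (G \<theta> w t) * ?J (x - w) \<partial>lborel)"
      proof (intro nn_integral_cong)
        fix w
        have "indicator {w. dist (x - y) w < \<rho>} w = (indicator (ball (x - w) \<rho>) y :: ennreal)" for y
          by (simp add: indicator_def dist_norm norm_minus_commute algebra_simps)
        then show "(\<integral>\<^sup>+y. ennreal (G \<theta> w t) * indicator {w. dist (x - y) w < \<rho>} w * \<psi> y \<partial>lborel) = ennreal (G \<theta> w t) * ?J (x - w)"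
          by (simp add: nn_integral_cmult[symmetric] mult_ac)
      qed
      also have "\<dots> \<le> (\<integral>\<^sup>+w. ennreal (G \<theta> (w::'a) t) * K \<partial>lborel)"
        by (intro nn_integral_mono mult_left_mono K) auto
      also have "\<dots> = (\<integral>\<^sup>+w. ennreal (G \<theta> (w::'a) t) \<partial>lborel) * K" by (rule nn_integral_multc) measurable
      also have "\<dots> = K" by (simp add: G_integral(2)[OF \<theta> t(1)])
      finally show ?thesis .
    qed
    note S_le
    also have "ennreal (T * g) * ?J x + ennreal (1 / m) * (\<integral>\<^sup>+y. A (x - y) * \<psi> y \<partial>lborel) \<le> ennreal (T * g) * K + ennreal (1 / m) * K"
      by (intro add_mono mult_left_mono K A_le) auto
    also have "\<dots> = ennreal ((T * g + 1 / m) * k)"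
      using T g m k by (simp add: ennreal_mult'[symmetric] ennreal_plus[symmetric] distrib_right del: ennreal_plus)
    also have "\<dots> \<le> ennreal (C * T)"
    proof (rule ennreal_leI)
      have "(T * g + 1 / m) * k \<le> (T * g + T * (1 / m)) * k"
        using T m k by (intro mult_right_mono add_left_mono) (auto intro!: divide_right_mono)
      also have "\<dots> = T * ((g + 1 / m) * k)" by (simp add: algebra_simps)
      also have "\<dots> \<le> T * C" using T by (intro mult_left_mono) (auto simp: C_def)
      finally show "(T * g + 1 / m) * k \<le> C * T" by (simp add: mult.commute)
    qed
    finally show "S \<theta> t \<psi> x \<le> ennreal (C * t powr (- (DIM('a) / \<theta>)))" unfolding T_def .
  qed
qed

section \<open>The nonlinearity\<close>

lemma tangent_line_below:
  fixes g :: "real \<Rightarrow> real"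
  assumes der: "\<And>u. u \<ge> c \<Longrightarrow> (g has_real_derivative g' u) (at u)"
    and mono: "\<And>u v. c \<le> u \<Longrightarrow> u \<le> v \<Longrightarrow> g' u \<le> g' v"
    and "c \<le> a" "c \<le> u"
  shows "g a + g' a * (u - a) \<le> g u"
proof (cases u a rule: linorder_cases)
  case less
  obtain z where z: "u < z" "z < a" "g a - g u = (a - u) * g' z"
    using MVT2[OF less, of g g'] der assms(4) by (metis order_trans)
  have "(a - u) * g' z \<le> (a - u) * g' a" using z less assms by (intro mult_left_mono mono) auto
  then show ?thesis using z by (simp add: algebra_simps)
next
  case greater
  obtain z where z: "a < z" "z < u" "g u - g a = (u - a) * g' z"
    using MVT2[OF greater, of g g'] der assms(3) by (metis order_trans)
  have "(u - a) * g' a \<le> (u - a) * g' z" using z greater assms by (intro mult_left_mono mono) auto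
  then show ?thesis using z by (simp add: algebra_simps)
qed simp

locale nonlinearity =
  fixes f :: "real \<Rightarrow> real"
  assumes C1: "f C1_differentiable_on {0<..}"
    and cont: "continuous_on {0..} f"
    and pos: "\<And>u. u > 0 \<Longrightarrow> f u > 0"
    and deriv_nonneg: "\<And>u. u > 0 \<Longrightarrow> deriv f u \<ge> 0"
    and F_eventually_finite: "\<forall>\<^sub>F u in at_top. F_of f u < \<infinity>"
    and F_lim: "((\<lambda>u. deriv f u * enn2real (F_of f u)) \<longlongrightarrow> 1) at_top"
begin

section \<open>The real-valued F, its derivative, its limit at infinity and its inverse\<close>

definition Fr :: "real \<Rightarrow> real" where "Fr u = enn2real (F_of f u)"

text \<open>The description is meaningful only for p in the range of \<open>Fr\<close> on the
  positive reals; for 0 < p \<le> \<open>Fr c\<close> it denotes a point at or beyond c.\<close>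

definition Finv :: "real \<Rightarrow> real" where "Finv p = (THE u. u > 0 \<and> Fr u = p)"

lemma has_deriv: "u > 0 \<Longrightarrow> (f has_real_derivative deriv f u) (at u)"
proof -
  assume u: "u > 0"
  obtain D where "\<And>x. x > 0 \<Longrightarrow> (f has_vector_derivative D x) (at x)"
    using C1 unfolding C1_differentiable_on_def by auto
  then have "(f has_real_derivative D u) (at u)" using u by (simp add: has_real_derivative_iff_has_vector_derivative)
  then show ?thesis by (metis DERIV_imp_deriv)
qed

lemma f_mono: "0 \<le> u \<Longrightarrow> u \<le> v \<Longrightarrow> f u \<le> f v"
proof (cases "u = v")
  case False
  assume uv: "0 \<le> u" "u \<le> v"
  show ?thesis
  proof (rule DERIV_nonneg_imp_increasing_open[OF uv(2)])
    show "\<exists>y. (f has_real_derivative y) (at x) \<and> 0 \<le> y" if "u < x" "x < v" for x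
      using has_deriv[of x] deriv_nonneg[of x] uv that by (intro exI[of _ "deriv f x"]) auto
    show "continuous_on {u..v} f" using cont by (rule continuous_on_subset) (use uv in auto)
  qed
qed simp

lemma f_nonneg: "u \<ge> 0 \<Longrightarrow> f u \<ge> 0"
proof (cases "u = 0")
  case True
  have "f 0 \<ge> 0"
  proof (rule LIMSEQ_le_const)
    show "(\<lambda>n. f (1 / real (Suc n))) \<longlonglongrightarrow> f 0"
      by (rule continuous_on_tendsto_compose[OF cont LIMSEQ_Suc[OF lim_1_over_n]]) auto
    show "\<exists>N. \<forall>n\<ge>N. 0 \<le> f (1 / real (Suc n))"
      by (auto intro!: less_imp_le pos)
  qed
  then show ?thesis using True by simp
qed (use pos in \<open>auto intro: less_imp_le\<close>)

lemma inverse_f_continuous: "0 < a \<Longrightarrow> continuous_on {a..b} (\<lambda>t. 1 / f t)"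
  using pos by (intro continuous_intros continuous_on_subset[OF cont]) (auto simp: less_imp_neq[symmetric] dest: pos)

lemma borel_measurable_inverse_f:
  assumes "a > 0"
  shows "(\<lambda>t. indicator {a<..} t * ennreal (1 / f t)) \<in> borel_measurable borel"
proof -
  have "(\<lambda>t. indicator {a<..} t *\<^sub>R (1 / f t)) \<in> borel_measurable borel"
    using assms pos by (intro borel_measurable_continuous_on_indicator continuous_intros continuous_on_subset[OF cont]) (auto simp: less_imp_neq[symmetric] dest: order_less_trans)
  then have "(\<lambda>t. ennreal (indicator {a<..} t *\<^sub>R (1 / f t))) \<in> borel_measurable borel" by measurable
  moreover have "(\<lambda>t. ennreal (indicator {a<..} t *\<^sub>R (1 / f t))) = (\<lambda>t. indicator {a<..} t * ennreal (1 / f t))"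
    by (auto simp: indicator_def)
  ultimately show ?thesis by simp
qed

lemma F_of_split:
  assumes "0 < u" "u \<le> v"
  shows "F_of f u = ennreal (integral {u..v} (\<lambda>t. 1 / f t)) + F_of f v"
proof -
  let ?I = "integral {u..v} (\<lambda>t. 1 / f t)"
  define g where "g t = indicator {u<..} t * ennreal (1 / f t)" for t
  have [measurable]: "g \<in> borel_measurable borel"
    unfolding g_def by (rule borel_measurable_inverse_f[OF assms(1)])
  have "F_of f u = (\<integral>\<^sup>+t. g t \<partial>lborel)"
    unfolding F_of_def nn_integral_completion g_def by (simp add: mult.commute)
  also have "\<dots> = (\<integral>\<^sup>+t. g t * indicator {..v} t + g t * indicator {v<..} t \<partial>lborel)"
    by (intro nn_integral_cong) (auto simp: indicator_def)
  also have "\<dots> = (\<integral>\<^sup>+t. g t * indicator {..v} t \<partial>lborel) + (\<integral>\<^sup>+t. g t * indicator {v<..} t \<partial>lborel)"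
    by (intro nn_integral_add) measurable
  also have "(\<integral>\<^sup>+t. g t * indicator {v<..} t \<partial>lborel) = F_of f v"
    unfolding F_of_def nn_integral_completion using assms by (intro nn_integral_cong) (auto simp: indicator_def g_def)
  also have "(\<integral>\<^sup>+t. g t * indicator {..v} t \<partial>lborel) = (\<integral>\<^sup>+t. ennreal (indicator {u..v} t * (1 / f t)) \<partial>lborel)"
    by (intro nn_integral_cong_AE) (use AE_lborel_singleton[of u] in eventually_elim, auto simp: indicator_def g_def)
  also have "\<dots> = ennreal (?I)"
  proof (rule nn_integral_has_integral_lborel)
    show "(\<lambda>t. indicator {u..v} t * (1 / f t)) \<in> borel_measurable borel"
      using borel_measurable_continuous_on_indicator[OF _ inverse_f_continuous[OF assms(1), of v]] by simp
    show "0 \<le> indicator {u..v} t * (1 / f t)" for t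
      using assms pos[of t] by (auto simp: indicator_def)
    have "((\<lambda>t. 1 / f t) has_integral ?I) {u..v}"
      by (intro integrable_integral integrable_continuous_interval inverse_f_continuous assms)
    then have "((\<lambda>t. if t \<in> {u..v} then 1 / f t else 0) has_integral ?I) UNIV"
      by (simp only: has_integral_restrict_UNIV)
    moreover have "(\<lambda>t. indicator {u..v} t * (1 / f t)) = (\<lambda>t. if t \<in> {u..v} then 1 / f t else 0)"
      by (auto simp: indicator_def)
    ultimately show "((\<lambda>t. indicator {u..v} t * (1 / f t)) has_integral ?I) UNIV"
      by (simp only:)
  qed
  finally show ?thesis .
qed

lemma F_of_finite: "u > 0 \<Longrightarrow> F_of f u < \<infinity>"
proof -
  assume u: "u > 0"
  obtain v where v: "v \<ge> u" "F_of f v < \<infinity>"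
    using F_eventually_finite unfolding eventually_at_top_linorder by (metis linear)
  show ?thesis using F_of_split[OF u v(1)] v by simp
qed

lemma F_of_eq: "u > 0 \<Longrightarrow> F_of f u = ennreal (Fr u)"
  using F_of_finite[of u] by (simp add: Fr_def)

lemma Fr_nonneg: "Fr u \<ge> 0" by (simp add: Fr_def)

lemma Fr_split: "0 < u \<Longrightarrow> u \<le> v \<Longrightarrow> Fr u = integral {u..v} (\<lambda>t. 1 / f t) + Fr v"
proof -
  let ?I = "integral {u..v} (\<lambda>t. 1 / f t)"
  assume uv: "0 < u" "u \<le> v"
  have "0 \<le> ?I"
    using uv by (intro integral_nonneg integrable_continuous_interval inverse_f_continuous) (auto intro!: less_imp_le pos)
  then have "ennreal (Fr u) = ennreal (?I + Fr v)"
    using F_of_split[OF uv] uv ennreal_plus[OF \<open>0 \<le> integral _ _\<close> Fr_nonneg[of v]] by (simp add: F_of_eq del: ennreal_plus)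
  then show ?thesis using \<open>0 \<le> integral _ _\<close> by (subst (asm) ennreal_inj) (auto simp: Fr_nonneg)
qed

lemma Fr_deriv: "u > 0 \<Longrightarrow> (Fr has_real_derivative - (1 / f u)) (at u)"
proof -
  assume u: "u > 0"
  \<comment> \<open>The primitive starts at u / 2 because f may vanish at 0, where 1 / f then has no
    continuous extension.\<close>
  let ?a = "u / 2" and ?b = "u + 1"
  have "((\<lambda>x. integral {?a..x} (\<lambda>t. 1 / f t)) has_real_derivative (1 / f u)) (at u within {?a..?b})"
    using u by (intro integral_has_real_derivative inverse_f_continuous) auto
  then have "((\<lambda>x. integral {?a..x} (\<lambda>t. 1 / f t)) has_real_derivative (1 / f u)) (at u)"
    using u by (simp add: at_within_Icc_at)
  then have "((\<lambda>x. Fr ?a - integral {?a..x} (\<lambda>t. 1 / f t)) has_real_derivative - (1 / f u)) (at u)"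
    by (auto intro!: derivative_eq_intros)
  moreover have "\<forall>\<^sub>F x in nhds u. Fr ?a - integral {?a..x} (\<lambda>t. 1 / f t) = Fr x"
  proof -
    have "\<forall>\<^sub>F x in nhds u. x \<in> {?a<..}" using u by (intro eventually_nhds_in_open) auto
    then show ?thesis by eventually_elim (use Fr_split[of ?a] u in \<open>auto simp: algebra_simps\<close>)
  qed
  ultimately show ?thesis by (subst (asm) DERIV_cong_ev[OF refl _ refl]) auto
qed

lemma Fr_strict_antimono: "0 < u \<Longrightarrow> u < v \<Longrightarrow> Fr v < Fr u"
proof (rule DERIV_neg_imp_decreasing[of u v Fr])
  fix x assume "0 < u" "u \<le> x"
  then show "\<exists>y. (Fr has_real_derivative y) (at x) \<and> y < 0"
    using Fr_deriv[of x] pos[of x] by (intro exI[of _ "- (1 / f x)"]) auto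
qed

lemma Fr_antimono: "0 < u \<Longrightarrow> u \<le> v \<Longrightarrow> Fr v \<le> Fr u"
  using Fr_strict_antimono[of u v] by (cases "u = v") auto

lemma Fr_pos: "u > 0 \<Longrightarrow> Fr u > 0"
  using Fr_strict_antimono[of u "u + 1"] by (smt (verit) Fr_def enn2real_nonneg)

lemma Fr_less_iff: "0 < u \<Longrightarrow> 0 < v \<Longrightarrow> Fr u < Fr v \<longleftrightarrow> v < u"
  by (meson Fr_antimono Fr_strict_antimono not_less)

lemma Fr_le_iff: "0 < u \<Longrightarrow> 0 < v \<Longrightarrow> Fr u \<le> Fr v \<longleftrightarrow> v \<le> u"
  by (meson Fr_less_iff not_less)

lemma Fr_diff_ge:
  assumes "0 < u" "u \<le> v"
  shows "(v - u) / f v \<le> Fr u - Fr v" "Fr u - Fr v \<le> (v - u) / f u"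
proof -
  have "(v - u) / f v \<le> Fr u - Fr v \<and> Fr u - Fr v \<le> (v - u) / f u"
  proof (cases "u = v")
    case False
    then have uv: "u < v" using assms by simp
    obtain z where z: "u < z" "z < v" "Fr v - Fr u = (v - u) * (- (1 / f z))"
      using MVT2[OF uv, of Fr "\<lambda>u. - (1 / f u)"] Fr_deriv assms by (metis less_le_trans)
    have "(v - u) / f v \<le> (v - u) / f z" "(v - u) / f z \<le> (v - u) / f u"
      using z assms uv by (auto intro!: divide_left_mono f_mono pos mult_pos_pos)
    then show ?thesis using z(3) by simp
  qed simp
  then show "(v - u) / f v \<le> Fr u - Fr v" "Fr u - Fr v \<le> (v - u) / f u" by auto
qed

lemma Fr_tendsto_0: "(Fr \<longlongrightarrow> 0) at_top"
proof -
  have eq: "F_of f u = (\<integral>\<^sup>+t. indicator {u<..} t * ennreal (1 / f t) \<partial>lborel)" for u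
    unfolding F_of_def nn_integral_completion by (simp add: mult.commute)
  have "(\<lambda>n. F_of f (real (Suc n))) \<longlonglongrightarrow> (\<integral>\<^sup>+t. 0 \<partial>(lborel :: real measure))"
    unfolding eq
  proof (rule nn_integral_dominated_convergence[where w = "\<lambda>t. indicator {1<..} t * ennreal (1 / f t)"])
    show "(\<integral>\<^sup>+t. indicator {1<..} t * ennreal (1 / f t) \<partial>lborel) < \<infinity>"
      using F_of_finite[of 1] unfolding eq by simp
    show "AE t in lborel. indicator {real (Suc n)<..} t * ennreal (1 / f t) \<le> indicator {1<..} t * ennreal (1 / f t)" for n
      by (auto simp: indicator_def)
    show "AE t in lborel. (\<lambda>n. indicator {real (Suc n)<..} t * ennreal (1 / f t)) \<longlonglongrightarrow> 0"
    proof (rule AE_I2)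
      fix t :: real
      obtain k where k: "t < real k" using reals_Archimedean2 by blast
      show "(\<lambda>n. indicator {real (Suc n)<..} t * ennreal (1 / f t)) \<longlonglongrightarrow> 0"
        by (rule tendsto_eventually, rule eventually_mono[OF eventually_ge_at_top[of k]]) (use k in auto)
    qed
  qed (use borel_measurable_inverse_f in auto)
  then have "(\<lambda>n. enn2real (F_of f (real (Suc n)))) \<longlonglongrightarrow> enn2real 0" by (intro tendsto_enn2real) auto
  then have L: "(\<lambda>n. Fr (real (Suc n))) \<longlonglongrightarrow> 0" by (simp add: Fr_def)
  show ?thesis
  proof (rule tendstoI)
    fix e :: real assume "e > 0"
    then obtain n where n: "Fr (real (Suc n)) < e"
      using order_tendstoD(2)[OF L, of e] by (auto simp: eventually_sequentially)
    show "\<forall>\<^sub>F u in at_top. dist (Fr u) 0 < e"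
      using eventually_ge_at_top[of "real (Suc n)"]
    proof eventually_elim
      case (elim u)
      then have "Fr u \<le> Fr (real (Suc n))" "u > 0" by (auto intro!: Fr_antimono)
      then show ?case using n Fr_pos[of u] by simp
    qed
  qed
qed

lemma Finv:
  assumes "c > 0" "0 < p" "p \<le> Fr c"
  shows "Finv p \<ge> c" "Fr (Finv p) = p" "Finv p > 0"
proof -
  obtain v where v: "v \<ge> c" "Fr v < p"
    using order_tendstoD(2)[OF Fr_tendsto_0 assms(2)] unfolding eventually_at_top_linorder
    by (metis nle_le)
  have "\<exists>u\<ge>c. u \<le> v \<and> Fr u = p"
  proof (rule IVT2)
    show "\<forall>x. c \<le> x \<and> x \<le> v \<longrightarrow> isCont Fr x" using assms by (auto intro!: DERIV_isCont[OF Fr_deriv])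
  qed (use v assms in auto)
  then obtain u where u: "c \<le> u" "Fr u = p" by auto
  have "Finv p = u"
    unfolding Finv_def
  proof (rule the_equality)
    fix w assume w: "0 < w \<and> Fr w = p"
    then show "w = u" using u assms Fr_le_iff[of u w] Fr_le_iff[of w u] by auto
  qed (use u assms in auto)
  then show "Finv p \<ge> c" "Fr (Finv p) = p" "Finv p > 0" using u assms by auto
qed

section \<open>Monotone products of f with powers of F, and convexity of powers of F\<close>

lemma fF_antimono:
  assumes "c > 0" "\<And>u. u \<ge> c \<Longrightarrow> deriv f u * Fr u \<le> 1" "c \<le> u" "u \<le> v"
  shows "f v * Fr v \<le> f u * Fr u"
proof (rule DERIV_nonpos_imp_nonincreasing[OF assms(4)])
  fix x assume x: "u \<le> x" "x \<le> v"
  then have "x > 0" "deriv f x * Fr x \<le> 1" using assms by auto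
  then have "((\<lambda>u. f u * Fr u) has_real_derivative (deriv f x * Fr x - 1)) (at x)"
    using has_deriv Fr_deriv pos[of x] by (auto intro!: derivative_eq_intros)
  then show "\<exists>y. ((\<lambda>u. f u * Fr u) has_real_derivative y) (at x) \<and> y \<le> 0"
    using \<open>deriv f x * Fr x \<le> 1\<close> by (intro exI[of _ "deriv f x * Fr x - 1"]) auto
qed

text \<open>The counterpart of \<open>fF_antimono\<close>: \<open>f * Fr\<close> may decrease to 0,
  but beyond c it stays above a fixed multiple of \<open>Fr powr \<epsilon>\<close>. This controls
  the gap in the existence proof and the convexity of \<open>Fr powr \<epsilon>\<close> in the
  nonexistence proof.\<close>

lemma f_Fr_powr_mono:
  assumes "c > 0" "\<And>u. u \<ge> c \<Longrightarrow> deriv f u * Fr u \<ge> 1 - \<epsilon>" "c \<le> u" "u \<le> v"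
  shows "f u * Fr u powr (1 - \<epsilon>) \<le> f v * Fr v powr (1 - \<epsilon>)"
proof (rule DERIV_nonneg_imp_nondecreasing[OF assms(4)])
  fix x assume x: "u \<le> x" "x \<le> v"
  then have x0: "x > 0" and le: "deriv f x * Fr x \<ge> 1 - \<epsilon>" using assms by auto
  have Fx: "Fr x > 0" by (rule Fr_pos[OF x0])
  have "((\<lambda>u. f u * Fr u powr (1 - \<epsilon>)) has_real_derivative
      deriv f x * Fr x powr (1 - \<epsilon>) + f x * ((1 - \<epsilon>) * Fr x powr (1 - \<epsilon> - 1) * (- (1 / f x)))) (at x)"
    by (rule DERIV_cong[OF DERIV_mult[OF has_deriv[OF x0] DERIV_fun_powr[OF Fr_deriv[OF x0] Fx, of "1 - \<epsilon>"]]])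
       simp
  also have "deriv f x * Fr x powr (1 - \<epsilon>) + f x * ((1 - \<epsilon>) * Fr x powr (1 - \<epsilon> - 1) * (- (1 / f x)))
     = Fr x powr (- \<epsilon>) * (deriv f x * Fr x - (1 - \<epsilon>))"
  proof -
    have "Fr x powr (1 - \<epsilon>) = Fr x powr (- \<epsilon>) * Fr x" using Fx powr_add[of "Fr x" "- \<epsilon>" 1] by simp
    then show ?thesis using pos[OF x0] by (simp add: algebra_simps)
  qed
  finally have der: "((\<lambda>u. f u * Fr u powr (1 - \<epsilon>)) has_real_derivative Fr x powr (- \<epsilon>) * (deriv f x * Fr x - (1 - \<epsilon>))) (at x)" .
  show "\<exists>y. ((\<lambda>u. f u * Fr u powr (1 - \<epsilon>)) has_real_derivative y) (at x) \<and> 0 \<le> y"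
    using der le by (intro exI[of _ "Fr x powr (- \<epsilon>) * (deriv f x * Fr x - (1 - \<epsilon>))"]) auto
qed

lemma Fr_powr_deriv:
  assumes "u > 0"
  shows "((\<lambda>u. Fr u powr a) has_real_derivative - a * Fr u powr (a - 1) / f u) (at u)"
  by (rule DERIV_cong[OF DERIV_fun_powr[OF Fr_deriv[OF assms] Fr_pos[OF assms], of a]]) simp

text \<open>Convexity in tangent form. The slope of \<open>Fr powr (-r)\<close> is r divided by the
  product of \<open>f * Fr\<close> and \<open>Fr powr r\<close>; both factors decrease, so the slope
  increases.\<close>

lemma Fr_neg_powr_tangent:
  assumes c: "c > 0" "\<And>u. u \<ge> c \<Longrightarrow> deriv f u * Fr u \<le> 1" and r: "r > 0" and "c \<le> a" "c \<le> u"
  shows "Fr a powr (-r) + r * Fr a powr (- r - 1) / f a * (u - a) \<le> Fr u powr (-r)"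
proof (rule tangent_line_below[where c = c and g' = "\<lambda>a. r * Fr a powr (- r - 1) / f a"])
  show "((\<lambda>u. Fr u powr (-r)) has_real_derivative r * Fr u powr (- r - 1) / f u) (at u)" if "c \<le> u" for u
    using Fr_powr_deriv[of u "-r"] c that by simp
  fix u v assume uv: "c \<le> u" "u \<le> v"
  then have 0: "u > 0" "v > 0" using c by auto
  have eq: "Fr x powr (- r - 1) / f x = 1 / (f x * Fr x * Fr x powr r)" if "x > 0" for x
  proof -
    have "Fr x powr (- r - 1) = Fr x powr (- (r + 1))" by simp
    also have "\<dots> = 1 / Fr x powr (r + 1)" by (rule powr_minus_divide)
    also have "Fr x powr (r + 1) = Fr x powr r * Fr x" using Fr_pos[OF that] by (simp add: powr_add)
    finally show ?thesis by simp
  qed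
  have "f v * Fr v * Fr v powr r \<le> f u * Fr u * Fr u powr r"
    using r uv 0 pos[OF 0(1)] Fr_nonneg
    by (intro mult_mono[OF fF_antimono[OF c uv]] powr_mono2 Fr_antimono) auto
  moreover have "0 < f v * Fr v * Fr v powr r"
    using pos[OF 0(2)] Fr_pos[OF 0(2)] by simp
  ultimately have "1 / (f u * Fr u * Fr u powr r) \<le> 1 / (f v * Fr v * Fr v powr r)"
    by (intro frac_le) auto
  then have "r * (Fr u powr (- r - 1) / f u) \<le> r * (Fr v powr (- r - 1) / f v)"
    unfolding eq[OF 0(1)] eq[OF 0(2)] using r by (intro mult_left_mono) auto
  then show "r * Fr u powr (- r - 1) / f u \<le> r * Fr v powr (- r - 1) / f v" by simp
qed (use assms in auto)

text \<open>The slope of \<open>Fr powr \<epsilon>\<close> is - \<epsilon> divided by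
  \<open>f * Fr powr (1 - \<epsilon>)\<close>, whose denominator is nondecreasing by
  \<open>f_Fr_powr_mono\<close>.\<close>

lemma Fr_powr_tangent:
  assumes c: "c > 0" "\<And>u. u \<ge> c \<Longrightarrow> deriv f u * Fr u \<ge> 1 - \<epsilon>" and \<epsilon>: "\<epsilon> > 0" and "c \<le> a" "c \<le> u"
  shows "Fr a powr \<epsilon> + - \<epsilon> * Fr a powr (\<epsilon> - 1) / f a * (u - a) \<le> Fr u powr \<epsilon>"
proof (rule tangent_line_below[where c = c and g' = "\<lambda>a. - \<epsilon> * Fr a powr (\<epsilon> - 1) / f a"])
  show "((\<lambda>u. Fr u powr \<epsilon>) has_real_derivative - \<epsilon> * Fr u powr (\<epsilon> - 1) / f u) (at u)" if "c \<le> u" for u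
    using Fr_powr_deriv[of u \<epsilon>] c that by simp
  fix u v assume uv: "c \<le> u" "u \<le> v"
  then have 0: "u > 0" "v > 0" using c by auto
  have eq: "Fr x powr (\<epsilon> - 1) / f x = 1 / (f x * Fr x powr (1 - \<epsilon>))" if "x > 0" for x
    using Fr_pos[OF that] powr_minus_divide[of "Fr x" "1 - \<epsilon>"] by (simp add: mult_ac)
  have "1 / (f v * Fr v powr (1 - \<epsilon>)) \<le> 1 / (f u * Fr u powr (1 - \<epsilon>))"
    using f_Fr_powr_mono[OF c uv] 0 Fr_pos pos by (intro divide_left_mono) (auto intro!: mult_pos_pos simp: less_imp_neq[symmetric])
  then have "\<epsilon> * (Fr v powr (\<epsilon> - 1) / f v) \<le> \<epsilon> * (Fr u powr (\<epsilon> - 1) / f u)"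
    unfolding eq[OF 0(1)] eq[OF 0(2)] using \<epsilon> by (intro mult_left_mono) auto
  then show "- \<epsilon> * Fr u powr (\<epsilon> - 1) / f u \<le> - \<epsilon> * Fr v powr (\<epsilon> - 1) / f v" by simp
qed (use assms in auto)

lemma F_neg_pow_eq: "u > 0 \<Longrightarrow> F_neg_pow f r u = Fr u powr (-r)"
  using F_of_finite[of u] by (simp add: F_neg_pow_def Fr_def powr_minus_divide)

end

section \<open>Tangent lines and monotone iteration\<close>

text \<open>Jensen's inequality for an increasing convex function h with \<psi> in the role of
  h(\<phi>), H of h(a) and m of h'(a): a bound on the average of \<psi> by H bounds the average of
  \<phi> by a. The tangent inequality is arranged without subtraction, since the averages live in
  \<open>ennreal\<close>.\<close>

lemma S_le_of_tangent:
  fixes \<phi> \<psi> :: "'a::euclidean_space \<Rightarrow> real"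
  assumes \<theta>: "0 < \<theta>" "\<theta> \<le> 2" and t: "t > 0"
    and [measurable]: "\<phi> \<in> borel_measurable borel" "\<psi> \<in> borel_measurable borel"
    and nonneg: "\<And>y. \<phi> y \<ge> 0" "\<And>y. \<psi> y \<ge> 0" "m > 0" "H \<ge> 0" "a \<ge> 0"
    and tangent: "\<And>y. m * \<phi> y + H \<le> m * a + \<psi> y"
    and le: "S \<theta> t (\<lambda>y. ennreal (\<psi> y)) x \<le> ennreal H"
  shows "S \<theta> t (\<lambda>y. ennreal (\<phi> y)) x \<le> ennreal a"
proof -
  let ?S = "\<lambda>\<phi>. S \<theta> t (\<lambda>y. ennreal (\<phi> y)) x"
  have "ennreal H + ennreal m * ?S \<phi> = S \<theta> t (\<lambda>y. ennreal H + ennreal m * ennreal (\<phi> y)) x"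
    by (simp add: S_add S_cmult S_const[OF \<theta> t])
  also have "\<dots> \<le> S \<theta> t (\<lambda>y. ennreal (m * a) + ennreal (\<psi> y)) x"
  proof (rule S_mono)
    fix y
    show "ennreal H + ennreal m * ennreal (\<phi> y) \<le> ennreal (m * a) + ennreal (\<psi> y)"
      using ennreal_leI[OF tangent[of y]] nonneg by (simp add: ennreal_mult add.commute)
  qed
  also have "\<dots> = ennreal (m * a) + ?S \<psi>"
    by (simp add: S_add S_const[OF \<theta> t])
  also have "\<dots> \<le> ennreal (m * a) + ennreal H" by (intro add_left_mono le)
  also have "\<dots> = ennreal H + ennreal (m * a)" by (rule add.commute)
  finally have "ennreal m * ?S \<phi> \<le> ennreal (m * a)"
    by (simp add: ennreal_add_left_cancel_le)
  then have "ennreal (1 / m) * (ennreal m * ?S \<phi>) \<le> ennreal (1 / m) * ennreal (m * a)"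
    by (intro mult_left_mono) auto
  then show ?thesis using nonneg by (simp add: mult.assoc[symmetric] ennreal_mult[symmetric])
qed

text \<open>The same for a decreasing convex function with slope - m at a: an upper bound on the
  average of \<psi> becomes a lower bound on that of \<phi>.\<close>

lemma S_ge_of_tangent:
  fixes \<phi> \<psi> :: "'a::euclidean_space \<Rightarrow> real"
  assumes \<theta>: "0 < \<theta>" "\<theta> \<le> 2" and t: "t > 0"
    and [measurable]: "\<phi> \<in> borel_measurable borel" "\<psi> \<in> borel_measurable borel"
    and nonneg: "\<And>y. \<phi> y \<ge> 0" "\<And>y. \<psi> y \<ge> 0" "m > 0" "H \<ge> 0" "a \<ge> 0"
    and tangent: "\<And>y. H + m * a \<le> \<psi> y + m * \<phi> y"
    and le: "S \<theta> t (\<lambda>y. ennreal (\<psi> y)) x \<le> ennreal H"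
  shows "ennreal a \<le> S \<theta> t (\<lambda>y. ennreal (\<phi> y)) x"
proof -
  let ?S = "\<lambda>\<phi>. S \<theta> t (\<lambda>y. ennreal (\<phi> y)) x"
  have "ennreal H + ennreal (m * a) = S \<theta> t (\<lambda>y. ennreal H + ennreal (m * a)) x"
    by (simp add: S_const[OF \<theta> t])
  also have "\<dots> \<le> S \<theta> t (\<lambda>y. ennreal (\<psi> y) + ennreal m * ennreal (\<phi> y)) x"
  proof (rule S_mono)
    fix y
    show "ennreal H + ennreal (m * a) \<le> ennreal (\<psi> y) + ennreal m * ennreal (\<phi> y)"
      using ennreal_leI[OF tangent[of y]] nonneg by (simp add: ennreal_mult)
  qed
  also have "\<dots> = ?S \<psi> + ennreal m * ?S \<phi>"
    by (simp add: S_add S_cmult)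
  also have "\<dots> \<le> ennreal H + ennreal m * ?S \<phi>"
    by (intro add_right_mono le)
  finally have "ennreal (m * a) \<le> ennreal m * ?S \<phi>"
    by (simp add: ennreal_add_left_cancel_le)
  then have "ennreal (1 / m) * ennreal (m * a) \<le> ennreal (1 / m) * (ennreal m * ?S \<phi>)"
    by (intro mult_left_mono) auto
  then show ?thesis using nonneg by (simp add: mult.assoc[symmetric] ennreal_mult[symmetric])
qed

section \<open>The Duhamel operator on \<open>ennreal\<close>-valued functions and its monotone
  iteration\<close>

context nonlinearity
begin

text \<open>Infinity is sent to \<open>f 0\<close>, because \<open>enn2real\<close> maps it to 0.
  Monotonicity and continuity are therefore stated for finite arguments only.\<close>

definition fe :: "ennreal \<Rightarrow> ennreal" where "fe v = ennreal (f (enn2real v))"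

definition duhamel :: "real \<Rightarrow> ('a::euclidean_space \<Rightarrow> real) \<Rightarrow> ('a \<Rightarrow> real \<Rightarrow> ennreal) \<Rightarrow> 'a \<Rightarrow> real \<Rightarrow> ennreal" where
  "duhamel \<theta> \<phi> U x t = S \<theta> t (\<lambda>y. ennreal (\<phi> y)) x +
     (\<integral>\<^sup>+s\<in>{0<..<t}. S \<theta> (t - s) (\<lambda>y. fe (U y s)) x \<partial>lborel)"

lemma borel_measurable_fe [measurable]: "fe \<in> borel_measurable borel"
proof -
  have "continuous_on UNIV (\<lambda>u. f (max u 0))"
    by (rule continuous_on_compose2[OF cont]) (auto intro!: continuous_intros)
  then have [measurable]: "(\<lambda>u. f (max u 0)) \<in> borel_measurable borel" by (rule borel_measurable_continuous_onI)
  have "fe = (\<lambda>v. ennreal (f (max (enn2real v) 0)))" by (rule ext) (simp add: fe_def max_absorb1)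
  moreover have "(\<lambda>v. ennreal (f (max (enn2real v) 0))) \<in> borel_measurable borel" by measurable
  ultimately show ?thesis by (simp only:)
qed

lemma fe_mono: "u \<le> v \<Longrightarrow> v < \<infinity> \<Longrightarrow> fe u \<le> fe v"
  unfolding fe_def by (intro ennreal_leI f_mono enn2real_mono) auto

lemma fe_tendsto:
  assumes "(U \<longlongrightarrow> v) F" "v < \<infinity>"
  shows "((\<lambda>n. fe (U n)) \<longlongrightarrow> fe v) F"
proof -
  have "((\<lambda>n. enn2real (U n)) \<longlongrightarrow> enn2real v) F"
    using assms by (intro tendsto_enn2real) auto
  then have "((\<lambda>n. f (enn2real (U n))) \<longlongrightarrow> f (enn2real v)) F"
    by (rule continuous_on_tendsto_compose[OF cont]) auto
  then show ?thesis unfolding fe_def by (rule tendsto_ennrealI)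
qed

lemma borel_measurable_duhamel:
  fixes \<phi> :: "'a::euclidean_space \<Rightarrow> real"
  assumes [measurable]: "\<phi> \<in> borel_measurable borel"
    "(\<lambda>(x, t). U x t) \<in> borel_measurable (borel \<Otimes>\<^sub>M borel)"
  shows "(\<lambda>(x, t). duhamel \<theta> \<phi> U x t) \<in> borel_measurable (borel \<Otimes>\<^sub>M borel)"
proof -
  have "(\<lambda>(x, t). duhamel \<theta> \<phi> U x t) = (\<lambda>z. S \<theta> (snd z) (\<lambda>y. ennreal (\<phi> y)) (fst z) +
     (\<integral>\<^sup>+s. S \<theta> (snd z - s) (\<lambda>y. fe (U y s)) (fst z) * indicator {s. 0 < s \<and> s < snd z} s \<partial>lborel))"
    by (simp add: duhamel_def fun_eq_iff greaterThanLessThan_def greaterThan_def lessThan_def Int_def)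
  also have "\<dots> \<in> borel_measurable (borel \<Otimes>\<^sub>M borel)"
    by measurable
  finally show ?thesis .
qed

lemma duhamel_mono:
  assumes "\<And>y s. 0 < s \<Longrightarrow> s < t \<Longrightarrow> U y s \<le> V y s \<and> V y s < \<infinity>"
  shows "duhamel \<theta> \<phi> U x t \<le> duhamel \<theta> \<phi> V x t"
  unfolding duhamel_def
  by (intro add_left_mono nn_integral_mono) (use assms in \<open>auto simp: indicator_def intro!: S_mono fe_mono\<close>)

text \<open>The barrier w depends on time alone. While an iterate stays below w, its nonlinear term
  is at most \<open>g s\<close>, which the semigroup leaves unchanged as a constant in space, so the
  next iterate stays below w. Monotone convergence in space and then in time identifies the limit as
  a fixed point.\<close>

lemma duhamel_fixed_point:
  fixes \<phi> :: "'a::euclidean_space \<Rightarrow> real" and g :: "real \<Rightarrow> ennreal"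
  assumes \<theta>: "0 < \<theta>" "\<theta> \<le> 2"
    and [measurable]: "\<phi> \<in> borel_measurable borel"
    and w0: "\<And>t. 0 < t \<Longrightarrow> t < T \<Longrightarrow> w t \<ge> 0"
    and g: "\<And>s u. 0 < s \<Longrightarrow> s < T \<Longrightarrow> 0 \<le> u \<Longrightarrow> u \<le> w s \<Longrightarrow> ennreal (f u) \<le> g s"
    and w: "\<And>t x. 0 < t \<Longrightarrow> t < T \<Longrightarrow> S \<theta> t (\<lambda>y. ennreal (\<phi> y)) x + (\<integral>\<^sup>+s\<in>{0<..<t}. g s \<partial>lborel) \<le> ennreal (w t)"
  obtains U where "(\<lambda>(x, t). U x t) \<in> borel_measurable (borel \<Otimes>\<^sub>M borel)"
    "\<And>x t. 0 < t \<Longrightarrow> t < T \<Longrightarrow> U x t < \<infinity>"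
    "\<And>x t. 0 < t \<Longrightarrow> t < T \<Longrightarrow> duhamel \<theta> \<phi> U x t = U x t"
proof -
  define P where "P n = (duhamel \<theta> \<phi> ^^ n) (\<lambda>x t. 0)" for n
  have P0: "P 0 = (\<lambda>x t. 0)" and PS: "P (Suc n) = duhamel \<theta> \<phi> (P n)" for n by (simp_all add: P_def)
  have [measurable]: "(\<lambda>(x, t). P n x t) \<in> borel_measurable (borel \<Otimes>\<^sub>M borel)" for n
  proof (induction n)
    case (Suc n)
    show ?case unfolding PS by (rule borel_measurable_duhamel) (use Suc in measurable)
  qed (simp add: P0)
  have bound: "P n x t \<le> ennreal (w t)" if "0 < t" "t < T" for n x t
    using that
  proof (induction n arbitrary: x t)
    case (Suc n)
    have "fe (P n y s) \<le> g s" if s: "0 < s" "s < t" for y s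
    proof -
      have le: "P n y s \<le> ennreal (w s)" using Suc s by auto
      have "enn2real (P n y s) \<le> w s" using le w0[of s] s Suc.prems by (intro enn2real_leI) auto
      then show ?thesis unfolding fe_def using s Suc.prems by (intro g) auto
    qed
    then have "S \<theta> (t - s) (\<lambda>y. fe (P n y s)) x \<le> g s" if "0 < s" "s < t" for s
      using S_mono[of "\<lambda>y. fe (P n y s)" "\<lambda>_. g s" \<theta> "t - s" x] S_const[OF \<theta>, of "t - s" "g s" x] that by simp
    then have "P (Suc n) x t \<le> S \<theta> t (\<lambda>y. ennreal (\<phi> y)) x + (\<integral>\<^sup>+s\<in>{0<..<t}. g s \<partial>lborel)"
      unfolding PS duhamel_def by (intro add_left_mono nn_integral_mono) (auto simp: indicator_def)
    also have "\<dots> \<le> ennreal (w t)" using w Suc.prems by auto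
    finally show ?case .
  qed (simp add: P0)
  have fin: "P n x t < \<infinity>" if "0 < t" "t < T" for n x t
    using bound[OF that] by (rule le_less_trans) simp
  have Pmono: "P n x t \<le> P (Suc n) x t" if "0 < t" "t < T" for n x t
    using that
  proof (induction n arbitrary: x t)
    case (Suc n)
    show ?case unfolding PS[of "Suc n"] PS[of n]
      by (rule duhamel_mono) (use Suc fin in \<open>auto simp flip: PS\<close>)
  qed (simp add: P0)
  have Pinc: "incseq (\<lambda>n. P n x t)" if "0 < t" "t < T" for x t
    using Pmono[OF that] by (rule incseq_SucI)
  define U where "U x t = (SUP n. P n x t)" for x t
  have Ub: "U x t \<le> ennreal (w t)" if "0 < t" "t < T" for x t
    unfolding U_def by (intro SUP_least bound that)
  have Ufin: "U x t < \<infinity>" if "0 < t" "t < T" for x t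
    using Ub[OF that] by (rule le_less_trans) simp
  have Ulim: "(\<lambda>n. P n x t) \<longlonglongrightarrow> U x t" if "0 < t" "t < T" for x t
    unfolding U_def by (rule LIMSEQ_SUP[OF Pinc[OF that]])
  have Um[measurable]: "(\<lambda>(x, t). U x t) \<in> borel_measurable (borel \<Otimes>\<^sub>M borel)"
    unfolding U_def by measurable
  have "duhamel \<theta> \<phi> U x t = U x t" if t: "0 < t" "t < T" for x t
  proof (rule LIMSEQ_unique)
    show "(\<lambda>n. P (Suc n) x t) \<longlonglongrightarrow> U x t" by (rule LIMSEQ_Suc[OF Ulim[OF t]])
    have inner: "(\<lambda>n. S \<theta> (t - s) (\<lambda>y. fe (P n y s)) x) \<longlonglongrightarrow> S \<theta> (t - s) (\<lambda>y. fe (U y s)) x"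
      and mono: "S \<theta> (t - s) (\<lambda>y. fe (P n y s)) x \<le> S \<theta> (t - s) (\<lambda>y. fe (P (Suc n) y s)) x"
      if s: "0 < s" "s < t" for s n
    proof -
      have sT: "s < T" using s t by simp
      show "S \<theta> (t - s) (\<lambda>y. fe (P n y s)) x \<le> S \<theta> (t - s) (\<lambda>y. fe (P (Suc n) y s)) x" for n
        by (intro S_mono fe_mono Pmono fin s sT)
      show "(\<lambda>n. S \<theta> (t - s) (\<lambda>y. fe (P n y s)) x) \<longlonglongrightarrow> S \<theta> (t - s) (\<lambda>y. fe (U y s)) x"
        unfolding S_eq
      proof (rule nn_integral_LIMSEQ)
        show "incseq (\<lambda>n y. ennreal (G \<theta> (x - y) (t - s)) * fe (P n y s))"
          by (intro incseq_SucI le_funI mult_left_mono fe_mono Pmono fin s sT) simp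
        show "(\<lambda>n. ennreal (G \<theta> (x - y) (t - s)) * fe (P n y s)) \<longlonglongrightarrow> ennreal (G \<theta> (x - y) (t - s)) * fe (U y s)" for y
          by (intro ennreal_tendsto_cmult fe_tendsto Ulim Ufin s sT) simp
      qed measurable
    qed
    have "(\<lambda>n. \<integral>\<^sup>+s\<in>{0<..<t}. S \<theta> (t - s) (\<lambda>y. fe (P n y s)) x \<partial>lborel) \<longlonglongrightarrow> (\<integral>\<^sup>+s\<in>{0<..<t}. S \<theta> (t - s) (\<lambda>y. fe (U y s)) x \<partial>lborel)"
    proof (rule nn_integral_LIMSEQ)
      show "incseq (\<lambda>n s. S \<theta> (t - s) (\<lambda>y. fe (P n y s)) x * indicator {0<..<t} s)"
        by (intro incseq_SucI le_funI) (auto simp: indicator_def mono)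
      show "(\<lambda>n. S \<theta> (t - s) (\<lambda>y. fe (P n y s)) x * indicator {0<..<t} s) \<longlonglongrightarrow> S \<theta> (t - s) (\<lambda>y. fe (U y s)) x * indicator {0<..<t} s" for s
        using inner[of s] by (cases "s \<in> {0<..<t}") auto
    qed measurable
    then show "(\<lambda>n. P (Suc n) x t) \<longlonglongrightarrow> duhamel \<theta> \<phi> U x t"
      unfolding PS duhamel_def by (intro tendsto_add tendsto_const)
  qed
  then show ?thesis using that[OF Um Ufin] by blast
qed

end

section \<open>Existence\<close>

lemma borel_measurable_lebesgue_on_of_borel:
  fixes u :: "'a::euclidean_space \<Rightarrow> real \<Rightarrow> real"
  assumes "(\<lambda>(x, t). u x t) \<in> borel_measurable (borel \<Otimes>\<^sub>M borel)"
  shows "(\<lambda>(x, t). u x t) \<in> borel_measurable (lebesgue_on A)"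
proof -
  have "(\<lambda>(x, t). u x t) \<in> borel_measurable lborel" using assms by (simp add: borel_prod)
  then show ?thesis by (intro measurable_restrict_space1 measurable_completion)
qed

context nonlinearity
begin

lemma has_local_solution_of_duhamel:
  fixes \<phi> \<phi>' :: "'a::euclidean_space \<Rightarrow> real"
  assumes T: "T > 0" and ae: "AE x in lborel. \<phi> x = \<phi>' x"
    and U: "(\<lambda>(x, t). U x t) \<in> borel_measurable (borel \<Otimes>\<^sub>M borel)"
      "\<And>x t. 0 < t \<Longrightarrow> t < T \<Longrightarrow> U x t < \<infinity>"
      "\<And>x t. 0 < t \<Longrightarrow> t < T \<Longrightarrow> duhamel \<theta> \<phi>' U x t = U x t"
  shows "has_local_solution \<theta> f \<phi>"
  unfolding has_local_solution_def
proof (intro exI conjI)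
  show "T > 0" by (rule T)
  note [measurable] = U(1)
  have m: "(\<lambda>(x, t). enn2real (U x t)) \<in> borel_measurable (borel \<Otimes>\<^sub>M borel)" by measurable
  show "integral_solution \<theta> f \<phi> T (\<lambda>x t. enn2real (U x t))"
    unfolding integral_solution_def
  proof (intro conjI ballI allI)
    show "(\<lambda>(x, t). enn2real (U x t)) \<in> borel_measurable (lebesgue_on (UNIV \<times> {0<..<T}))"
      by (rule borel_measurable_lebesgue_on_of_borel[OF m])
    fix t assume t: "t \<in> {0<..<T}"
    have "ennreal (enn2real (U x t)) = S \<theta> t (\<lambda>y. ennreal (\<phi> y)) x +
          (\<integral>\<^sup>+s\<in>{0<..<t}. S \<theta> (t - s) (\<lambda>y. ennreal (f (enn2real (U y s)))) x \<partial>lebesgue)" for x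
    proof -
      have "S \<theta> t (\<lambda>y. ennreal (\<phi> y)) x = S \<theta> t (\<lambda>y. ennreal (\<phi>' y)) x"
        by (rule S_cong_AE) (use ae in eventually_elim, simp)
      then show ?thesis
        using U(2)[of t x] U(3)[of t x] t by (simp add: duhamel_def fe_def nn_integral_completion)
    qed
    then show "AE x in lebesgue. ennreal (enn2real (U x t)) = S \<theta> t (\<lambda>y. ennreal (\<phi> y)) x +
          (\<integral>\<^sup>+s\<in>{0<..<t}. S \<theta> (t - s) (\<lambda>y. ennreal (f (enn2real (U y s)))) x \<partial>lebesgue)"
      by simp
  qed simp
qed

text \<open>The truncation at c keeps the argument in the positive reals, where \<open>Fr\<close> is
  differentiable.\<close>

lemma borel_measurable_Fr_max:
  assumes "c > 0"
  shows "(\<lambda>u. Fr (max u c)) \<in> borel_measurable borel"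
proof (rule borel_measurable_continuous_onI)
  have "continuous_on {0<..} Fr"
    by (intro continuous_at_imp_continuous_on ballI DERIV_isCont[OF Fr_deriv]) simp
  then show "continuous_on UNIV (\<lambda>u. Fr (max u c))"
    by (rule continuous_on_compose2) (use assms in \<open>auto intro!: continuous_intros\<close>)
qed

lemma eventually_at_right_powr_less:
  fixes a e :: real
  assumes "a > 0" "e > 0"
  shows "\<forall>\<^sub>F t in at_right 0. t powr a < e"
proof -
  have "\<forall>\<^sub>F t in at_right 0. 0 \<le> (t::real)"
    using eventually_at_right_less[of "0::real"] by eventually_elim auto
  then have "((\<lambda>t. t powr a) \<longlongrightarrow> 0 powr a) (at_right 0)"
    using assms by (intro tendsto_powr' tendsto_intros) auto
  then show ?thesis using assms by (auto dest: order_tendstoD(2))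
qed

lemma local_existence:
  fixes \<phi> :: "'a::euclidean_space \<Rightarrow> real"
  assumes \<theta>: "0 < \<theta>" "\<theta> \<le> 2" and \<rho>: "\<rho> > 0" and r: "r > DIM('a) / \<theta>"
    and le1: "\<forall>\<^sub>F u in at_top. deriv f u * enn2real (F_of f u) \<le> 1"
    and \<phi>: "\<phi> \<in> borel_measurable lebesgue" "\<And>x. 0 \<le> \<phi> x"
    and ul: "(\<lambda>x. F_neg_pow f r (\<phi> x)) \<in> L1_ul \<rho>"
  shows "has_local_solution \<theta> f \<phi>"
proof -
  define \<alpha> where "\<alpha> = DIM('a) / (\<theta> * r)"
  have r0: "r > 0" using r \<theta> by (smt (verit) divide_pos_pos DIM_positive of_nat_0_less_iff)
  have \<alpha>: "0 < \<alpha>" "\<alpha> < 1" using r r0 \<theta> by (auto simp: \<alpha>_def field_simps)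
  have \<alpha>r: "\<alpha> * r = DIM('a) / \<theta>" using r0 by (simp add: \<alpha>_def)
  \<comment> \<open>This makes \<open>\<alpha> * \<epsilon>\<close> half of
    \<open>1 - \<alpha>\<close>. The other half, \<eta>, is the power of t left over to beat the
    constants.\<close>
  define \<epsilon> where "\<epsilon> = (1 - \<alpha>) / (2 * \<alpha>)"
  have \<epsilon>: "\<epsilon> > 0" using \<alpha> by (simp add: \<epsilon>_def)
  define \<eta> where "\<eta> = (1 - \<alpha>) / 2"
  have \<eta>: "\<eta> > 0" "1 - \<alpha> = \<eta> + \<alpha> * \<epsilon>" using \<alpha> by (auto simp: \<eta>_def \<epsilon>_def field_simps)
  have "\<forall>\<^sub>F u in at_top. deriv f u * Fr u > 1 - \<epsilon>"
    using order_tendstoD(1)[OF F_lim, of "1 - \<epsilon>"] \<epsilon> by (simp add: Fr_def)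
  then have "\<forall>\<^sub>F u in at_top. u > 0 \<and> deriv f u * Fr u \<le> 1 \<and> 1 - \<epsilon> \<le> deriv f u * Fr u"
    using le1 eventually_gt_at_top[of 0] by eventually_elim (auto simp: Fr_def)
  then obtain c where c: "\<And>u. u \<ge> c \<Longrightarrow> u > 0 \<and> deriv f u * Fr u \<le> 1 \<and> 1 - \<epsilon> \<le> deriv f u * Fr u"
    unfolding eventually_at_top_linorder by blast
  have c0: "c > 0" and c1: "\<And>u. u \<ge> c \<Longrightarrow> deriv f u * Fr u \<le> 1" and c2: "\<And>u. u \<ge> c \<Longrightarrow> 1 - \<epsilon> \<le> deriv f u * Fr u"
    using c by auto
  have Fc: "Fr c > 0" by (rule Fr_pos[OF c0])
  obtain \<phi>0 where \<phi>0: "\<phi>0 \<in> borel_measurable lborel" "AE x in lborel. \<phi> x = \<phi>0 x"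
    using completion_ex_borel_measurable_real[OF \<phi>(1)] by blast
  \<comment> \<open>A Borel version agrees with \<phi> only almost everywhere; the maximum restores
    nonnegativity at every point.\<close>
  define \<phi>' where "\<phi>' x = max 0 (\<phi>0 x)" for x
  have [measurable]: "\<phi>' \<in> borel_measurable borel" unfolding \<phi>'_def using \<phi>0(1) by simp
  have ae: "AE x in lborel. \<phi> x = \<phi>' x"
    using \<phi>0(2)
  proof eventually_elim
    case (elim x)
    then show ?case using \<phi>(2)[of x] by (simp add: \<phi>'_def)
  qed
  \<comment> \<open>Raising the datum to at least c moves it into the range where
    \<open>Fr powr (-r)\<close> is convex. Where the datum is below c, the result is the constant
    \<open>Fr c powr (-r)\<close>, which has finite integral over every \<rho>-ball.\<close>
  define \<psi> where "\<psi> x = Fr (max (\<phi>' x) c) powr (-r)" for x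
  have [measurable]: "(\<lambda>x. Fr (max (\<phi>' x) c)) \<in> borel_measurable borel"
    by (rule measurable_compose[OF _ borel_measurable_Fr_max[OF c0]]) measurable
  have [measurable]: "\<psi> \<in> borel_measurable borel"
    unfolding \<psi>_def by measurable
  define K0 where "K0 = (SUP y. \<integral>\<^sup>+x\<in>ball y \<rho>. ennreal \<bar>F_neg_pow f r (\<phi> x)\<bar> \<partial>lebesgue)"
  have K0: "K0 < \<infinity>" using ul unfolding L1_ul_def K0_def by auto
  define V where "V = ennreal (unit_ball_vol (real DIM('a)) * \<rho> ^ DIM('a))"
  define K where "K = K0 + ennreal (Fr c powr (-r)) * V"
  have K: "K < \<infinity>" using K0 by (simp add: K_def V_def ennreal_mult_less_top)
  have K_le: "(\<integral>\<^sup>+x. ennreal (\<psi> x) * indicator (ball y \<rho>) x \<partial>lborel) \<le> K" for y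
  proof -
    have [measurable]: "ball y \<rho> \<in> sets borel" by simp
    let ?h = "\<lambda>x. ennreal (\<psi> x) * indicator (ball y \<rho>) x"
    have "(\<integral>\<^sup>+x. ?h x \<partial>lborel)
      = (\<integral>\<^sup>+x. ?h x * indicator {x. \<phi>' x \<ge> c} x + ?h x * indicator {x. \<phi>' x < c} x \<partial>lborel)"
      by (intro nn_integral_cong) (auto simp: indicator_def)
    also have "\<dots> = (\<integral>\<^sup>+x. ?h x * indicator {x. \<phi>' x \<ge> c} x \<partial>lborel)
        + (\<integral>\<^sup>+x. ?h x * indicator {x. \<phi>' x < c} x \<partial>lborel)"
      by (intro nn_integral_add) measurable
    also have "\<dots> \<le> (\<integral>\<^sup>+x. ennreal \<bar>F_neg_pow f r (\<phi> x)\<bar> * indicator (ball y \<rho>) x \<partial>lborel)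
        + (\<integral>\<^sup>+x. ennreal (Fr c powr (-r)) * indicator (ball y \<rho>) x \<partial>lborel)"
    proof (intro add_mono nn_integral_mono_AE)
      show "AE x in lborel. ?h x * indicator {x. c \<le> \<phi>' x} x \<le> ennreal \<bar>F_neg_pow f r (\<phi> x)\<bar> * indicator (ball y \<rho>) x"
        using ae by eventually_elim
          (use c0 in \<open>auto simp: indicator_def \<psi>_def max_absorb1 F_neg_pow_eq\<close>)
      show "AE x in lborel. ?h x * indicator {x. \<phi>' x < c} x \<le> ennreal (Fr c powr (-r)) * indicator (ball y \<rho>) x"
        by (auto simp: indicator_def \<psi>_def max_absorb2)
    qed
    also have "(\<integral>\<^sup>+x. ennreal (Fr c powr (-r)) * indicator (ball y \<rho>) x \<partial>lborel) = ennreal (Fr c powr (-r)) * V"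
      using \<rho> by (simp add: nn_integral_cmult_indicator emeasure_ball V_def)
    also have "(\<integral>\<^sup>+x. ennreal \<bar>F_neg_pow f r (\<phi> x)\<bar> * indicator (ball y \<rho>) x \<partial>lborel) + ennreal (Fr c powr (-r)) * V \<le> K"
      unfolding K_def K0_def
      by (intro add_right_mono SUP_upper2[of y]) (simp_all add: nn_integral_completion)
    finally show ?thesis .
  qed
  obtain C where C: "C > 0" "\<And>t x. 0 < t \<Longrightarrow> t \<le> 1 \<Longrightarrow> S \<theta> t (\<lambda>y. ennreal (\<psi> y)) x \<le> ennreal (C * t powr (- (DIM('a) / \<theta>)))"
    using S_le_uniformly_local[OF \<theta> \<rho>, of "\<lambda>y. ennreal (\<psi> y)" K] K K_le by auto
  \<comment> \<open>Chosen so that \<open>Fr (v t) powr (-r)\<close> equals the smoothing bound on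
    the average of \<psi>; see \<open>br\<close>, where \<open>\<alpha> * r\<close> equals N /
    \<theta>.\<close>
  define b where "b = C powr (- 1 / r)"
  have b: "b > 0" using C by (simp add: b_def)
  have br: "(b * t powr \<alpha>) powr (-r) = C * t powr (- (DIM('a) / \<theta>))" if "t > 0" for t
    using C r0 that by (simp add: powr_mult b_def powr_powr \<alpha>r)
  define k where "k = f c * Fr c powr (1 - \<epsilon>)"
  have k: "k > 0" using pos[OF c0] Fc by (simp add: k_def)
  define L where "L = f c * Fr c"
  have L: "L > 0" using pos[OF c0] Fc by (simp add: L_def)
  let ?S = "\<lambda>t x. S \<theta> t (\<lambda>y. ennreal (\<phi>' y)) x"
  let ?A = "2 * L / b / (1 - \<alpha>)"
  define D where "D = (?A) / (k / 2 * b powr \<epsilon>)"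
  have D: "D > 0" using L b \<alpha> k by (simp add: D_def)
  \<comment> \<open>In turn: the smoothing estimate applies, v and w lie beyond c, and the Duhamel
    term fits into the gap between them, D being the ratio of the two constants.\<close>
  have "\<forall>\<^sub>F t in at_right 0. t powr 1 < 1 \<and> t powr \<alpha> < Fr c / b \<and> t powr \<eta> < 1 / D"
    using \<alpha> \<eta> b Fc D by (intro eventually_conj eventually_at_right_powr_less) auto
  then obtain T where T: "T > 0" and small: "\<And>t. 0 < t \<Longrightarrow> t < T \<Longrightarrow> t powr 1 < 1 \<and> t powr \<alpha> < Fr c / b \<and> t powr \<eta> < 1 / D"
    unfolding eventually_at_right_field by auto
  define v where "v t = Finv (b * t powr \<alpha>)" for t
  define w where "w t = Finv (b * t powr \<alpha> / 2)" for t
  have v: "v t \<ge> c" "Fr (v t) = b * t powr \<alpha>" and w: "w t \<ge> c" "Fr (w t) = b * t powr \<alpha> / 2" and vw: "v t \<le> w t"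
    if "0 < t" "t < T" for t
  proof -
    have p: "0 < b * t powr \<alpha>" "b * t powr \<alpha> \<le> Fr c" using small[OF that] b that by (auto simp: field_simps)
    show v: "v t \<ge> c" "Fr (v t) = b * t powr \<alpha>" using Finv[OF c0 p] by (auto simp: v_def)
    have p': "0 < b * t powr \<alpha> / 2" "b * t powr \<alpha> / 2 \<le> Fr c" using p by auto
    show w: "w t \<ge> c" "Fr (w t) = b * t powr \<alpha> / 2" using Finv[OF c0 p'] by (auto simp: w_def)
    show "v t \<le> w t" using v w c0 p Fr_le_iff[of "w t" "v t"] by auto
  qed
  have S_v: "?S t x \<le> ennreal (v t)" if t: "0 < t" "t < T" for t x
  proof -
    have "?S t x \<le> S \<theta> t (\<lambda>y. ennreal (max (\<phi>' y) c)) x"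
      by (intro S_mono ennreal_leI) simp
    also have "\<dots> \<le> ennreal (v t)"
    proof (rule S_le_of_tangent[OF \<theta> t(1)])
      let ?m = "r * Fr (v t) powr (- r - 1) / f (v t)"
      have vt: "v t > 0" using v[OF t] c0 by simp
      show "?m > 0" using r0 Fr_pos[OF vt] pos[OF vt] by simp
      show "S \<theta> t (\<lambda>y. ennreal (\<psi> y)) x \<le> ennreal (Fr (v t) powr (-r))"
        unfolding v(2)[OF t] br[OF t(1)] by (rule C(2)) (use t small[OF t] in auto)
      show "?m * max (\<phi>' y) c + Fr (v t) powr (-r) \<le> ?m * v t + \<psi> y" for y
        using Fr_neg_powr_tangent[OF c0 c1 r0, of "v t" "max (\<phi>' y) c"] v[OF t]
        unfolding \<psi>_def right_diff_distrib by linarith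
    qed (use c0 v[OF t] in \<open>auto simp: \<psi>_def le_max_iff_disj\<close>)
    finally show ?thesis .
  qed
  \<comment> \<open>By choice of w, \<open>Fr (v t) - Fr (w t)\<close> is half of
    \<open>Fr (v t)\<close>. The mean value bound then gives a gap of at least
    \<open>f (v t) * Fr (v t) / 2\<close>, and \<open>f_Fr_powr_mono\<close> bounds this below by a
    multiple of \<open>t powr (\<alpha> * \<epsilon>)\<close>.\<close>
  have gap: "v t + ?A * t powr (1 - \<alpha>) \<le> w t" if t: "0 < t" "t < T" for t
  proof -
    have vt: "v t > 0" using v[OF t] c0 by simp
    have "k \<le> f (v t) * Fr (v t) powr (1 - \<epsilon>)"
      unfolding k_def using f_Fr_powr_mono[OF c0 c2 order_refl v(1)[OF t]] .
    then have "k * Fr (v t) powr \<epsilon> \<le> f (v t) * Fr (v t) powr (1 - \<epsilon>) * Fr (v t) powr \<epsilon>"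
      by (rule mult_right_mono) simp
    also have "\<dots> = f (v t) * Fr (v t)"
      using Fr_pos[OF vt] powr_add[of "Fr (v t)" "1 - \<epsilon>" \<epsilon>] by simp
    also have "\<dots> = 2 * (f (v t) * (Fr (v t) - Fr (w t)))" using v[OF t] w[OF t] by simp
    also have "f (v t) * (Fr (v t) - Fr (w t)) \<le> w t - v t"
      using Fr_diff_ge(2)[OF vt vw[OF t]] pos[OF vt] by (simp add: field_simps)
    finally have "k / 2 * Fr (v t) powr \<epsilon> \<le> w t - v t" by simp
    moreover have "Fr (v t) powr \<epsilon> = b powr \<epsilon> * t powr (\<alpha> * \<epsilon>)"
      unfolding v(2)[OF t] using b t by (simp add: powr_mult powr_powr)
    moreover have "?A * t powr (1 - \<alpha>) \<le> k / 2 * b powr \<epsilon> * t powr (\<alpha> * \<epsilon>)"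
    proof -
      have e1: "?A = D * (k / 2 * b powr \<epsilon>)" using k b by (simp add: D_def)
      have e2: "t powr (1 - \<alpha>) = t powr \<eta> * t powr (\<alpha> * \<epsilon>)" unfolding \<eta>(2) by (rule powr_add)
      have "D * t powr \<eta> \<le> 1" using small[OF t] D by (simp add: field_simps)
      then have "(D * t powr \<eta>) * (k / 2 * b powr \<epsilon> * t powr (\<alpha> * \<epsilon>)) \<le> 1 * (k / 2 * b powr \<epsilon> * t powr (\<alpha> * \<epsilon>))"
        using k by (intro mult_right_mono) auto
      moreover have "?A * t powr (1 - \<alpha>) = (D * t powr \<eta>) * (k / 2 * b powr \<epsilon> * t powr (\<alpha> * \<epsilon>))"
        unfolding e1 e2 by (simp only: mult_ac)
      ultimately show ?thesis by (simp only: mult_1_left)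
    qed
    ultimately have "?A * t powr (1 - \<alpha>) \<le> w t - v t" by (simp only: mult.assoc)
    then show ?thesis by linarith
  qed
  \<comment> \<open>Since \<open>f * Fr\<close> is at most L beyond c, \<open>f (w s)\<close> is at
    most \<open>L / Fr (w s)\<close>, which is this expression. It is integrable at 0 because
    \<alpha> < 1, that is r > N / \<theta>.\<close>
  define g where "g s = ennreal (2 * L / b) * ennreal (s powr (- \<alpha>))" for s
  have f_le_g: "ennreal (f u) \<le> g s" if s: "0 < s" "s < T" and u: "0 \<le> u" "u \<le> w s" for s u
  proof -
    have "f u \<le> f (w s)" by (rule f_mono[OF u])
    moreover have "f (w s) * Fr (w s) \<le> L"
      unfolding L_def by (rule fF_antimono[OF c0 c1 order_refl w(1)[OF s]])
    then have "f (w s) \<le> 2 * L / b * s powr (- \<alpha>)"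
      unfolding w(2)[OF s] using b s by (simp add: powr_minus field_simps)
    ultimately show ?thesis unfolding g_def using L b by (simp add: ennreal_mult[symmetric] ennreal_leI)
  qed
  have w_ge: "?S t x + (\<integral>\<^sup>+s\<in>{0<..<t}. g s \<partial>lborel) \<le> ennreal (w t)" if t: "0 < t" "t < T" for t x
  proof -
    have "(\<integral>\<^sup>+s\<in>{0<..<t}. g s \<partial>lborel) \<le> (\<integral>\<^sup>+s. ennreal (2 * L / b) * (ennreal (s powr (- \<alpha>)) * indicator {0..t} s) \<partial>lborel)"
      by (intro nn_integral_mono) (auto simp: g_def indicator_def)
    also have "\<dots> = ennreal (2 * L / b) * (\<integral>\<^sup>+s. ennreal (s powr (- \<alpha>)) * indicator {0..t} s \<partial>lborel)"
      by (rule nn_integral_cmult) measurable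
    also have "\<dots> = ennreal (?A * t powr (1 - \<alpha>))"
      using nn_integral_powr_Icc[of "- \<alpha>" t] \<alpha> t L b by (simp add: ennreal_mult[symmetric] add.commute)
    finally have I: "(\<integral>\<^sup>+s\<in>{0<..<t}. g s \<partial>lborel) \<le> ennreal (?A * t powr (1 - \<alpha>))" .
    have "?S t x + (\<integral>\<^sup>+s\<in>{0<..<t}. g s \<partial>lborel) \<le> ennreal (v t) + ennreal (?A * t powr (1 - \<alpha>))"
      by (intro add_mono S_v I t)
    also have "\<dots> = ennreal (v t + ?A * t powr (1 - \<alpha>))"
      using v[OF t] c0 L b \<alpha> by (intro ennreal_plus[symmetric]) auto
    also have "\<dots> \<le> ennreal (w t)" by (intro ennreal_leI gap t)
    finally show ?thesis .
  qed
  have w0: "w t \<ge> 0" if "0 < t" "t < T" for t using w(1)[OF that] c0 by simp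
  obtain U where "(\<lambda>(x, t). U x t) \<in> borel_measurable (borel \<Otimes>\<^sub>M borel)"
    "\<And>x t. 0 < t \<Longrightarrow> t < T \<Longrightarrow> U x t < \<infinity>"
    "\<And>x t. 0 < t \<Longrightarrow> t < T \<Longrightarrow> duhamel \<theta> \<phi>' U x t = U x t"
    using duhamel_fixed_point[OF \<theta> \<open>\<phi>' \<in> _\<close> w0 f_le_g w_ge] by blast
  then show ?thesis by (rule has_local_solution_of_duhamel[OF T ae])
qed

end

section \<open>Lifespan of solutions\<close>

lemma AE_lborel_prod_swap:
  fixes P :: "'a::euclidean_space \<times> real \<Rightarrow> bool"
  assumes "AE z in lborel. P z"
  shows "AE t in lborel. AE x in lborel. P (x, t)"
proof -
  have "AE z in (lborel :: 'a measure) \<Otimes>\<^sub>M (lborel :: real measure). P z"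
    using assms by (simp only: lborel_prod)
  then obtain N where N: "{z \<in> space (lborel \<Otimes>\<^sub>M lborel). \<not> P z} \<subseteq> N" "N \<in> sets ((lborel :: 'a measure) \<Otimes>\<^sub>M (lborel :: real measure))" "emeasure (lborel \<Otimes>\<^sub>M lborel) N = 0"
    by (rule AE_E)
  have "AE z in lborel \<Otimes>\<^sub>M lborel. z \<notin> N" using N by (intro AE_not_in) auto
  then have ae: "AE x in lborel. AE t in lborel. (x, t) \<notin> N" by (rule lborel_pair.AE_pair)
  have "{z \<in> space (lborel \<Otimes>\<^sub>M lborel). (fst z, snd z) \<notin> N} = space (lborel \<Otimes>\<^sub>M lborel) - N" by auto
  then have "{z \<in> space (lborel \<Otimes>\<^sub>M lborel). (fst z, snd z) \<notin> N} \<in> sets ((lborel :: 'a measure) \<Otimes>\<^sub>M (lborel :: real measure))"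
    using sets.compl_sets[OF N(2)] by (simp only:)
  from lborel_pair.AE_commute[of "\<lambda>x t. (x, t) \<notin> N", OF this] ae
  have "AE t in lborel. AE x in lborel. (x, t) \<notin> N" by blast
  then show ?thesis
  proof eventually_elim
    case (elim t)
    then show ?case by eventually_elim (use N(1) in \<open>auto simp: space_pair_measure\<close>)
  qed
qed

context nonlinearity
begin

lemma duhamel_cong_AE:
  assumes "AE s in lborel. 0 < s \<longrightarrow> s < t \<longrightarrow> (AE y in lborel. fe (U y s) = fe (V y s))"
  shows "duhamel \<theta> \<phi> U x t = duhamel \<theta> \<phi> V x t"
proof -
  have "(\<integral>\<^sup>+s\<in>{0<..<t}. S \<theta> (t - s) (\<lambda>y. fe (U y s)) x \<partial>lborel) = (\<integral>\<^sup>+s\<in>{0<..<t}. S \<theta> (t - s) (\<lambda>y. fe (V y s)) x \<partial>lborel)"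
  proof (rule nn_integral_cong_AE)
    show "AE s in lborel. S \<theta> (t - s) (\<lambda>y. fe (U y s)) x * indicator {0<..<t} s = S \<theta> (t - s) (\<lambda>y. fe (V y s)) x * indicator {0<..<t} s"
      using assms
    proof eventually_elim
      case (elim s)
      then show ?case by (cases "s \<in> {0<..<t}") (auto intro!: S_cong_AE)
    qed
  qed
  then show ?thesis by (simp add: duhamel_def)
qed

text \<open>
  A solution is only Lebesgue measurable; the right-hand side of its integral equation, computed
  from a Borel version, is a Borel solution for which the equation holds at every point.
\<close>

lemma duhamel_of_integral_solution:
  fixes \<phi> :: "'a::euclidean_space \<Rightarrow> real"
  assumes sol: "integral_solution \<theta> f \<phi> T u" and [measurable]: "\<phi> \<in> borel_measurable borel"
  obtains V where "(\<lambda>(x, t). V x t) \<in> borel_measurable (borel \<Otimes>\<^sub>M borel)"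
    "\<And>t. 0 < t \<Longrightarrow> t < T \<Longrightarrow> AE x in lborel. V x t < \<infinity>"
    "\<And>x t. 0 < t \<Longrightarrow> t < T \<Longrightarrow> V x t = duhamel \<theta> \<phi> V x t"
proof -
  let ?S = "\<lambda>u t x s. S \<theta> (t - s) (\<lambda>y. ennreal (f (u y s))) x"
  have um: "(\<lambda>(x, t). u x t) \<in> borel_measurable (lebesgue_on (UNIV \<times> {0<..<T}))"
    and u0: "\<And>x t. 0 < t \<Longrightarrow> t < T \<Longrightarrow> 0 \<le> u x t"
    and eq: "\<And>t. 0 < t \<Longrightarrow> t < T \<Longrightarrow> AE x in lborel. ennreal (u x t) = S \<theta> t (\<lambda>y. ennreal (\<phi> y)) x +
          (\<integral>\<^sup>+s\<in>{0<..<t}. ?S u t x s \<partial>lborel)"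
    using sol unfolding integral_solution_def by (auto simp: AE_completion_iff nn_integral_completion)
  have "open (UNIV \<times> {0<..<T} :: ('a \<times> real) set)" by (intro open_Times) auto
  then have "UNIV \<times> {0<..<T} \<in> sets (lebesgue :: ('a \<times> real) measure)" by (intro sets_completionI_sets) auto
  then have "(\<lambda>z. indicator (UNIV \<times> {0<..<T}) z *\<^sub>R (case z of (x, t) \<Rightarrow> u x t)) \<in> borel_measurable (lebesgue :: ('a \<times> real) measure)"
    using um by (subst (asm) borel_measurable_restrict_space_iff) auto
  then obtain u' where u': "u' \<in> borel_measurable (lborel :: ('a \<times> real) measure)"
    and ae: "AE z in lborel. indicator (UNIV \<times> {0<..<T}) z *\<^sub>R (case z of (x, t) \<Rightarrow> u x t) = u' z"
    using completion_ex_borel_measurable_real by blast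
  define U where "U x t = ennreal (u' (x, t))" for x t
  have u'm[measurable]: "u' \<in> borel_measurable (borel \<Otimes>\<^sub>M borel)" using u' by (simp add: borel_prod)
  have [measurable]: "(\<lambda>(x, t). U x t) \<in> borel_measurable (borel \<Otimes>\<^sub>M borel)" unfolding U_def by measurable
  define V where "V = duhamel \<theta> \<phi> U"
  have V: "(\<lambda>(x, t). V x t) \<in> borel_measurable (borel \<Otimes>\<^sub>M borel)"
    unfolding V_def by (rule borel_measurable_duhamel) measurable
  have aes: "AE s in lborel. 0 < s \<longrightarrow> s < T \<longrightarrow> (AE y in lborel. ennreal (u y s) = U y s)"
    using AE_lborel_prod_swap[OF ae]
  proof eventually_elim
    case (elim s)
    show ?case
    proof (intro impI)
      assume "0 < s" "s < T"
      with elim show "AE y in lborel. ennreal (u y s) = U y s"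
        by (auto simp: U_def elim!: eventually_mono)
    qed
  qed
  \<comment> \<open>This holds for every t: the equation for u is required at every t, and its time
    integral does not see the null set of times at which u and \<open>U\<close> differ on more than
    a null set.\<close>
  have V_u: "AE x in lborel. ennreal (u x t) = V x t" if t: "0 < t" "t < T" for t
  proof -
    have "(\<integral>\<^sup>+s\<in>{0<..<t}. ?S u t x s \<partial>lborel) = (\<integral>\<^sup>+s\<in>{0<..<t}. S \<theta> (t - s) (\<lambda>y. fe (U y s)) x \<partial>lborel)" for x
    proof (rule nn_integral_cong_AE)
      show "AE s in lborel. ?S u t x s * indicator {0<..<t} s = S \<theta> (t - s) (\<lambda>y. fe (U y s)) x * indicator {0<..<t} s"
        using aes
      proof eventually_elim
        case (elim s)
        show ?case
        proof (cases "s \<in> {0<..<t}")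
          case True
          then have s: "0 < s" "s < T" using t by auto
          have "AE y in lborel. ennreal (u y s) = U y s" using elim s by blast
          then have "?S u t x s = S \<theta> (t - s) (\<lambda>y. fe (U y s)) x"
            by (intro S_cong_AE, elim eventually_mono) (metis enn2real_ennreal fe_def u0 s)
          then show ?thesis by simp
        qed simp
      qed
    qed
    then show ?thesis using eq[OF t] by (simp add: V_def duhamel_def)
  qed
  show ?thesis
  proof (rule that[OF V])
    fix t assume t: "0 < t" "t < T"
    show "AE x in lborel. V x t < \<infinity>"
      using V_u[OF t]
    proof eventually_elim
      case (elim x)
      show ?case unfolding elim[symmetric] by simp
    qed
    have "AE s in lborel. 0 < s \<longrightarrow> s < t \<longrightarrow> (AE y in lborel. fe (U y s) = fe (V y s))"
      using aes
    proof eventually_elim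
      case (elim s)
      show ?case
      proof (intro impI)
        assume s: "0 < s" "s < t"
        then have "AE y in lborel. ennreal (u y s) = U y s" using elim t by auto
        moreover have "AE y in lborel. ennreal (u y s) = V y s" using V_u s t by auto
        ultimately show "AE y in lborel. fe (U y s) = fe (V y s)" by eventually_elim simp
      qed
    qed
    then have "duhamel \<theta> \<phi> U x t = duhamel \<theta> \<phi> V x t" for x by (rule duhamel_cong_AE)
    then show "V x t = duhamel \<theta> \<phi> V x t" for x by (simp add: V_def)
  qed
qed

text \<open>
  Discrete form of \<open>z' \<ge> f z \<Longrightarrow> (F z)' \<le> -1\<close>. With \<open>x \<ge> 1 + ln x\<close> applied to the ratios
  \<open>f (z\<^sub>k) / f (z\<^sub>k\<^sub>+\<^sub>1)\<close> the errors telescope, so that no regularity of \<open>z\<close> is needed.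
\<close>

lemma Fr_ge_lifespan:
  assumes T: "T > 0" and z0: "z 0 > 0"
    and z: "\<And>s s'. 0 \<le> s \<Longrightarrow> s < s' \<Longrightarrow> s' \<le> T \<Longrightarrow> z s + (s' - s) * f (z s) \<le> z s'"
  shows "T \<le> Fr (z 0)"
proof -
  let ?d = "ln (f (z 0)) - ln (f (z T))"
  have zpos: "z s > 0" if "0 \<le> s" "s \<le> T" for s
  proof (cases "s = 0")
    case False
    have "z 0 + s * f (z 0) \<le> z s" using z[of 0 s] that False by simp
    moreover have "s * f (z 0) \<ge> 0" using that pos[OF z0] by simp
    ultimately show ?thesis using z0 by linarith
  qed (use z0 in simp)
  have step: "T + (T / real n) * ?d \<le> Fr (z 0)" if n: "n > 0" for n :: nat
  proof -
    define h where "h = T / real n"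
    have h: "h > 0" "real n * h = T" using T n by (auto simp: h_def)
    have "h * (real k + ln (f (z 0)) - ln (f (z (real k * h)))) \<le> Fr (z 0) - Fr (z (real k * h))" if "k \<le> n" for k
      using that
    proof (induction k)
      case (Suc k)
      let ?a = "real k * h" and ?b = "real (Suc k) * h"
      have "real (Suc k) * h \<le> real n * h" using Suc.prems h by (intro mult_right_mono) auto
      then have ab: "0 \<le> ?a" "?a < ?b" "?b \<le> T" "?b - ?a = h" using h by (auto simp: algebra_simps)
      have za: "z ?a > 0" and zb: "z ?b > 0" using zpos ab by auto
      have fa: "f (z ?a) > 0" and fb: "f (z ?b) > 0" using pos za zb by auto
      have zz: "h * f (z ?a) \<le> z ?b - z ?a" using z[OF ab(1,2,3)] ab(4) by simp
      then have le: "z ?a \<le> z ?b" using h fa by (smt (verit) mult_pos_pos)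
      have "ln (f (z ?a) / f (z ?b)) \<le> f (z ?a) / f (z ?b) - 1" using fa fb by (intro ln_le_minus_one) simp
      then have "h * (1 + ln (f (z ?a)) - ln (f (z ?b))) \<le> h * (f (z ?a) / f (z ?b))"
        using h fa fb by (intro mult_left_mono) (auto simp: ln_div)
      also have "\<dots> \<le> (z ?b - z ?a) / f (z ?b)" using zz fb by (simp add: divide_right_mono)
      also have "\<dots> \<le> Fr (z ?a) - Fr (z ?b)" by (rule Fr_diff_ge(1)[OF za le])
      finally have "h * (1 + ln (f (z ?a)) - ln (f (z ?b))) \<le> Fr (z ?a) - Fr (z ?b)" .
      moreover have "h * (real k + ln (f (z 0)) - ln (f (z ?a))) \<le> Fr (z 0) - Fr (z ?a)" using Suc by simp
      moreover have "h * (real (Suc k) + ln (f (z 0)) - ln (f (z ?b))) = h * (1 + ln (f (z ?a)) - ln (f (z ?b))) + h * (real k + ln (f (z 0)) - ln (f (z ?a)))"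
        by (simp add: algebra_simps)
      ultimately show ?case by linarith
    qed simp
    from this[OF order_refl] have "h * (real n + ln (f (z 0)) - ln (f (z T))) \<le> Fr (z 0) - Fr (z T)"
      unfolding h(2) .
    moreover have "h * (real n + ln (f (z 0)) - ln (f (z T))) = T + h * ?d"
      using h(2) by (simp add: algebra_simps)
    ultimately show ?thesis using Fr_nonneg[of "z T"] unfolding h_def by linarith
  qed
  \<comment> \<open>The telescoped logarithms do not depend on n, so their weight T / n removes them
    in the limit.\<close>
  have "(\<lambda>n. T + (T * (1 / real n)) * ?d) \<longlonglongrightarrow> T + (T * 0) * ?d"
    by (intro tendsto_intros lim_1_over_n)
  then have L: "(\<lambda>n. T + (T * (1 / real n)) * ?d) \<longlonglongrightarrow> T" by simp
  show ?thesis
    by (rule LIMSEQ_le_const2[OF L]) (use step in \<open>auto intro!: exI[of _ 1]\<close>)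
qed

section \<open>Jensen's inequality along the backward flow and the lifespan bound\<close>

lemma f_tangent:
  assumes conv: "convex_on {0..} f" and "a > 0" "v \<ge> 0"
  shows "f a + deriv f a * (v - a) \<le> f v"
proof -
  have "deriv f a * (v - a) \<le> f v - f a"
  proof (rule convex_on_imp_above_tangent[OF conv])
    show "a \<in> interior {0..}" using assms by (simp add: interior_real_atLeast)
    show "(f has_real_derivative deriv f a) (at a within {0..})"
      using has_deriv[OF assms(2)] by (rule has_field_derivative_at_within)
  qed (use assms in auto)
  then show ?thesis by simp
qed

text \<open>The tangent of f at a is integrated against the kernel; its slope is nonnegative, so all
  terms can be arranged in \<open>ennreal\<close> without subtraction. Finiteness of V almost
  everywhere is required because \<open>fe\<close> sends infinity to \<open>f 0\<close>.\<close>

lemma S_jensen: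
  fixes V :: "'a::euclidean_space \<Rightarrow> ennreal"
  assumes \<theta>: "0 < \<theta>" "\<theta> \<le> 2" and t: "t > 0" and conv: "convex_on {0..} f"
    and [measurable]: "V \<in> borel_measurable borel" and fin: "AE y in lborel. V y < \<infinity>"
    and a: "S \<theta> t V x = ennreal a" "a > 0"
  shows "ennreal (f a) \<le> S \<theta> t (\<lambda>y. fe (V y)) x"
proof -
  define d where "d = deriv f a"
  have d: "d \<ge> 0" unfolding d_def by (rule deriv_nonneg[OF a(2)])
  have fa: "f a \<ge> 0" using pos[OF a(2)] by simp
  have "ennreal (d * a) + ennreal (f a) = ennreal (f a) + ennreal d * S \<theta> t V x"
    using d a by (simp add: ennreal_mult add.commute)
  also have "\<dots> = S \<theta> t (\<lambda>y. ennreal (f a) + ennreal d * V y) x"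
    by (simp add: S_add S_cmult S_const[OF \<theta> t])
  also have "\<dots> \<le> S \<theta> t (\<lambda>y. ennreal (d * a) + fe (V y)) x"
  proof (rule S_mono_AE)
    show "AE y in lborel. ennreal (f a) + ennreal d * V y \<le> ennreal (d * a) + fe (V y)"
      using fin
    proof eventually_elim
      case (elim y)
      define v where "v = enn2real (V y)"
      have v: "V y = ennreal v" "v \<ge> 0" using elim by (auto simp: v_def)
      have "f a + d * v \<le> d * a + f v"
        using f_tangent[OF conv a(2) v(2)] by (simp add: d_def algebra_simps)
      from ennreal_leI[OF this] show ?case
        using v d fa a f_nonneg[OF v(2)] by (simp add: fe_def ennreal_mult)
    qed
  qed
  also have "\<dots> = ennreal (d * a) + S \<theta> t (\<lambda>y. fe (V y)) x"
    by (simp add: S_add S_const[OF \<theta> t])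
  finally show ?thesis by (simp add: ennreal_add_left_cancel_le)
qed

text \<open>The semigroup law pushes \<open>S (t - s)\<close> through the integral equation at time
  s. The right-hand side depends on s only through the upper limit of integration, so it is monotone
  in s and its increments are explicit.\<close>

lemma S_duhamel:
  fixes \<phi> :: "'a::euclidean_space \<Rightarrow> real"
  assumes \<theta>: "0 < \<theta>" "\<theta> \<le> 2" and s: "0 < s" "s < t"
    and [measurable]: "\<phi> \<in> borel_measurable borel" "(\<lambda>(x, t). V x t) \<in> borel_measurable (borel \<Otimes>\<^sub>M borel)"
  shows "S \<theta> (t - s) (\<lambda>y. duhamel \<theta> \<phi> V y s) x = S \<theta> t (\<lambda>y. ennreal (\<phi> y)) x +
    (\<integral>\<^sup>+\<tau>\<in>{0<..<s}. S \<theta> (t - \<tau>) (\<lambda>y. fe (V y \<tau>)) x \<partial>lborel)"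
proof -
  let ?I = "\<lambda>y \<tau>. S \<theta> (s - \<tau>) (\<lambda>z. fe (V z \<tau>)) y * indicator {0<..<s} \<tau>"
  have ts: "t - s > 0" "t - s + s = t" using s by auto
  have "S \<theta> (t - s) (\<lambda>y. duhamel \<theta> \<phi> V y s) x = S \<theta> (t - s) (S \<theta> s (\<lambda>y. ennreal (\<phi> y))) x +
    S \<theta> (t - s) (\<lambda>y. \<integral>\<^sup>+\<tau>\<in>{0<..<s}. S \<theta> (s - \<tau>) (\<lambda>z. fe (V z \<tau>)) y \<partial>lborel) x"
    unfolding duhamel_def by (intro S_add) measurable
  also have "S \<theta> (t - s) (S \<theta> s (\<lambda>y. ennreal (\<phi> y))) x = S \<theta> t (\<lambda>y. ennreal (\<phi> y)) x"
    using S_semigroup[OF \<theta> ts(1) s(1), of "\<lambda>y. ennreal (\<phi> y)" x] ts by simp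
  also have "S \<theta> (t - s) (\<lambda>y. \<integral>\<^sup>+\<tau>\<in>{0<..<s}. S \<theta> (s - \<tau>) (\<lambda>z. fe (V z \<tau>)) y \<partial>lborel) x
    = (\<integral>\<^sup>+\<tau>\<in>{0<..<s}. S \<theta> (t - \<tau>) (\<lambda>y. fe (V y \<tau>)) x \<partial>lborel)"
  proof -
    have "S \<theta> (t - s) (\<lambda>y. \<integral>\<^sup>+\<tau>\<in>{0<..<s}. S \<theta> (s - \<tau>) (\<lambda>z. fe (V z \<tau>)) y \<partial>lborel) x
      = (\<integral>\<^sup>+y. (\<integral>\<^sup>+\<tau>. ennreal (G \<theta> (x - y) (t - s)) * ?I y \<tau> \<partial>lborel) \<partial>lborel)"
      by (subst S_eq, intro nn_integral_cong nn_integral_cmult[symmetric]) measurable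
    also have "\<dots> = (\<integral>\<^sup>+\<tau>. (\<integral>\<^sup>+y. ennreal (G \<theta> (x - y) (t - s)) * ?I y \<tau> \<partial>lborel) \<partial>lborel)"
      by (rule lborel_pair.Fubini'[symmetric]) measurable
    also have "\<dots> = (\<integral>\<^sup>+\<tau>\<in>{0<..<s}. S \<theta> (t - \<tau>) (\<lambda>y. fe (V y \<tau>)) x \<partial>lborel)"
    proof (intro nn_integral_cong)
      fix \<tau> :: real
      show "(\<integral>\<^sup>+y. ennreal (G \<theta> (x - y) (t - s)) * ?I y \<tau> \<partial>lborel) = S \<theta> (t - \<tau>) (\<lambda>y. fe (V y \<tau>)) x * indicator {0<..<s} \<tau>"
      proof (cases "\<tau> \<in> {0<..<s}")
        case True
        then have "(\<integral>\<^sup>+y. ennreal (G \<theta> (x - y) (t - s)) * ?I y \<tau> \<partial>lborel)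
          = S \<theta> (t - s) (S \<theta> (s - \<tau>) (\<lambda>z. fe (V z \<tau>))) x" by (simp add: S_eq)
        also have "\<dots> = S \<theta> (t - s + (s - \<tau>)) (\<lambda>z. fe (V z \<tau>)) x"
          using True by (intro S_semigroup \<theta> ts) auto
        finally show ?thesis using True by simp
      qed simp
    qed
    finally show ?thesis .
  qed
  finally show ?thesis .
qed

text \<open>The space-time point (x, t) is fixed, and only finiteness of V at this one point keeps
  the comparison function finite. Jensen's inequality bounds the integrand below by f of the
  comparison function, and \<open>Fr_ge_lifespan\<close> applies.\<close>

lemma lifespan_bound:
  fixes \<phi> :: "'a::euclidean_space \<Rightarrow> real"
  assumes \<theta>: "0 < \<theta>" "\<theta> \<le> 2" and conv: "convex_on {0..} f"
    and [measurable]: "\<phi> \<in> borel_measurable borel" "(\<lambda>(x, t). V x t) \<in> borel_measurable (borel \<Otimes>\<^sub>M borel)"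
    and V: "\<And>t. 0 < t \<Longrightarrow> t < T \<Longrightarrow> AE x in lborel. V x t < \<infinity>"
      "\<And>x t. 0 < t \<Longrightarrow> t < T \<Longrightarrow> V x t = duhamel \<theta> \<phi> V x t"
    and t: "0 < t" "t < T" and fin: "V x t < \<infinity>"
    and a: "S \<theta> t (\<lambda>y. ennreal (\<phi> y)) x = ennreal a" "a > 0"
  shows "t \<le> Fr a"
proof -
  define I where "I \<tau> = S \<theta> (t - \<tau>) (\<lambda>y. fe (V y \<tau>)) x" for \<tau>
  have [measurable]: "I \<in> borel_measurable borel" unfolding I_def by measurable
  \<comment> \<open>For 0 < s < t this is \<open>S (t - s)\<close> applied to V at time s, by
    \<open>S_duhamel\<close>. The formula also covers both ends: it is a at s = 0 and
    \<open>V x t\<close> at s = t.\<close>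
  define Z where "Z s = ennreal a + (\<integral>\<^sup>+\<tau>\<in>{0<..<s}. I \<tau> \<partial>lborel)" for s
  define z where "z s = enn2real (Z s)" for s
  have Zmono: "Z s \<le> Z s'" if "s \<le> s'" for s s'
    unfolding Z_def using that by (intro add_left_mono nn_integral_mono) (auto simp: indicator_def)
  have "Z t = V x t" unfolding V(2)[OF t] Z_def duhamel_def a(1) I_def ..
  then have Zfin: "Z s < \<infinity>" if "s \<le> t" for s
    using Zmono[OF that] fin by (simp add: order_le_less_trans)
  have Zz: "Z s = ennreal (z s)" if "s \<le> t" for s using Zfin[OF that] by (simp add: z_def)
  have az: "a \<le> z s" if "s \<le> t" for s
  proof -
    have "ennreal a \<le> ennreal (z s)" unfolding Zz[OF that, symmetric] by (simp add: Z_def)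
    then show ?thesis using a(2) by (subst (asm) ennreal_le_iff) (auto simp: z_def)
  qed
  have zpos: "z s > 0" if "s \<le> t" for s using az[OF that] a(2) by simp
  have z_0: "z 0 = a" using a(2) by (simp add: z_def Z_def)
  have jensen: "ennreal (f (z \<tau>)) \<le> I \<tau>" if \<tau>: "0 < \<tau>" "\<tau> < t" for \<tau>
    unfolding I_def
  proof (rule S_jensen[OF \<theta> _ conv])
    have \<tau>T: "\<tau> < T" using \<tau> t by simp
    show "AE y in lborel. V y \<tau> < \<infinity>" by (rule V(1)[OF \<tau>(1) \<tau>T])
    have "S \<theta> (t - \<tau>) (\<lambda>y. V y \<tau>) x = S \<theta> (t - \<tau>) (\<lambda>y. duhamel \<theta> \<phi> V y \<tau>) x"
      using V(2)[OF \<tau>(1) \<tau>T] by simp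
    also have "\<dots> = Z \<tau>" unfolding S_duhamel[OF \<theta> \<tau> \<open>\<phi> \<in> _\<close> \<open>(\<lambda>(x, t). V x t) \<in> _\<close>] Z_def I_def a(1) ..
    finally show "S \<theta> (t - \<tau>) (\<lambda>y. V y \<tau>) x = ennreal (z \<tau>)" using Zz \<tau> by simp
  qed (use \<tau> zpos in auto)
  \<comment> \<open>Over (s, s') the integrand dominates f of z, which is at least
    \<open>f (z s)\<close> because z and f are both nondecreasing.\<close>
  have growth: "z s + (s' - s) * f (z s) \<le> z s'" if s: "0 \<le> s" "s < s'" "s' \<le> t" for s s'
  proof -
    have fz: "f (z s) > 0" using pos zpos s by simp
    have zm: "z s \<le> z \<tau>" if "s \<le> \<tau>" "\<tau> \<le> t" for \<tau>
      unfolding z_def using Zmono[OF that(1)] Zfin[OF that(2)] by (intro enn2real_mono) auto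
    have "Z s + ennreal ((s' - s) * f (z s)) = ennreal a + ((\<integral>\<^sup>+\<tau>\<in>{0<..<s}. I \<tau> \<partial>lborel) + (\<integral>\<^sup>+\<tau>. ennreal (f (z s)) * indicator {s<..<s'} \<tau> \<partial>lborel))"
      using s fz by (simp add: Z_def nn_integral_cmult_indicator ennreal_mult add.assoc mult.commute)
    also have "(\<integral>\<^sup>+\<tau>\<in>{0<..<s}. I \<tau> \<partial>lborel) + (\<integral>\<^sup>+\<tau>. ennreal (f (z s)) * indicator {s<..<s'} \<tau> \<partial>lborel)
       = (\<integral>\<^sup>+\<tau>. I \<tau> * indicator {0<..<s} \<tau> + ennreal (f (z s)) * indicator {s<..<s'} \<tau> \<partial>lborel)"
      by (intro nn_integral_add[symmetric]) measurable
    also have "\<dots> \<le> (\<integral>\<^sup>+\<tau>\<in>{0<..<s'}. I \<tau> \<partial>lborel)"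
    proof (intro nn_integral_mono)
      fix \<tau> :: real
      have "ennreal (f (z s)) \<le> I \<tau>" if "s < \<tau>" "\<tau> < s'"
      proof -
        have "f (z s) \<le> f (z \<tau>)" using zm that s zpos[of s] by (intro f_mono) auto
        then show ?thesis using jensen[of \<tau>] that s by (meson ennreal_leI order_trans le_less_trans less_le_trans)
      qed
      then show "I \<tau> * indicator {0<..<s} \<tau> + ennreal (f (z s)) * indicator {s<..<s'} \<tau> \<le> I \<tau> * indicator {0<..<s'} \<tau>"
        using s by (auto simp: indicator_def)
    qed
    finally have "Z s + ennreal ((s' - s) * f (z s)) \<le> Z s'" by (simp add: Z_def add_left_mono)
    then show ?thesis
      using s fz Zz[of s] Zz[of s'] zpos[of s] zpos[of s']
      by (simp add: ennreal_plus[symmetric] del: ennreal_plus)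
  qed
  show ?thesis using Fr_ge_lifespan[of t z] t growth a z_0 by simp
qed

section \<open>Nonexistence\<close>

lemma nonexistence:
  fixes \<rho> r :: real
  assumes \<theta>: "0 < \<theta>" "\<theta> \<le> 2" and \<rho>: "\<rho> > 0" and conv: "convex_on {0..} f"
    and r: "0 < r" "r < DIM('a::euclidean_space) / \<theta>"
  shows "\<exists>\<phi> :: 'a \<Rightarrow> real. \<phi> \<in> borel_measurable lebesgue \<and> (\<forall>x. 0 \<le> \<phi> x) \<and>
    (\<lambda>x. F_neg_pow f r (\<phi> x)) \<in> L1_ul \<rho> \<and> \<not> has_local_solution \<theta> f \<phi>"
proof -
  have "\<theta> < DIM('a) / r" using r \<theta> by (simp add: field_simps)
  \<comment> \<open>The upper bound makes \<open>norm x powr (- (\<beta> * r))\<close> locally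
    integrable; the lower bound makes the singularity too strong for a solution.\<close>
  then obtain \<beta> where \<beta>: "\<theta> < \<beta>" "\<beta> < DIM('a) / r" using dense by blast
  then have \<beta>r: "\<beta> * r < DIM('a)" using r by (simp add: field_simps)
  have \<beta>0: "\<beta> > 0" using \<beta> \<theta> by simp
  \<comment> \<open>Then \<kappa> is half of \<beta> - \<theta>, so \<theta> + \<kappa> lies midway
    between \<theta> and \<beta>, and the exponent \<gamma> exceeds 1.\<close>
  define \<epsilon> where "\<epsilon> = (\<beta> - \<theta>) / (2 * \<beta>)"
  have \<epsilon>: "\<epsilon> > 0" using \<beta> \<beta>0 by (simp add: \<epsilon>_def)
  define \<kappa> where "\<kappa> = \<beta> * \<epsilon>"
  have \<kappa>: "\<kappa> > 0" "\<theta> + \<kappa> < \<beta>" using \<beta> \<beta>0 \<epsilon> by (auto simp: \<kappa>_def \<epsilon>_def field_simps)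
  define \<gamma> where "\<gamma> = \<beta> / (\<theta> + \<kappa>)"
  have \<gamma>: "\<gamma> > 1" using \<kappa> \<theta> by (simp add: \<gamma>_def)
  have "\<forall>\<^sub>F u in at_top. deriv f u * Fr u > 1 - \<epsilon>"
    using order_tendstoD(1)[OF F_lim, of "1 - \<epsilon>"] \<epsilon> by (simp add: Fr_def)
  then have "\<forall>\<^sub>F u in at_top. u > 0 \<and> 1 - \<epsilon> \<le> deriv f u * Fr u"
    using eventually_gt_at_top[of 0] by eventually_elim auto
  then obtain c where c: "\<And>u. u \<ge> c \<Longrightarrow> u > 0 \<and> 1 - \<epsilon> \<le> deriv f u * Fr u"
    unfolding eventually_at_top_linorder by blast
  have c0: "c > 0" and c2: "\<And>u. u \<ge> c \<Longrightarrow> 1 - \<epsilon> \<le> deriv f u * Fr u"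
    using c by auto
  define P where "P = Fr c"
  have P: "P > 0" unfolding P_def by (rule Fr_pos[OF c0])
  \<comment> \<open>The cap P = \<open>Fr c\<close> keeps q in the domain of \<open>Finv\<close>,
    with values of \<phi> at least c. At the origin q is 0, which \<open>Fr\<close> does not attain
    on the positive reals, so \<phi> gets the harmless value c there.\<close>
  define q where "q x = min (norm x powr \<beta>) P" for x :: 'a
  define \<phi> where "\<phi> x = (if x = 0 then c else Finv (q x))" for x :: 'a
  have q: "0 < q x" "q x \<le> Fr c" if "x \<noteq> 0" for x using that P by (auto simp: q_def P_def)
  have \<phi>c: "\<phi> x \<ge> c" for x using Finv(1)[OF c0 q] by (simp add: \<phi>_def)
  have \<phi>pos: "\<phi> x > 0" for x using \<phi>c[of x] c0 by linarith
  have Fr_\<phi>: "Fr (\<phi> x) = q x" if "x \<noteq> 0" for x using Finv(2)[OF c0 q[OF that]] that by (simp add: \<phi>_def)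
  have Fr_\<phi>0: "Fr (\<phi> 0) = P" by (simp add: \<phi>_def P_def)
  have [measurable]: "q \<in> borel_measurable borel" unfolding q_def by measurable
  \<comment> \<open>As \<open>Fr\<close> is strictly decreasing, the superlevel sets of \<phi> are,
    off the origin, sublevel sets of q; no regularity of \<open>Finv\<close> is invoked.\<close>
  have [measurable]: "\<phi> \<in> borel_measurable borel"
  proof (rule borel_measurableI_greater)
    fix a :: real
    have "a < \<phi> x \<longleftrightarrow> a < c \<or> x \<noteq> 0 \<and> q x < Fr a" for x
    proof (cases "a < c")
      case True
      then show ?thesis using \<phi>c[of x] by auto
    next
      case False
      then have "a > 0" using c0 by simp
      then show ?thesis
        using False Fr_less_iff[OF \<phi>pos[of x], of a] Fr_\<phi>[of x] by (cases "x = 0") (auto simp: \<phi>_def)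
    qed
    then have "{x \<in> space borel. a < \<phi> x} = {x \<in> space borel. a < c \<or> x \<noteq> 0 \<and> q x < Fr a}" by simp
    also have "\<dots> \<in> sets borel" by measurable
    finally show "{x \<in> space borel. a < \<phi> x} \<in> sets borel" .
  qed
  have [measurable]: "(\<lambda>x. Fr (\<phi> x)) \<in> borel_measurable borel"
  proof -
    have "(\<lambda>x. Fr (max (\<phi> x) c)) \<in> borel_measurable borel"
      by (rule measurable_compose[OF _ borel_measurable_Fr_max[OF c0]]) measurable
    then show ?thesis using \<phi>c by (simp add: max_absorb1)
  qed
  define h where "h x = F_neg_pow f r (\<phi> x)" for x
  have h_eq: "h x = Fr (\<phi> x) powr (-r)" for x unfolding h_def by (rule F_neg_pow_eq[OF \<phi>pos])
  have [measurable]: "h \<in> borel_measurable borel" unfolding h_eq by measurable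
  define M where "M = 1 + P powr (-r)"
  have M: "M > 0" by (simp add: M_def add_pos_nonneg)
  define I0 where "I0 = (\<integral>\<^sup>+x. ennreal (norm (x::'a) powr (- (\<beta> * r))) * indicator (ball 0 1) x \<partial>lborel)"
  have I0: "I0 < \<infinity>" unfolding I0_def
    by (rule nn_integral_norm_powr_unit_ball) (use \<beta>0 r \<beta>r in auto)
  have h_le: "ennreal \<bar>h x\<bar> \<le> ennreal (norm x powr (- (\<beta> * r))) * indicator (ball 0 1) x + ennreal M" for x
  proof (cases "x = 0 \<or> norm x powr \<beta> \<ge> P")
    case True
    then have "Fr (\<phi> x) = P" using Fr_\<phi>0 Fr_\<phi>[of x] by (cases "x = 0") (auto simp: q_def)
    then have "ennreal \<bar>h x\<bar> \<le> ennreal M" by (intro ennreal_leI) (simp add: h_eq M_def)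
    then show ?thesis by (rule order_trans) simp
  next
    case False
    then have "h x = norm x powr (- (\<beta> * r))" by (simp add: h_eq Fr_\<phi> q_def powr_powr)
    moreover have "norm x powr (- (\<beta> * r)) \<le> M" if "norm x \<ge> 1"
    proof -
      have "norm x powr (- (\<beta> * r)) \<le> 1" using powr_mono[of "- (\<beta> * r)" 0 "norm x"] that \<beta>0 r by (auto split: if_splits)
      then show ?thesis by (simp add: M_def add_increasing2)
    qed
    ultimately show ?thesis by (cases "norm x < 1") (auto intro: ennreal_leI)
  qed
  have h_int: "(\<integral>\<^sup>+x. ennreal \<bar>h x\<bar> * indicator A x \<partial>lborel) \<le> I0 + ennreal M * emeasure lborel A"
    if A: "A \<in> sets borel" for A
  proof -
    have [measurable]: "A \<in> sets borel" "A \<in> sets lborel" "ball (0::'a) 1 \<in> sets borel" using A by simp_all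
    have "(\<integral>\<^sup>+x. ennreal \<bar>h x\<bar> * indicator A x \<partial>lborel) \<le> (\<integral>\<^sup>+x. ennreal (norm x powr (- (\<beta> * r))) * indicator (ball 0 1) x + ennreal M * indicator A x \<partial>lborel)"
      by (intro nn_integral_mono) (use h_le in \<open>auto simp: indicator_def\<close>)
    also have "\<dots> = I0 + (\<integral>\<^sup>+x. ennreal M * indicator A x \<partial>lborel)"
      unfolding I0_def by (intro nn_integral_add) measurable
    finally show ?thesis by (simp add: nn_integral_cmult_indicator)
  qed
  have ul: "h \<in> L1_ul \<rho>"
    unfolding L1_ul_def L1_loc_def
  proof (intro CollectI conjI allI impI)
    fix A :: "'a set" assume A: "compact A"
    then have As[measurable]: "A \<in> sets borel" by (rule borel_compact)
    have "emeasure lborel A < \<infinity>" using A by (rule emeasure_compact_finite)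
    then have "I0 + ennreal M * emeasure lborel A < \<infinity>" using I0 by (simp add: ennreal_mult_less_top)
    then have fin: "(\<integral>\<^sup>+x. ennreal \<bar>h x\<bar> * indicator A x \<partial>lborel) < \<infinity>" using h_int[OF As] by (rule le_less_trans[rotated])
    have "integrable lborel (\<lambda>x. indicator A x *\<^sub>R h x)"
    proof (rule integrableI_bounded)
      show "(\<integral>\<^sup>+x. ennreal (norm (indicator A x *\<^sub>R h x)) \<partial>lborel) < \<infinity>"
      proof -
        have "ennreal (norm (indicator A x *\<^sub>R h x)) = ennreal \<bar>h x\<bar> * indicator A x" for x
          by (simp split: split_indicator)
        then show ?thesis using fin by (simp only:)
      qed
    qed measurable
    then show "h absolutely_integrable_on A"
      unfolding set_integrable_def by (subst integrable_completion) auto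
  next
    have "(SUP y. \<integral>\<^sup>+x\<in>ball y \<rho>. ennreal \<bar>h x\<bar> \<partial>lebesgue) \<le> I0 + ennreal M * ennreal (unit_ball_vol (real DIM('a)) * \<rho> ^ DIM('a))"
    proof (rule SUP_least)
      fix y :: 'a
      show "(\<integral>\<^sup>+x\<in>ball y \<rho>. ennreal \<bar>h x\<bar> \<partial>lebesgue) \<le> I0 + ennreal M * ennreal (unit_ball_vol (real DIM('a)) * \<rho> ^ DIM('a))"
        using h_int[of "ball y \<rho>"] \<rho> by (simp add: nn_integral_completion emeasure_ball)
    qed
    also have "\<dots> < \<infinity>" using I0 by (simp add: ennreal_mult_less_top)
    finally show "(SUP y. \<integral>\<^sup>+x\<in>ball y \<rho>. ennreal \<bar>h x\<bar> \<partial>lebesgue) < \<infinity>" .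
  qed
  obtain C where C: "C \<ge> 0" "\<And>t R. t > 0 \<Longrightarrow> R > 0 \<Longrightarrow>
      (\<integral>\<^sup>+y. ennreal (G \<theta> (y::'a) t) * indicator {y. R < norm y} y \<partial>lborel) \<le> ennreal (C * t * R powr (-\<theta>))"
    using G_tail[OF \<theta>, where 'a='a] by blast
  define p where "p x = Fr (\<phi> x) powr \<epsilon>" for x
  have [measurable]: "p \<in> borel_measurable borel" unfolding p_def by measurable
  define Q where "Q = P powr \<epsilon>"
  have Q: "Q > 0" using P by (simp add: Q_def)
  define C1 where "C1 = 2 powr \<kappa> + Q * C"
  let ?t = "\<lambda>t. t powr (\<kappa> / (\<theta> + \<kappa>))"
  have C1: "C1 > 0" using Q C by (simp add: C1_def add_pos_nonneg)
  \<comment> \<open>The average of p is split at distance R from x. Nearby, p is at most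
    \<open>(2 * R) powr \<kappa>\<close>; beyond R it is at most Q and the kernel has mass of order
    \<open>t * R powr (-\<theta>)\<close>. Balancing \<open>R powr \<kappa>\<close> with that mass
    gives \<open>R powr (\<theta> + \<kappa>) = t\<close>.\<close>
  have S_p: "S \<theta> t (\<lambda>y. ennreal (p y)) x \<le> ennreal (C1 * ?t t)"
    if t: "t > 0" and x: "norm x < t powr (1 / (\<theta> + \<kappa>))" for t and x :: 'a
  proof -
    define R where "R = t powr (1 / (\<theta> + \<kappa>))"
    have R: "R > 0" using t by (simp add: R_def)
    define E :: "'a \<Rightarrow> ennreal" where "E y = indicator {y. R < norm y} y" for y
    have [measurable]: "E \<in> borel_measurable borel" unfolding E_def by measurable
    have "S \<theta> t (\<lambda>y. ennreal (p y)) x \<le> S \<theta> t (\<lambda>y. ennreal ((2 * R) powr \<kappa>) + ennreal Q * E (x - y)) x"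
    proof (rule S_mono_AE)
      show "AE y in lborel. ennreal (p y) \<le> ennreal ((2 * R) powr \<kappa>) + ennreal Q * E (x - y)"
        using AE_lborel_singleton[of "0::'a"]
      proof eventually_elim
        case (elim y)
        have py: "p y = q y powr \<epsilon>" using elim by (simp add: p_def Fr_\<phi>)
        show ?case
        proof (cases "R < norm (x - y)")
          case True
          have "p y \<le> Q" unfolding py Q_def using q[OF elim] \<epsilon> by (intro powr_mono2) (auto simp: P_def)
          then have "ennreal (p y) \<le> ennreal Q * E (x - y)" using True by (simp add: E_def ennreal_leI)
          then show ?thesis by (rule order_trans) simp
        next
          case False
          have "norm y \<le> norm x + norm (x - y)" by (metis norm_minus_commute norm_triangle_sub)
          then have "norm y \<le> 2 * R" using False x by (simp add: R_def)
          then have "norm y powr \<kappa> \<le> (2 * R) powr \<kappa>" using \<kappa> by (intro powr_mono2) auto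
          moreover have "p y \<le> (norm y powr \<beta>) powr \<epsilon>"
            unfolding py using q[OF elim] \<epsilon> by (intro powr_mono2) (auto simp: q_def)
          ultimately have "p y \<le> (2 * R) powr \<kappa>" by (simp add: powr_powr \<kappa>_def)
          then show ?thesis by (simp add: ennreal_leI add_increasing2)
        qed
      qed
    qed
    also have "\<dots> = ennreal ((2 * R) powr \<kappa>) + ennreal Q * S \<theta> t (\<lambda>y. E (x - y)) x"
      by (simp add: S_add S_cmult S_const[OF \<theta> t])
    also have "S \<theta> t (\<lambda>y. E (x - y)) x = (\<integral>\<^sup>+y. ennreal (G \<theta> y t) * E y \<partial>lborel)"
      unfolding S_eq by (rule nn_integral_lborel_reflect[of "\<lambda>y. ennreal (G \<theta> y t) * E y" x]) measurable
    also have "ennreal ((2 * R) powr \<kappa>) + ennreal Q * (\<integral>\<^sup>+y. ennreal (G \<theta> y t) * E y \<partial>lborel) \<le> ennreal ((2 * R) powr \<kappa>) + ennreal Q * ennreal (C * t * R powr (-\<theta>))"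
      unfolding E_def by (intro add_left_mono mult_left_mono C(2) t R) simp
    also have "\<dots> = ennreal ((2 * R) powr \<kappa> + Q * (C * t * R powr (-\<theta>)))"
      using Q C t by (simp add: ennreal_mult[symmetric])
    also have "(2 * R) powr \<kappa> = 2 powr \<kappa> * ?t t"
      using R t by (simp add: powr_mult R_def powr_powr)
    also have "Q * (C * t * R powr (-\<theta>)) = Q * C * ?t t"
    proof -
      have "t * R powr (-\<theta>) = t powr (1 + - \<theta> / (\<theta> + \<kappa>))"
        using t powr_add[of t 1 "- \<theta> / (\<theta> + \<kappa>)"] by (simp add: R_def powr_powr)
      also have "1 + - \<theta> / (\<theta> + \<kappa>) = \<kappa> / (\<theta> + \<kappa>)" using \<theta> \<kappa> by (simp add: field_simps)
      finally show ?thesis by simp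
    qed
    also have "2 powr \<kappa> * ?t t + Q * C * ?t t = C1 * ?t t"
      by (simp add: C1_def distrib_right)
    finally show ?thesis .
  qed
  \<comment> \<open>This undoes the power \<epsilon>: since \<open>\<gamma> * \<epsilon>\<close> is
    \<kappa> / (\<theta> + \<kappa>), the bound on the average of \<open>Fr powr \<epsilon>\<close>
    becomes \<open>b * t powr \<gamma>\<close> for \<open>Fr\<close>.\<close>
  define b where "b = C1 powr (1 / \<epsilon>)"
  have b: "b > 0" using C1 by (simp add: b_def)
  have b\<epsilon>: "(b * t powr \<gamma>) powr \<epsilon> = C1 * ?t t" if "t > 0" for t
    using C1 \<epsilon> that by (simp add: powr_mult b_def powr_powr \<gamma>_def \<kappa>_def mult.commute)
  have "\<not> has_local_solution \<theta> f \<phi>"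
  proof
    assume "has_local_solution \<theta> f \<phi>"
    then obtain T u where T: "T > 0" and u: "integral_solution \<theta> f \<phi> T u" unfolding has_local_solution_def by auto
    obtain V where Vm: "(\<lambda>(x, t). V x t) \<in> borel_measurable (borel \<Otimes>\<^sub>M borel)"
      and Vfin: "\<And>t. 0 < t \<Longrightarrow> t < T \<Longrightarrow> AE x in lborel. V x t < \<infinity>"
      and Veq: "\<And>x t. 0 < t \<Longrightarrow> t < T \<Longrightarrow> V x t = duhamel \<theta> \<phi> V x t"
      using duhamel_of_integral_solution[OF u \<open>\<phi> \<in> _\<close>] by blast
    \<comment> \<open>In turn: t lies in the existence interval, \<open>Finv\<close> is defined at
      \<open>b * t powr \<gamma>\<close>, and \<open>b * t powr \<gamma> < t\<close>, which is
      possible because \<gamma> > 1.\<close>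
    have "\<forall>\<^sub>F t in at_right 0. t powr 1 < T \<and> t powr \<gamma> < P / b \<and> t powr (\<gamma> - 1) < 1 / b"
      using T P b \<gamma> by (intro eventually_conj eventually_at_right_powr_less) auto
    then obtain \<delta> where \<delta>: "\<delta> > 0" "\<And>t. 0 < t \<Longrightarrow> t < \<delta> \<Longrightarrow> t powr 1 < T \<and> t powr \<gamma> < P / b \<and> t powr (\<gamma> - 1) < 1 / b"
      unfolding eventually_at_right_field by auto
    define t where "t = \<delta> / 2"
    have t: "0 < t" and small: "t powr 1 < T" "t powr \<gamma> < P / b" "t powr (\<gamma> - 1) < 1 / b"
      using \<delta>(2)[of "\<delta> / 2"] \<delta>(1) by (auto simp: t_def)
    have tT: "t < T" using small t by simp
    define R where "R = t powr (1 / (\<theta> + \<kappa>))"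
    have R: "R > 0" using t by (simp add: R_def)
    \<comment> \<open>A single point of finiteness is enough for \<open>lifespan_bound\<close>. It
      has to lie within R of the origin for \<open>S_p\<close>, and it exists because the ball is
      not a null set.\<close>
    have "\<exists>x\<in>ball 0 R. V x t < \<infinity>"
    proof (rule ccontr)
      assume "\<not> ?thesis"
      then have "AE x in lborel. x \<notin> ball (0::'a) R" using Vfin[OF t tT] by (elim eventually_mono) auto
      then have "emeasure lborel {x \<in> space lborel. x \<in> ball (0::'a) R} = 0" by (rule emeasure_eq_0_AE)
      moreover have "{x \<in> space lborel. x \<in> ball (0::'a) R} = ball 0 R" by auto
      ultimately have "ennreal (unit_ball_vol (real DIM('a)) * R ^ DIM('a)) = 0"
        using R by (simp only: emeasure_ball[OF less_imp_le])
      moreover have "unit_ball_vol (real DIM('a)) * R ^ DIM('a) > 0" using R by simp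
      ultimately show False by (simp add: ennreal_eq_0_iff)
    qed
    then obtain x where x: "norm x < R" "V x t < \<infinity>" by auto
    let ?S = "S \<theta> t (\<lambda>y. ennreal (\<phi> y)) x"
    have bt: "0 < b * t powr \<gamma>" "b * t powr \<gamma> \<le> Fr c" using small b t by (auto simp: field_simps P_def)
    \<comment> \<open>The tangent to \<open>Fr powr \<epsilon>\<close> is taken at the level that
      matches the bound of \<open>S_p\<close>, so Jensen's inequality yields that the average of
      \<phi> is at least a.\<close>
    define a where "a = Finv (b * t powr \<gamma>)"
    have a: "a \<ge> c" "Fr a = b * t powr \<gamma>" "a > 0" using Finv[OF c0 bt] by (auto simp: a_def)
    have "ennreal a \<le> ?S"
    proof (rule S_ge_of_tangent[OF \<theta> t])
      let ?m = "\<epsilon> * Fr a powr (\<epsilon> - 1) / f a"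
      show "?m > 0" using \<epsilon> Fr_pos[OF a(3)] pos[OF a(3)] by simp
      show "S \<theta> t (\<lambda>y. ennreal (p y)) x \<le> ennreal (Fr a powr \<epsilon>)"
        unfolding a(2) b\<epsilon>[OF t] by (rule S_p[OF t x(1)[unfolded R_def]])
      show "Fr a powr \<epsilon> + ?m * a \<le> p y + ?m * \<phi> y" for y
      proof -
        have "Fr a powr \<epsilon> + - \<epsilon> * Fr a powr (\<epsilon> - 1) / f a * (\<phi> y - a) \<le> Fr (\<phi> y) powr \<epsilon>"
          by (rule Fr_powr_tangent[OF c0 c2 \<epsilon> a(1) \<phi>c])
        moreover have "- \<epsilon> * Fr a powr (\<epsilon> - 1) / f a * (\<phi> y - a) = - (?m * (\<phi> y - a))" by simp
        moreover have "- (?m * (\<phi> y - a)) = ?m * a - ?m * \<phi> y" by (simp only: right_diff_distrib minus_diff_eq)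
        ultimately show ?thesis unfolding p_def by linarith
      qed
    qed (use a \<phi>pos in \<open>auto simp: p_def intro: less_imp_le\<close>)
    moreover have "?S \<le> V x t"
      unfolding Veq[OF t tT] duhamel_def by simp
    then have "?S < \<infinity>" using x(2) by (rule le_less_trans)
    then obtain z where z: "?S = ennreal z" "z \<ge> 0"
      by (cases "?S") auto
    ultimately have az: "a \<le> z" by simp
    have "t \<le> Fr z"
      using az a(3) by (intro lifespan_bound[OF \<theta> conv \<open>\<phi> \<in> _\<close> Vm Vfin Veq t tT x(2) z(1)]) auto
    also have "\<dots> \<le> Fr a" by (rule Fr_antimono[OF a(3) az])
    also have "\<dots> = b * t powr (\<gamma> - 1) * t" using a(2) t by (simp add: powr_diff)
    also have "\<dots> < 1 * t" using small(3) b t by (intro mult_strict_right_mono) (auto simp: field_simps)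
    finally show False by simp
  qed
  moreover have "\<phi> \<in> borel_measurable lebesgue"
    by (rule measurable_completion) simp
  moreover have "\<forall>x. 0 \<le> \<phi> x" using \<phi>pos by (auto intro: less_imp_le)
  ultimately show ?thesis using ul unfolding h_def[abs_def] by blast
qed

end

theorem theorem1p6:
  fixes \<theta> \<rho> :: real and f :: "real \<Rightarrow> real"
  assumes "0 < \<theta>" and "\<theta> \<le> 2" and "0 < \<rho>"
    and "f C1_differentiable_on {0<..}" and "continuous_on {0..} f"
    and "\<And>u. u > 0 \<Longrightarrow> f u > 0"
    and "\<And>u. u > 0 \<Longrightarrow> deriv f u \<ge> 0"
    and "\<forall>\<^sub>F u in at_top. F_of f u < \<infinity>"
    and "((\<lambda>u. deriv f u * enn2real (F_of f u)) \<longlongrightarrow> 1) at_top"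
  shows
    "(\<forall>r. r > real DIM('a) / \<theta> \<longrightarrow>
          (\<exists>c\<ge>0. convex_on {c..} f) \<longrightarrow>
          (\<forall>\<^sub>F u in at_top. deriv f u * enn2real (F_of f u) \<le> 1) \<longrightarrow>
          (\<forall>\<phi> :: 'a::euclidean_space \<Rightarrow> real.
             \<phi> \<in> borel_measurable lebesgue \<longrightarrow> (\<forall>x. 0 \<le> \<phi> x) \<longrightarrow>
             (\<lambda>x. F_neg_pow f r (\<phi> x)) \<in> L1_ul \<rho> \<longrightarrow>
             has_local_solution \<theta> f \<phi>)) \<and>
     (convex_on {0..} f \<longrightarrow>
        (\<forall>r. 0 < r \<and> r < real DIM('a) / \<theta> \<longrightarrow>
          (\<exists>\<phi> :: 'a \<Rightarrow> real.
             \<phi> \<in> borel_measurable lebesgue \<and> (\<forall>x. 0 \<le> \<phi> x) \<and>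
             (\<lambda>x. F_neg_pow f r (\<phi> x)) \<in> L1_ul \<rho> \<and>
             \<not> has_local_solution \<theta> f \<phi>)))"
proof -
  interpret nonlinearity f
    by standard (use assms in auto)
  show ?thesis
    using local_existence[OF assms(1-3)] nonexistence[OF assms(1-3)] by blast
qed

end
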